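(* Let $\mathcal{X}$ and $\mathcal{A}$ be 2-categories and let $G:\mathcal{A}\to\mathcal{X}$ be a pseudo functor. Then there exists a left biadjoint for $G$ if and only if for every object $X$ of $\mathcal{X}$ there exist an object $R$ of $\mathcal{A}$ and a biuniversal arrow $\eta_X:X\to G(R)$ from $X$ to $G$.
   Context: 2-categories are strict and small. Pseudo functors and pseudo natural transformations are taken in the usual sense, always with invertible coherence 2-cells. Biuniversal arrow: let $S:\mathcal{D}\to\mathcal{C}$ be a pseudo functor and $C$ an object of $\mathcal{C}$. An object $R$ of $\mathcal{D}$ together with a morphism $u:C\to SR$ is a biuniversal arrow from $C$ to $S$ if for every object $D$ of $\mathcal{D}$ the functor $Mor_{\mathcal{D}}(R,D)\to Mor_{\mathcal{C}}(C,SD)$, $f'\mapsto Sf'\circ u$, $\gamma\mapsto S\gamma * i_u$, is an equivalence of categories. Biadjunction: a biadjunction $\langle F,G,\phi\rangle:\mathcal{X}\rightharpoonup\mathcal{A}$ consists of pseudo functors $F:\mathcal{X}\to\mathcal{A}$ and $G:\mathcal{A}\to\mathcal{X}$ and, for all objects $X$ of $\mathcal{X}$ and $A$ of $\mathcal{A}$, an equivalence of categories $\phi_{X,A}:Mor_{\mathcal{A}}(FX,A)\to Mor_{\mathcal{X}}(X,GA)$, such that $\phi$ is pseudo natural in each variable (between the pseudo functors $Mor_{\mathcal{A}}(F-,-)$ and $Mor_{\mathcal{X}}(-,G-)$ on $\mathcal{X}^{op}\times\mathcal{A}$ with values in $Cat$). Then $F$ is called a left biadjoint for $G$. *)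

theory Defs
  imports Main
begin

section \<open>Categories, functors, natural transformations\<close>

record ('a, 'f) cat_data =
  Obj :: "'a set"
  Arr :: "'f set"
  Dom :: "'f \<Rightarrow> 'a"
  Cod :: "'f \<Rightarrow> 'a"
  Ide :: "'a \<Rightarrow> 'f"
  Cmp :: "'f \<Rightarrow> 'f \<Rightarrow> 'f"  (infixr "\<odot>\<index>" 70)

locale category =
  fixes C :: "('a, 'f) cat_data"  (structure)
  assumes Dom_Obj: "f \<in> Arr C \<Longrightarrow> Dom C f \<in> Obj C"
    and Cod_Obj: "f \<in> Arr C \<Longrightarrow> Cod C f \<in> Obj C"
    and Ide_Arr: "a \<in> Obj C \<Longrightarrow> Ide C a \<in> Arr C"
    and Dom_Ide: "a \<in> Obj C \<Longrightarrow> Dom C (Ide C a) = a"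
    and Cod_Ide: "a \<in> Obj C \<Longrightarrow> Cod C (Ide C a) = a"
    and Cmp_Arr: "\<lbrakk>g \<in> Arr C; f \<in> Arr C; Dom C g = Cod C f\<rbrakk> \<Longrightarrow> g \<odot> f \<in> Arr C"
    and Dom_Cmp: "\<lbrakk>g \<in> Arr C; f \<in> Arr C; Dom C g = Cod C f\<rbrakk> \<Longrightarrow> Dom C (g \<odot> f) = Dom C f"
    and Cod_Cmp: "\<lbrakk>g \<in> Arr C; f \<in> Arr C; Dom C g = Cod C f\<rbrakk> \<Longrightarrow> Cod C (g \<odot> f) = Cod C g"
    and Cmp_Ide: "f \<in> Arr C \<Longrightarrow> f \<odot> Ide C (Dom C f) = f"
    and Ide_Cmp: "f \<in> Arr C \<Longrightarrow> Ide C (Cod C f) \<odot> f = f"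
    and Cmp_assoc: "\<lbrakk>h \<in> Arr C; g \<in> Arr C; f \<in> Arr C; Dom C h = Cod C g; Dom C g = Cod C f\<rbrakk>
      \<Longrightarrow> (h \<odot> g) \<odot> f = h \<odot> (g \<odot> f)"

definition invertible :: "('a, 'f) cat_data \<Rightarrow> 'f \<Rightarrow> bool" where
  "invertible C f \<longleftrightarrow> f \<in> Arr C \<and>
     (\<exists>g \<in> Arr C. Dom C g = Cod C f \<and> Cod C g = Dom C f \<and>
        g \<odot>\<^bsub>C\<^esub> f = Ide C (Dom C f) \<and> f \<odot>\<^bsub>C\<^esub> g = Ide C (Cod C f))"

record ('a, 'f, 'b, 'g) functor_data =
  on_obj :: "'a \<Rightarrow> 'b"
  on_arr :: "'f \<Rightarrow> 'g"

locale is_functor =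
  C: category C + D: category D
  for C :: "('a, 'f) cat_data" and D :: "('b, 'g) cat_data" +
  fixes F :: "('a, 'f, 'b, 'g) functor_data"
  assumes on_obj_Obj: "a \<in> Obj C \<Longrightarrow> on_obj F a \<in> Obj D"
    and on_arr_Arr: "f \<in> Arr C \<Longrightarrow> on_arr F f \<in> Arr D"
    and Dom_on_arr: "f \<in> Arr C \<Longrightarrow> Dom D (on_arr F f) = on_obj F (Dom C f)"
    and Cod_on_arr: "f \<in> Arr C \<Longrightarrow> Cod D (on_arr F f) = on_obj F (Cod C f)"
    and on_arr_Ide: "a \<in> Obj C \<Longrightarrow> on_arr F (Ide C a) = Ide D (on_obj F a)"
    and on_arr_Cmp: "\<lbrakk>g \<in> Arr C; f \<in> Arr C; Dom C g = Cod C f\<rbrakk>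
      \<Longrightarrow> on_arr F (g \<odot>\<^bsub>C\<^esub> f) = on_arr F g \<odot>\<^bsub>D\<^esub> on_arr F f"

definition functor_id :: "('a, 'f, 'a, 'f) functor_data" where
  "functor_id = \<lparr>on_obj = \<lambda>a. a, on_arr = \<lambda>f. f\<rparr>"

definition functor_comp ::
  "('b, 'g, 'c, 'h) functor_data \<Rightarrow> ('a, 'f, 'b, 'g) functor_data \<Rightarrow> ('a, 'f, 'c, 'h) functor_data"
  where "functor_comp G F = \<lparr>on_obj = \<lambda>a. on_obj G (on_obj F a), on_arr = \<lambda>f. on_arr G (on_arr F f)\<rparr>"

locale nat_trans =
  S: is_functor C D S + T: is_functor C D T
  for C :: "('a, 'f) cat_data" and D :: "('b, 'g) cat_data"
    and S T :: "('a, 'f, 'b, 'g) functor_data" +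
  fixes t :: "'a \<Rightarrow> 'g"
  assumes component_Arr: "a \<in> Obj C \<Longrightarrow> t a \<in> Arr D"
    and Dom_component: "a \<in> Obj C \<Longrightarrow> Dom D (t a) = on_obj S a"
    and Cod_component: "a \<in> Obj C \<Longrightarrow> Cod D (t a) = on_obj T a"
    and naturality: "f \<in> Arr C \<Longrightarrow>
      t (Cod C f) \<odot>\<^bsub>D\<^esub> on_arr S f = on_arr T f \<odot>\<^bsub>D\<^esub> t (Dom C f)"

locale nat_iso =
  nat_trans C D S T t
  for C :: "('a, 'f) cat_data" and D :: "('b, 'g) cat_data"
    and S T :: "('a, 'f, 'b, 'g) functor_data" and t :: "'a \<Rightarrow> 'g" +
  assumes component_invertible: "a \<in> Obj C \<Longrightarrow> invertible D (t a)"

definition equivalence_of_categories ::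
  "('a, 'f) cat_data \<Rightarrow> ('b, 'g) cat_data \<Rightarrow> ('a, 'f, 'b, 'g) functor_data \<Rightarrow> bool" where
  "equivalence_of_categories C D F \<longleftrightarrow> is_functor C D F \<and>
     (\<exists>G s t. is_functor D C G \<and>
        nat_iso C C functor_id (functor_comp G F) s \<and>
        nat_iso D D (functor_comp F G) functor_id t)"


section \<open>Strict 2-categories\<close>

text \<open>
  \<open>vdom\<close> and \<open>vcod\<close> give the source and target 1-cell of a 2-cell; \<open>\<cdot>\<close> composes 1-cells,
  \<open>\<bullet>\<close> composes 2-cells vertically and \<open>\<star>\<close> horizontally, all in the order of function composition.
\<close>

record ('o, 'm, 'c) two_cat_data =
  Ob :: "'o set"
  Ar :: "'m set"
  Cl :: "'c set"
  src :: "'m \<Rightarrow> 'o"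
  tgt :: "'m \<Rightarrow> 'o"
  vdom :: "'c \<Rightarrow> 'm"
  vcod :: "'c \<Rightarrow> 'm"
  one :: "'o \<Rightarrow> 'm"
  idc :: "'m \<Rightarrow> 'c"
  comp1 :: "'m \<Rightarrow> 'm \<Rightarrow> 'm"  (infixr "\<cdot>\<index>" 75)
  vcomp :: "'c \<Rightarrow> 'c \<Rightarrow> 'c"  (infixr "\<bullet>\<index>" 70)
  hcomp :: "'c \<Rightarrow> 'c \<Rightarrow> 'c"  (infixr "\<star>\<index>" 75)

definition arrow_cat :: "('o, 'm, 'c) two_cat_data \<Rightarrow> ('o, 'm) cat_data" where
  "arrow_cat C = \<lparr>Obj = Ob C, Arr = Ar C, Dom = src C, Cod = tgt C, Ide = one C, Cmp = comp1 C\<rparr>"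

definition vertical_cat :: "('o, 'm, 'c) two_cat_data \<Rightarrow> ('m, 'c) cat_data" where
  "vertical_cat C = \<lparr>Obj = Ar C, Arr = Cl C, Dom = vdom C, Cod = vcod C, Ide = idc C, Cmp = vcomp C\<rparr>"

definition horizontal_cat :: "('o, 'm, 'c) two_cat_data \<Rightarrow> ('o, 'c) cat_data" where
  "horizontal_cat C = \<lparr>Obj = Ob C, Arr = Cl C, Dom = \<lambda>\<alpha>. src C (vdom C \<alpha>),
     Cod = \<lambda>\<alpha>. tgt C (vdom C \<alpha>), Ide = \<lambda>a. idc C (one C a), Cmp = hcomp C\<rparr>"

locale two_category =
  fixes C :: "('o, 'm, 'c) two_cat_data"  (structure)
  assumes arrow_category: "category (arrow_cat C)"
    and vertical_category: "category (vertical_cat C)"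
    and horizontal_category: "category (horizontal_cat C)"
    and src_vcod: "\<alpha> \<in> Cl C \<Longrightarrow> src C (vcod C \<alpha>) = src C (vdom C \<alpha>)"
    and tgt_vcod: "\<alpha> \<in> Cl C \<Longrightarrow> tgt C (vcod C \<alpha>) = tgt C (vdom C \<alpha>)"
    and vdom_hcomp: "\<lbrakk>\<beta> \<in> Cl C; \<alpha> \<in> Cl C; src C (vdom C \<beta>) = tgt C (vdom C \<alpha>)\<rbrakk>
      \<Longrightarrow> vdom C (\<beta> \<star> \<alpha>) = vdom C \<beta> \<cdot> vdom C \<alpha>"
    and vcod_hcomp: "\<lbrakk>\<beta> \<in> Cl C; \<alpha> \<in> Cl C; src C (vdom C \<beta>) = tgt C (vdom C \<alpha>)\<rbrakk>
      \<Longrightarrow> vcod C (\<beta> \<star> \<alpha>) = vcod C \<beta> \<cdot> vcod C \<alpha>"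
    and hcomp_idc: "\<lbrakk>g \<in> Ar C; f \<in> Ar C; src C g = tgt C f\<rbrakk>
      \<Longrightarrow> idc C g \<star> idc C f = idc C (g \<cdot> f)"
    and interchange: "\<lbrakk>\<beta>' \<in> Cl C; \<beta> \<in> Cl C; \<alpha>' \<in> Cl C; \<alpha> \<in> Cl C;
        vdom C \<beta>' = vcod C \<beta>; vdom C \<alpha>' = vcod C \<alpha>; src C (vdom C \<beta>) = tgt C (vdom C \<alpha>)\<rbrakk>
      \<Longrightarrow> (\<beta>' \<bullet> \<beta>) \<star> (\<alpha>' \<bullet> \<alpha>) = (\<beta>' \<star> \<alpha>') \<bullet> (\<beta> \<star> \<alpha>)"

definition Mor :: "('o, 'm, 'c) two_cat_data \<Rightarrow> 'o \<Rightarrow> 'o \<Rightarrow> ('m, 'c) cat_data" where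
  "Mor C a b = \<lparr>Obj = {f \<in> Ar C. src C f = a \<and> tgt C f = b},
     Arr = {\<alpha> \<in> Cl C. src C (vdom C \<alpha>) = a \<and> tgt C (vdom C \<alpha>) = b},
     Dom = vdom C, Cod = vcod C, Ide = idc C, Cmp = vcomp C\<rparr>"

text \<open>\<open>op2\<close> reverses the 1-cells and keeps the direction of the 2-cells.\<close>

definition op2 :: "('o, 'm, 'c) two_cat_data \<Rightarrow> ('o, 'm, 'c) two_cat_data" where
  "op2 C = \<lparr>Ob = Ob C, Ar = Ar C, Cl = Cl C, src = tgt C, tgt = src C,
     vdom = vdom C, vcod = vcod C, one = one C, idc = idc C,
     comp1 = \<lambda>g f. f \<cdot>\<^bsub>C\<^esub> g, vcomp = vcomp C, hcomp = \<lambda>\<beta> \<alpha>. \<alpha> \<star>\<^bsub>C\<^esub> \<beta>\<rparr>"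

definition prod2 :: "('o, 'm, 'c) two_cat_data \<Rightarrow> ('p, 'n, 'd) two_cat_data
    \<Rightarrow> ('o \<times> 'p, 'm \<times> 'n, 'c \<times> 'd) two_cat_data" where
  "prod2 C D = \<lparr>Ob = Ob C \<times> Ob D, Ar = Ar C \<times> Ar D, Cl = Cl C \<times> Cl D,
     src = map_prod (src C) (src D), tgt = map_prod (tgt C) (tgt D),
     vdom = map_prod (vdom C) (vdom D), vcod = map_prod (vcod C) (vcod D),
     one = map_prod (one C) (one D), idc = map_prod (idc C) (idc D),
     comp1 = \<lambda>g f. (fst g \<cdot>\<^bsub>C\<^esub> fst f, snd g \<cdot>\<^bsub>D\<^esub> snd f),
     vcomp = \<lambda>\<beta> \<alpha>. (fst \<beta> \<bullet>\<^bsub>C\<^esub> fst \<alpha>, snd \<beta> \<bullet>\<^bsub>D\<^esub> snd \<alpha>),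
     hcomp = \<lambda>\<beta> \<alpha>. (fst \<beta> \<star>\<^bsub>C\<^esub> fst \<alpha>, snd \<beta> \<star>\<^bsub>D\<^esub> snd \<alpha>)\<rparr>"


section \<open>Pseudo functors\<close>

text \<open>
  The coherence 2-cells of a pseudo functor \<open>F\<close> are
  \<open>pf_comp F g f : F g \<cdot> F f \<Rightarrow> F (g \<cdot> f)\<close> and \<open>pf_unit F a : 1\<^bsub>F a\<^esub> \<Rightarrow> F 1\<^bsub>a\<^esub>\<close>.
\<close>

record ('o, 'm, 'c, 'p, 'n, 'd) pseudo_functor_data =
  pf_ob :: "'o \<Rightarrow> 'p"
  pf_ar :: "'m \<Rightarrow> 'n"
  pf_cl :: "'c \<Rightarrow> 'd"
  pf_comp :: "'m \<Rightarrow> 'm \<Rightarrow> 'd"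
  pf_unit :: "'o \<Rightarrow> 'd"

locale pseudo_functor =
  C: two_category C + D: two_category D
  for C :: "('o, 'm, 'c) two_cat_data" and D :: "('p, 'n, 'd) two_cat_data" +
  fixes F :: "('o, 'm, 'c, 'p, 'n, 'd) pseudo_functor_data"
  assumes pf_ob: "a \<in> Ob C \<Longrightarrow> pf_ob F a \<in> Ob D"
    and pf_ar: "f \<in> Ar C \<Longrightarrow> pf_ar F f \<in> Ar D"
    and src_pf_ar: "f \<in> Ar C \<Longrightarrow> src D (pf_ar F f) = pf_ob F (src C f)"
    and tgt_pf_ar: "f \<in> Ar C \<Longrightarrow> tgt D (pf_ar F f) = pf_ob F (tgt C f)"
    and pf_cl: "\<alpha> \<in> Cl C \<Longrightarrow> pf_cl F \<alpha> \<in> Cl D"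
    and vdom_pf_cl: "\<alpha> \<in> Cl C \<Longrightarrow> vdom D (pf_cl F \<alpha>) = pf_ar F (vdom C \<alpha>)"
    and vcod_pf_cl: "\<alpha> \<in> Cl C \<Longrightarrow> vcod D (pf_cl F \<alpha>) = pf_ar F (vcod C \<alpha>)"
    and pf_cl_idc: "f \<in> Ar C \<Longrightarrow> pf_cl F (idc C f) = idc D (pf_ar F f)"
    and pf_cl_vcomp: "\<lbrakk>\<beta> \<in> Cl C; \<alpha> \<in> Cl C; vdom C \<beta> = vcod C \<alpha>\<rbrakk>
      \<Longrightarrow> pf_cl F (\<beta> \<bullet>\<^bsub>C\<^esub> \<alpha>) = pf_cl F \<beta> \<bullet>\<^bsub>D\<^esub> pf_cl F \<alpha>"
    and pf_comp_invertible: "\<lbrakk>g \<in> Ar C; f \<in> Ar C; src C g = tgt C f\<rbrakk>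
      \<Longrightarrow> invertible (vertical_cat D) (pf_comp F g f)"
    and vdom_pf_comp: "\<lbrakk>g \<in> Ar C; f \<in> Ar C; src C g = tgt C f\<rbrakk>
      \<Longrightarrow> vdom D (pf_comp F g f) = pf_ar F g \<cdot>\<^bsub>D\<^esub> pf_ar F f"
    and vcod_pf_comp: "\<lbrakk>g \<in> Ar C; f \<in> Ar C; src C g = tgt C f\<rbrakk>
      \<Longrightarrow> vcod D (pf_comp F g f) = pf_ar F (g \<cdot>\<^bsub>C\<^esub> f)"
    and pf_comp_natural: "\<lbrakk>\<beta> \<in> Cl C; \<alpha> \<in> Cl C; src C (vdom C \<beta>) = tgt C (vdom C \<alpha>)\<rbrakk>
      \<Longrightarrow> pf_comp F (vcod C \<beta>) (vcod C \<alpha>) \<bullet>\<^bsub>D\<^esub> (pf_cl F \<beta> \<star>\<^bsub>D\<^esub> pf_cl F \<alpha>)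
        = pf_cl F (\<beta> \<star>\<^bsub>C\<^esub> \<alpha>) \<bullet>\<^bsub>D\<^esub> pf_comp F (vdom C \<beta>) (vdom C \<alpha>)"
    and pf_unit_invertible: "a \<in> Ob C \<Longrightarrow> invertible (vertical_cat D) (pf_unit F a)"
    and vdom_pf_unit: "a \<in> Ob C \<Longrightarrow> vdom D (pf_unit F a) = one D (pf_ob F a)"
    and vcod_pf_unit: "a \<in> Ob C \<Longrightarrow> vcod D (pf_unit F a) = pf_ar F (one C a)"
    and pf_unit_right: "f \<in> Ar C \<Longrightarrow>
      pf_comp F f (one C (src C f)) \<bullet>\<^bsub>D\<^esub> (idc D (pf_ar F f) \<star>\<^bsub>D\<^esub> pf_unit F (src C f))
        = idc D (pf_ar F f)"
    and pf_unit_left: "f \<in> Ar C \<Longrightarrow>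
      pf_comp F (one C (tgt C f)) f \<bullet>\<^bsub>D\<^esub> (pf_unit F (tgt C f) \<star>\<^bsub>D\<^esub> idc D (pf_ar F f))
        = idc D (pf_ar F f)"
    and pf_assoc: "\<lbrakk>h \<in> Ar C; g \<in> Ar C; f \<in> Ar C; src C h = tgt C g; src C g = tgt C f\<rbrakk>
      \<Longrightarrow> pf_comp F h (g \<cdot>\<^bsub>C\<^esub> f) \<bullet>\<^bsub>D\<^esub> (idc D (pf_ar F h) \<star>\<^bsub>D\<^esub> pf_comp F g f)
        = pf_comp F (h \<cdot>\<^bsub>C\<^esub> g) f \<bullet>\<^bsub>D\<^esub> (pf_comp F h g \<star>\<^bsub>D\<^esub> idc D (pf_ar F f))"

definition pf_id :: "('o, 'm, 'c) two_cat_data \<Rightarrow> ('o, 'm, 'c, 'o, 'm, 'c) pseudo_functor_data" where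
  "pf_id C = \<lparr>pf_ob = \<lambda>a. a, pf_ar = \<lambda>f. f, pf_cl = \<lambda>\<alpha>. \<alpha>,
     pf_comp = \<lambda>g f. idc C (g \<cdot>\<^bsub>C\<^esub> f), pf_unit = \<lambda>a. idc C (one C a)\<rparr>"


section \<open>Pseudo functors and pseudo natural transformations with values in \<open>Cat\<close>\<close>

text \<open>
  There is no type of all small categories, so the notions of pseudo functor \<open>K \<rightarrow> Cat\<close> and of
  pseudo natural transformation between two of them are the definitions of the general notions for
  the target 2-category \<open>Cat\<close>, with equations of natural transformations written componentwise.
  The object and arrow types of the categories in the image may differ from one such pseudo
  functor to the other.  Thus \<open>cpf_cl P \<alpha>\<close>, \<open>cpf_comp P g f\<close> and \<open>cpf_unit P k\<close> are families of
  components, indexed by the objects \<open>x\<close> of \<open>P (src \<alpha>)\<close>, \<open>P (src f)\<close> and \<open>P k\<close> respectively.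
\<close>

record ('o, 'm, 'c, 'a, 'f) cat_pseudo_functor_data =
  cpf_ob :: "'o \<Rightarrow> ('a, 'f) cat_data"
  cpf_ar :: "'m \<Rightarrow> ('a, 'f, 'a, 'f) functor_data"
  cpf_cl :: "'c \<Rightarrow> 'a \<Rightarrow> 'f"
  cpf_comp :: "'m \<Rightarrow> 'm \<Rightarrow> 'a \<Rightarrow> 'f"
  cpf_unit :: "'o \<Rightarrow> 'a \<Rightarrow> 'f"

locale cat_pseudo_functor =
  K: two_category K
  for K :: "('o, 'm, 'c) two_cat_data" +
  fixes P :: "('o, 'm, 'c, 'a, 'f) cat_pseudo_functor_data"
  assumes cpf_ob: "k \<in> Ob K \<Longrightarrow> category (cpf_ob P k)"
    and cpf_ar: "f \<in> Ar K \<Longrightarrow>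
      is_functor (cpf_ob P (src K f)) (cpf_ob P (tgt K f)) (cpf_ar P f)"
    and cpf_cl: "\<alpha> \<in> Cl K \<Longrightarrow>
      nat_trans (cpf_ob P (src K (vdom K \<alpha>))) (cpf_ob P (tgt K (vdom K \<alpha>)))
        (cpf_ar P (vdom K \<alpha>)) (cpf_ar P (vcod K \<alpha>)) (cpf_cl P \<alpha>)"
    and cpf_cl_idc: "\<lbrakk>f \<in> Ar K; x \<in> Obj (cpf_ob P (src K f))\<rbrakk> \<Longrightarrow>
      cpf_cl P (idc K f) x = Ide (cpf_ob P (tgt K f)) (on_obj (cpf_ar P f) x)"
    and cpf_cl_vcomp: "\<lbrakk>\<beta> \<in> Cl K; \<alpha> \<in> Cl K; vdom K \<beta> = vcod K \<alpha>;
        x \<in> Obj (cpf_ob P (src K (vdom K \<alpha>)))\<rbrakk> \<Longrightarrow>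
      cpf_cl P (\<beta> \<bullet>\<^bsub>K\<^esub> \<alpha>) x
        = cpf_cl P \<beta> x \<odot>\<^bsub>cpf_ob P (tgt K (vdom K \<alpha>))\<^esub> cpf_cl P \<alpha> x"
    and cpf_comp: "\<lbrakk>g \<in> Ar K; f \<in> Ar K; src K g = tgt K f\<rbrakk> \<Longrightarrow>
      nat_iso (cpf_ob P (src K f)) (cpf_ob P (tgt K g))
        (functor_comp (cpf_ar P g) (cpf_ar P f)) (cpf_ar P (g \<cdot>\<^bsub>K\<^esub> f)) (cpf_comp P g f)"
    and cpf_comp_natural: "\<lbrakk>\<beta> \<in> Cl K; \<alpha> \<in> Cl K; src K (vdom K \<beta>) = tgt K (vdom K \<alpha>);
        x \<in> Obj (cpf_ob P (src K (vdom K \<alpha>)))\<rbrakk> \<Longrightarrow>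
      cpf_comp P (vcod K \<beta>) (vcod K \<alpha>) x \<odot>\<^bsub>cpf_ob P (tgt K (vdom K \<beta>))\<^esub>
        (cpf_cl P \<beta> (on_obj (cpf_ar P (vcod K \<alpha>)) x) \<odot>\<^bsub>cpf_ob P (tgt K (vdom K \<beta>))\<^esub>
          on_arr (cpf_ar P (vdom K \<beta>)) (cpf_cl P \<alpha> x))
      = cpf_cl P (\<beta> \<star>\<^bsub>K\<^esub> \<alpha>) x \<odot>\<^bsub>cpf_ob P (tgt K (vdom K \<beta>))\<^esub>
        cpf_comp P (vdom K \<beta>) (vdom K \<alpha>) x"
    and cpf_unit: "k \<in> Ob K \<Longrightarrow>
      nat_iso (cpf_ob P k) (cpf_ob P k) functor_id (cpf_ar P (one K k)) (cpf_unit P k)"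
    and cpf_unit_right: "\<lbrakk>f \<in> Ar K; x \<in> Obj (cpf_ob P (src K f))\<rbrakk> \<Longrightarrow>
      cpf_comp P f (one K (src K f)) x \<odot>\<^bsub>cpf_ob P (tgt K f)\<^esub>
        on_arr (cpf_ar P f) (cpf_unit P (src K f) x)
      = Ide (cpf_ob P (tgt K f)) (on_obj (cpf_ar P f) x)"
    and cpf_unit_left: "\<lbrakk>f \<in> Ar K; x \<in> Obj (cpf_ob P (src K f))\<rbrakk> \<Longrightarrow>
      cpf_comp P (one K (tgt K f)) f x \<odot>\<^bsub>cpf_ob P (tgt K f)\<^esub>
        cpf_unit P (tgt K f) (on_obj (cpf_ar P f) x)
      = Ide (cpf_ob P (tgt K f)) (on_obj (cpf_ar P f) x)"
    and cpf_assoc: "\<lbrakk>h \<in> Ar K; g \<in> Ar K; f \<in> Ar K; src K h = tgt K g; src K g = tgt K f;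
        x \<in> Obj (cpf_ob P (src K f))\<rbrakk> \<Longrightarrow>
      cpf_comp P h (g \<cdot>\<^bsub>K\<^esub> f) x \<odot>\<^bsub>cpf_ob P (tgt K h)\<^esub>
        on_arr (cpf_ar P h) (cpf_comp P g f x)
      = cpf_comp P (h \<cdot>\<^bsub>K\<^esub> g) f x \<odot>\<^bsub>cpf_ob P (tgt K h)\<^esub>
        cpf_comp P h g (on_obj (cpf_ar P f) x)"

text \<open>
  The coherence 2-cell of \<open>\<phi> : P \<Rightarrow> Q\<close> at \<open>f : k \<rightarrow> l\<close> is a natural isomorphism
  \<open>cpt_ar \<phi> f : Q f \<circ> \<phi>\<^bsub>k\<^esub> \<Rightarrow> \<phi>\<^bsub>l\<^esub> \<circ> P f\<close>, where \<open>\<phi>\<^bsub>k\<^esub>\<close> is \<open>cpt_ob \<phi> k\<close>.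
\<close>

record ('o, 'm, 'a, 'f, 'b, 'g) cat_pseudo_nat_data =
  cpt_ob :: "'o \<Rightarrow> ('a, 'f, 'b, 'g) functor_data"
  cpt_ar :: "'m \<Rightarrow> 'a \<Rightarrow> 'g"

locale cat_pseudo_nat_trans =
  P: cat_pseudo_functor K P + Q: cat_pseudo_functor K Q
  for K :: "('o, 'm, 'c) two_cat_data"
    and P :: "('o, 'm, 'c, 'a, 'f) cat_pseudo_functor_data"
    and Q :: "('o, 'm, 'c, 'b, 'g) cat_pseudo_functor_data" +
  fixes \<phi> :: "('o, 'm, 'a, 'f, 'b, 'g) cat_pseudo_nat_data"
  assumes cpt_ob: "k \<in> Ob K \<Longrightarrow> is_functor (cpf_ob P k) (cpf_ob Q k) (cpt_ob \<phi> k)"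
    and cpt_ar: "f \<in> Ar K \<Longrightarrow>
      nat_iso (cpf_ob P (src K f)) (cpf_ob Q (tgt K f))
        (functor_comp (cpf_ar Q f) (cpt_ob \<phi> (src K f)))
        (functor_comp (cpt_ob \<phi> (tgt K f)) (cpf_ar P f)) (cpt_ar \<phi> f)"
    and cpt_cl: "\<lbrakk>\<mu> \<in> Cl K; x \<in> Obj (cpf_ob P (src K (vdom K \<mu>)))\<rbrakk> \<Longrightarrow>
      cpt_ar \<phi> (vcod K \<mu>) x \<odot>\<^bsub>cpf_ob Q (tgt K (vdom K \<mu>))\<^esub>
        cpf_cl Q \<mu> (on_obj (cpt_ob \<phi> (src K (vdom K \<mu>))) x)
      = on_arr (cpt_ob \<phi> (tgt K (vdom K \<mu>))) (cpf_cl P \<mu> x)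
        \<odot>\<^bsub>cpf_ob Q (tgt K (vdom K \<mu>))\<^esub> cpt_ar \<phi> (vdom K \<mu>) x"
    and cpt_one: "\<lbrakk>k \<in> Ob K; x \<in> Obj (cpf_ob P k)\<rbrakk> \<Longrightarrow>
      cpt_ar \<phi> (one K k) x \<odot>\<^bsub>cpf_ob Q k\<^esub> cpf_unit Q k (on_obj (cpt_ob \<phi> k) x)
      = on_arr (cpt_ob \<phi> k) (cpf_unit P k x)"
    and cpt_comp: "\<lbrakk>g \<in> Ar K; f \<in> Ar K; src K g = tgt K f; x \<in> Obj (cpf_ob P (src K f))\<rbrakk> \<Longrightarrow>
      cpt_ar \<phi> (g \<cdot>\<^bsub>K\<^esub> f) x \<odot>\<^bsub>cpf_ob Q (tgt K g)\<^esub>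
        cpf_comp Q g f (on_obj (cpt_ob \<phi> (src K f)) x)
      = on_arr (cpt_ob \<phi> (tgt K g)) (cpf_comp P g f x) \<odot>\<^bsub>cpf_ob Q (tgt K g)\<^esub>
        (cpt_ar \<phi> g (on_obj (cpf_ar P f) x) \<odot>\<^bsub>cpf_ob Q (tgt K g)\<^esub>
          on_arr (cpf_ar Q g) (cpt_ar \<phi> f x))"

text \<open>
  For pseudo functors \<open>S : X \<rightarrow> C\<close> and \<open>T : A \<rightarrow> C\<close>, the following is the \<open>Cat\<close>-valued pseudo
  functor \<open>Mor\<^bsub>C\<^esub>(S-,T-)\<close> on \<open>X\<^sup>o\<^sup>p \<times> A\<close>, sending a 1-cell \<open>(h, g)\<close> to \<open>f \<mapsto> T g \<cdot> f \<cdot> S h\<close>.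
  Composition in \<open>X\<^sup>o\<^sup>p\<close> is reversed, which swaps the arguments of \<open>pf_comp S\<close>.
\<close>

definition hom_pf :: "('p, 'n, 'd) two_cat_data
    \<Rightarrow> ('xo, 'xm, 'xc, 'p, 'n, 'd) pseudo_functor_data
    \<Rightarrow> ('ao, 'am, 'ac, 'p, 'n, 'd) pseudo_functor_data
    \<Rightarrow> ('xo \<times> 'ao, 'xm \<times> 'am, 'xc \<times> 'ac, 'n, 'd) cat_pseudo_functor_data" where
  "hom_pf C S T = \<lparr>
     cpf_ob = \<lambda>(x, a). Mor C (pf_ob S x) (pf_ob T a),
     cpf_ar = \<lambda>(h, g). \<lparr>on_obj = \<lambda>f. pf_ar T g \<cdot>\<^bsub>C\<^esub> f \<cdot>\<^bsub>C\<^esub> pf_ar S h,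
                        on_arr = \<lambda>\<beta>. idc C (pf_ar T g) \<star>\<^bsub>C\<^esub> \<beta> \<star>\<^bsub>C\<^esub> idc C (pf_ar S h)\<rparr>,
     cpf_cl = \<lambda>(\<sigma>, \<tau>) f. pf_cl T \<tau> \<star>\<^bsub>C\<^esub> idc C f \<star>\<^bsub>C\<^esub> pf_cl S \<sigma>,
     cpf_comp = \<lambda>(h', g') (h, g) f. pf_comp T g' g \<star>\<^bsub>C\<^esub> idc C f \<star>\<^bsub>C\<^esub> pf_comp S h h',
     cpf_unit = \<lambda>(x, a) f. pf_unit T a \<star>\<^bsub>C\<^esub> idc C f \<star>\<^bsub>C\<^esub> pf_unit S x\<rparr>"


section \<open>Biuniversal arrows and biadjunctions\<close>

definition biuniversal_arrow :: "('p, 'n, 'd) two_cat_data \<Rightarrow> ('o, 'm, 'c) two_cat_data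
    \<Rightarrow> ('p, 'n, 'd, 'o, 'm, 'c) pseudo_functor_data \<Rightarrow> 'o \<Rightarrow> 'p \<Rightarrow> 'm \<Rightarrow> bool" where
  "biuniversal_arrow D C S c R u \<longleftrightarrow>
     c \<in> Ob C \<and> R \<in> Ob D \<and> u \<in> Obj (Mor C c (pf_ob S R)) \<and>
     (\<forall>d \<in> Ob D. equivalence_of_categories (Mor D R d) (Mor C c (pf_ob S d))
        \<lparr>on_obj = \<lambda>f'. pf_ar S f' \<cdot>\<^bsub>C\<^esub> u, on_arr = \<lambda>\<gamma>. pf_cl S \<gamma> \<star>\<^bsub>C\<^esub> idc C u\<rparr>)"

definition biadjunction :: "('xo, 'xm, 'xc) two_cat_data \<Rightarrow> ('ao, 'am, 'ac) two_cat_data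
    \<Rightarrow> ('xo, 'xm, 'xc, 'ao, 'am, 'ac) pseudo_functor_data
    \<Rightarrow> ('ao, 'am, 'ac, 'xo, 'xm, 'xc) pseudo_functor_data
    \<Rightarrow> ('xo \<times> 'ao, 'xm \<times> 'am, 'am, 'ac, 'xm, 'xc) cat_pseudo_nat_data \<Rightarrow> bool" where
  "biadjunction X A F G \<phi> \<longleftrightarrow> pseudo_functor X A F \<and> pseudo_functor A X G \<and>
     cat_pseudo_nat_trans (prod2 (op2 X) A) (hom_pf A F (pf_id A)) (hom_pf X (pf_id X) G) \<phi> \<and>
     (\<forall>x \<in> Ob X. \<forall>a \<in> Ob A. equivalence_of_categories
        (Mor A (pf_ob F x) a) (Mor X x (pf_ob G a)) (cpt_ob \<phi> (x, a)))"

definition left_biadjoint :: "('xo, 'xm, 'xc) two_cat_data \<Rightarrow> ('ao, 'am, 'ac) two_cat_data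
    \<Rightarrow> ('xo, 'xm, 'xc, 'ao, 'am, 'ac) pseudo_functor_data
    \<Rightarrow> ('ao, 'am, 'ac, 'xo, 'xm, 'xc) pseudo_functor_data \<Rightarrow> bool" where
  "left_biadjoint X A F G \<longleftrightarrow> (\<exists>\<phi>. biadjunction X A F G \<phi>)"


section \<open>Well-definedness of \<open>Mor\<^bsub>C\<^esub>(S-,T-)\<close>\<close>

context two_category begin

lemma src_Ob: "f \<in> Ar C \<Longrightarrow> src C f \<in> Ob C"
  and tgt_Ob: "f \<in> Ar C \<Longrightarrow> tgt C f \<in> Ob C"
  and one_Ar: "a \<in> Ob C \<Longrightarrow> one C a \<in> Ar C"
  and src_one: "a \<in> Ob C \<Longrightarrow> src C (one C a) = a"
  and tgt_one: "a \<in> Ob C \<Longrightarrow> tgt C (one C a) = a"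
  and comp1_Ar: "\<lbrakk>g \<in> Ar C; f \<in> Ar C; src C g = tgt C f\<rbrakk> \<Longrightarrow> g \<cdot> f \<in> Ar C"
  and src_comp1: "\<lbrakk>g \<in> Ar C; f \<in> Ar C; src C g = tgt C f\<rbrakk> \<Longrightarrow> src C (g \<cdot> f) = src C f"
  and tgt_comp1: "\<lbrakk>g \<in> Ar C; f \<in> Ar C; src C g = tgt C f\<rbrakk> \<Longrightarrow> tgt C (g \<cdot> f) = tgt C g"
  and comp1_one: "f \<in> Ar C \<Longrightarrow> f \<cdot> one C (src C f) = f"
  and one_comp1: "f \<in> Ar C \<Longrightarrow> one C (tgt C f) \<cdot> f = f"
  and comp1_assoc: "\<lbrakk>h \<in> Ar C; g \<in> Ar C; f \<in> Ar C; src C h = tgt C g; src C g = tgt C f\<rbrakk>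
      \<Longrightarrow> (h \<cdot> g) \<cdot> f = h \<cdot> (g \<cdot> f)"
  using arrow_category unfolding category_def arrow_cat_def by auto

lemma vdom_Ar: "f \<in> Cl C \<Longrightarrow> vdom C f \<in> Ar C"
  and vcod_Ar: "f \<in> Cl C \<Longrightarrow> vcod C f \<in> Ar C"
  and idc_Cl: "a \<in> Ar C \<Longrightarrow> idc C a \<in> Cl C"
  and vdom_idc: "a \<in> Ar C \<Longrightarrow> vdom C (idc C a) = a"
  and vcod_idc: "a \<in> Ar C \<Longrightarrow> vcod C (idc C a) = a"
  and vcomp_Cl: "\<lbrakk>g \<in> Cl C; f \<in> Cl C; vdom C g = vcod C f\<rbrakk> \<Longrightarrow> g \<bullet> f \<in> Cl C"
  and vdom_vcomp: "\<lbrakk>g \<in> Cl C; f \<in> Cl C; vdom C g = vcod C f\<rbrakk> \<Longrightarrow> vdom C (g \<bullet> f) = vdom C f"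
  and vcod_vcomp: "\<lbrakk>g \<in> Cl C; f \<in> Cl C; vdom C g = vcod C f\<rbrakk> \<Longrightarrow> vcod C (g \<bullet> f) = vcod C g"
  and vcomp_idc: "f \<in> Cl C \<Longrightarrow> f \<bullet> idc C (vdom C f) = f"
  and idc_vcomp: "f \<in> Cl C \<Longrightarrow> idc C (vcod C f) \<bullet> f = f"
  and vcomp_assoc: "\<lbrakk>h \<in> Cl C; g \<in> Cl C; f \<in> Cl C; vdom C h = vcod C g; vdom C g = vcod C f\<rbrakk>
      \<Longrightarrow> (h \<bullet> g) \<bullet> f = h \<bullet> (g \<bullet> f)"
  using vertical_category unfolding category_def vertical_cat_def by auto

lemma hcomp_Cl: "\<lbrakk>g \<in> Cl C; f \<in> Cl C; src C (vdom C g) = tgt C (vdom C f)\<rbrakk> \<Longrightarrow> g \<star> f \<in> Cl C"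
  and hcomp_one: "f \<in> Cl C \<Longrightarrow> f \<star> idc C (one C (src C (vdom C f))) = f"
  and one_hcomp: "f \<in> Cl C \<Longrightarrow> idc C (one C (tgt C (vdom C f))) \<star> f = f"
  and hcomp_assoc: "\<lbrakk>h \<in> Cl C; g \<in> Cl C; f \<in> Cl C; src C (vdom C h) = tgt C (vdom C g);
      src C (vdom C g) = tgt C (vdom C f)\<rbrakk> \<Longrightarrow> (h \<star> g) \<star> f = h \<star> (g \<star> f)"
  using horizontal_category unfolding category_def horizontal_cat_def by auto

lemmas cell_simps = src_Ob tgt_Ob one_Ar src_one tgt_one comp1_Ar src_comp1 tgt_comp1 
  vdom_Ar vcod_Ar idc_Cl vdom_idc vcod_idc vcomp_Cl vdom_vcomp vcod_vcomp hcomp_Cl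
  vdom_hcomp vcod_hcomp src_vcod tgt_vcod

lemma category_Mor: "category (Mor C a b)"
  unfolding category_def Mor_def
  by (auto simp: cell_simps vcomp_idc idc_vcomp vcomp_assoc)

lemma two_category_op2: "two_category (op2 C)"
proof -
  have 1: "category (arrow_cat (op2 C))"
    unfolding category_def arrow_cat_def op2_def
    by (auto simp: cell_simps comp1_one one_comp1 comp1_assoc)
  have 2: "category (vertical_cat (op2 C))"
    unfolding category_def vertical_cat_def op2_def
    by (auto simp: cell_simps vcomp_idc idc_vcomp vcomp_assoc)
  have 3: "category (horizontal_cat (op2 C))"
    unfolding category_def horizontal_cat_def op2_def
    by (auto simp: cell_simps hcomp_one one_hcomp hcomp_assoc)
  show ?thesis
    unfolding two_category_def using 1 2 3
    by (auto simp: op2_def cell_simps hcomp_idc interchange)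
qed

lemma pseudo_functor_pf_id: "pseudo_functor C C (pf_id C)"
proof -
  have u: "invertible (vertical_cat C) (idc C f)" if "f \<in> Ar C" for f
    unfolding invertible_def vertical_cat_def using that
    by (auto intro!: bexI[of _ "idc C f"] simp: cell_simps) (metis idc_Cl vdom_idc vcomp_idc)+
  have idem: "idc C a \<bullet> idc C a = idc C a" if "a \<in> Ar C" for a
    by (metis that idc_Cl vdom_idc vcomp_idc)
  have n: "idc C (vcod C \<beta> \<cdot> vcod C \<alpha>) \<bullet> (\<beta> \<star> \<alpha>) = (\<beta> \<star> \<alpha>) \<bullet> idc C (vdom C \<beta> \<cdot> vdom C \<alpha>)"
    if "\<beta> \<in> Cl C" "\<alpha> \<in> Cl C" "src C (vdom C \<beta>) = tgt C (vdom C \<alpha>)" for \<alpha> \<beta>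
    using that by (metis hcomp_Cl idc_vcomp vcomp_idc vcod_hcomp vdom_hcomp)
  show ?thesis
    apply (rule pseudo_functor.intro)
      apply (rule two_category_axioms)
     apply (rule two_category_axioms)
    apply (rule pseudo_functor_axioms.intro)
    by (auto simp: pf_id_def cell_simps u n hcomp_idc comp1_one one_comp1 comp1_assoc idem)
qed

end

lemma two_category_prod2:
  assumes "two_category C" "two_category D"
  shows "two_category (prod2 C D)"
proof -
  interpret C: two_category C by fact
  interpret D: two_category D by fact
  have 1: "category (arrow_cat (prod2 C D))"
    unfolding category_def arrow_cat_def prod2_def
    by (auto simp: C.cell_simps C.comp1_one C.one_comp1 C.comp1_assoc D.cell_simps D.comp1_one D.one_comp1 D.comp1_assoc)
  have 2: "category (vertical_cat (prod2 C D))"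
    unfolding category_def vertical_cat_def prod2_def
    by (auto simp: C.cell_simps C.vcomp_idc C.idc_vcomp C.vcomp_assoc D.cell_simps D.vcomp_idc D.idc_vcomp D.vcomp_assoc)
  have 3: "category (horizontal_cat (prod2 C D))"
    unfolding category_def horizontal_cat_def prod2_def
    by (auto simp: C.cell_simps C.hcomp_one C.one_hcomp C.hcomp_assoc D.cell_simps D.hcomp_one D.one_hcomp D.hcomp_assoc)
  show ?thesis
    unfolding two_category_def using 1 2 3
    by (auto simp: prod2_def C.cell_simps C.hcomp_idc C.interchange D.cell_simps D.hcomp_idc D.interchange)
qed


context two_category begin

lemma hcomp3_interchange: "\<lbrakk>a' \<in> Cl C; a \<in> Cl C; b' \<in> Cl C; b \<in> Cl C; c' \<in> Cl C; c \<in> Cl C;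
  vdom C a' = vcod C a; vdom C b' = vcod C b; vdom C c' = vcod C c;
  src C (vdom C a) = tgt C (vdom C b); src C (vdom C b) = tgt C (vdom C c)\<rbrakk>
  \<Longrightarrow> (a' \<star> b' \<star> c') \<bullet> (a \<star> b \<star> c) = (a' \<bullet> a) \<star> (b' \<bullet> b) \<star> (c' \<bullet> c)"
  by (subst interchange[of b' b c' c], (simp add: cell_simps)+)
     (subst interchange, (simp add: cell_simps)+)

lemma idc_idem: "a \<in> Ar C \<Longrightarrow> idc C a \<bullet> idc C a = idc C a"
  by (metis idc_Cl vdom_idc vcomp_idc)

lemma vcomp_idc': "\<lbrakk>f \<in> Cl C; vdom C f = a\<rbrakk> \<Longrightarrow> f \<bullet> idc C a = f"
  and idc_vcomp': "\<lbrakk>f \<in> Cl C; vcod C f = a\<rbrakk> \<Longrightarrow> idc C a \<bullet> f = f"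
  by (auto simp: vcomp_idc idc_vcomp)

definition conj_functor :: "'m \<Rightarrow> 'm \<Rightarrow> ('m,'c,'m,'c) functor_data" where
 "conj_functor g h = \<lparr>on_obj = \<lambda>f. g \<cdot> f \<cdot> h, on_arr = \<lambda>\<beta>. idc C g \<star> \<beta> \<star> idc C h\<rparr>"

lemma is_functor_conj_functor:
  assumes "g \<in> Ar C" "h \<in> Ar C"
  shows "is_functor (Mor C (tgt C h) (src C g)) (Mor C (src C h) (tgt C g)) (conj_functor g h)"
  apply (rule is_functor.intro[OF category_Mor category_Mor])
  apply (rule is_functor_axioms.intro)
  using assms
  by (auto simp: Mor_def conj_functor_def cell_simps hcomp_idc hcomp3_interchange idc_idem)

lemma invertible_hcomp3: assumes "invertible (vertical_cat C) a" "invertible (vertical_cat C) c" "f \<in> Ar C"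
  "src C (vdom C a) = tgt C f" "src C f = tgt C (vdom C c)"
  shows "invertible (Mor C (src C (vdom C c)) (tgt C (vdom C a))) (a \<star> idc C f \<star> c)"
proof -
  obtain a' where a': "a' \<in> Cl C" "a \<in> Cl C" "vdom C a' = vcod C a" "vcod C a' = vdom C a" 
     "a' \<bullet> a = idc C (vdom C a)" "a \<bullet> a' = idc C (vcod C a)"
    using assms(1) unfolding invertible_def vertical_cat_def by auto
  obtain c' where c': "c' \<in> Cl C" "c \<in> Cl C" "vdom C c' = vcod C c" "vcod C c' = vdom C c" 
     "c' \<bullet> c = idc C (vdom C c)" "c \<bullet> c' = idc C (vcod C c)"
    using assms(2) unfolding invertible_def vertical_cat_def by auto
  show ?thesis
    unfolding invertible_def Mor_def using a' c' assms(3-)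
    by (auto intro!: exI[of _ "a' \<star> idc C f \<star> c'"] simp: cell_simps hcomp3_interchange idc_idem hcomp_idc)
qed

lemma nat_trans_hcomp3:
  assumes a: "a \<in> Cl C" "c \<in> Cl C" "src C (vdom C a) = y" "tgt C (vdom C c) = x"
   "src C (vdom C c) = x'" "tgt C (vdom C a) = y'"
  and "is_functor (Mor C x y) (Mor C x' y') S" "is_functor (Mor C x y) (Mor C x' y') T"
  and S: "\<And>f. f \<in> Ar C \<Longrightarrow> src C f = x \<Longrightarrow> tgt C f = y \<Longrightarrow> on_obj S f = vdom C a \<cdot> f \<cdot> vdom C c"
   "\<And>f. f \<in> Cl C \<Longrightarrow> src C (vdom C f) = x \<Longrightarrow> tgt C (vdom C f) = y \<Longrightarrow> on_arr S f = idc C (vdom C a) \<star> f \<star> idc C (vdom C c)"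
   "\<And>f. f \<in> Ar C \<Longrightarrow> src C f = x \<Longrightarrow> tgt C f = y \<Longrightarrow> on_obj T f = vcod C a \<cdot> f \<cdot> vcod C c"
   "\<And>f. f \<in> Cl C \<Longrightarrow> src C (vdom C f) = x \<Longrightarrow> tgt C (vdom C f) = y \<Longrightarrow> on_arr T f = idc C (vcod C a) \<star> f \<star> idc C (vcod C c)"
  and t: "\<And>f. f \<in> Ar C \<Longrightarrow> src C f = x \<Longrightarrow> tgt C f = y \<Longrightarrow> t f = a \<star> idc C f \<star> c"
  shows "nat_trans (Mor C x y) (Mor C x' y') S T t"
  apply (rule nat_trans.intro[OF assms(7,8)])
  apply (rule nat_trans_axioms.intro)
  using a by (auto simp: Mor_def S t cell_simps hcomp3_interchange vcomp_idc' idc_vcomp')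

lemma is_functor_comp:
  assumes "is_functor P Q F" "is_functor Q R G"
  shows "is_functor P R (functor_comp G F)"
  using assms unfolding is_functor_def is_functor_axioms_def functor_comp_def by auto

lemma is_functor_ident:
  assumes "category P"
  shows "is_functor P P functor_id"
  using assms unfolding is_functor_def is_functor_axioms_def functor_id_def by auto

end

lemma cat_pseudo_functor_hom_pf:
  assumes SF: "pseudo_functor X C S" and TF: "pseudo_functor A C T"
  shows "cat_pseudo_functor (prod2 (op2 X) A) (hom_pf C S T)"
proof -
  interpret S: pseudo_functor X C S by fact
  interpret T: pseudo_functor A C T by fact
  note cs = S.D.cell_simps S.pf_ob S.pf_ar S.src_pf_ar S.tgt_pf_ar S.pf_cl S.vdom_pf_cl S.vcod_pf_cl
    T.pf_ob T.pf_ar T.src_pf_ar T.tgt_pf_ar T.pf_cl T.vdom_pf_cl T.vcod_pf_cl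
    S.vdom_pf_comp S.vcod_pf_comp S.vdom_pf_unit S.vcod_pf_unit
    T.vdom_pf_comp T.vcod_pf_comp T.vdom_pf_unit T.vcod_pf_unit
    S.C.cell_simps T.C.cell_simps
  have inv_Cl: "invertible (vertical_cat C) a \<Longrightarrow> a \<in> Cl C" for a
    by (simp add: invertible_def vertical_cat_def)
  note cs = cs S.pf_comp_invertible[THEN inv_Cl] T.pf_comp_invertible[THEN inv_Cl]
    S.pf_unit_invertible[THEN inv_Cl] T.pf_unit_invertible[THEN inv_Cl]
  note pdefs = prod2_def op2_def
  have ar: "is_functor (Mor C (pf_ob S (tgt X h)) (pf_ob T (src A g))) (Mor C (pf_ob S (src X h)) (pf_ob T (tgt A g)))
     (cpf_ar (hom_pf C S T) (h,g))" if "h \<in> Ar X" "g \<in> Ar A" for g h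
    using S.D.is_functor_conj_functor[of "pf_ar T g" "pf_ar S h"] that
    by (simp add: cs S.D.conj_functor_def hom_pf_def)
  have mor_obj: "f \<in> Obj (Mor C x y) \<longleftrightarrow> f \<in> Ar C \<and> src C f = x \<and> tgt C f = y" for f x y
    by (simp add: Mor_def)
  show ?thesis
  proof (rule cat_pseudo_functor.intro[OF two_category_prod2[OF S.C.two_category_op2 T.C.two_category_axioms]],
     rule cat_pseudo_functor_axioms.intro, goal_cases)
    case (1 k)
    then show ?case by (cases k) (simp add: hom_pf_def S.D.category_Mor)
  next
    case (2 f)
    then show ?case using ar[of "fst f" "snd f"] by (cases f) (simp add: hom_pf_def pdefs)
  next
    case (3 \<alpha>)
    obtain s t where [simp]: "\<alpha> = (s,t)" by (cases \<alpha>)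
    have [simp]: "s \<in> Cl X" "t \<in> Cl A" using 3 by (auto simp: pdefs)
    show ?case
      using ar[of "vdom X s" "vdom A t"] ar[of "vcod X s" "vcod A t"]
      apply -
      apply (simp add: pdefs hom_pf_def cs)
      apply (rule S.D.nat_trans_hcomp3[of "pf_cl T t" "pf_cl S s"], auto simp: cs pdefs hom_pf_def)
      done
  next
    case (4 f x)
    then show ?case by (cases f) (auto simp: cs pdefs hom_pf_def mor_obj S.pf_cl_idc T.pf_cl_idc S.D.hcomp_idc, simp add: Mor_def)
  next
    case (5 \<beta> \<alpha> x)
    then show ?case apply (cases \<alpha>; cases \<beta>)
      apply (auto simp: cs pdefs hom_pf_def mor_obj S.pf_cl_vcomp T.pf_cl_vcomp)
      apply (simp add: Mor_def)
      apply (subst S.D.hcomp3_interchange)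
                apply (auto simp: cs S.D.idc_idem)
      done
  next
    case (6 g f)
    obtain h g1 where [simp]: "f = (h,g1)" by (cases f)
    obtain h' g' where [simp]: "g = (h',g')" by (cases g)
    have [simp]: "h \<in> Ar X" "h' \<in> Ar X" "g1 \<in> Ar A" "g' \<in> Ar A" "src X h = tgt X h'" "src A g' = tgt A g1"
      using 6 by (auto simp: pdefs)
    show ?case
      apply (rule nat_iso.intro)
       apply (simp add: pdefs hom_pf_def)
      apply (rule S.D.nat_trans_hcomp3[of "pf_comp T g' g1" "pf_comp S h h'"])
      subgoal by (auto simp: cs)
      subgoal by (auto simp: cs)
      subgoal by (auto simp: cs)
      subgoal by (auto simp: cs)
      subgoal by (auto simp: cs)
      subgoal by (auto simp: cs)
      subgoal using S.D.is_functor_comp[OF ar[of h g1, simplified] ar[of h' g', simplified]]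
        by (auto simp: cs hom_pf_def)
      subgoal using ar[of "h \<cdot>\<^bsub>X\<^esub> h'" "g' \<cdot>\<^bsub>A\<^esub> g1"] by (auto simp: cs hom_pf_def)
      subgoal by (auto simp: cs functor_comp_def S.D.comp1_assoc)
      subgoal by (auto simp: cs functor_comp_def S.D.hcomp_assoc S.D.hcomp_idc[symmetric])
      subgoal by (auto simp: cs functor_comp_def S.D.comp1_assoc)
      subgoal by (auto simp: cs functor_comp_def S.D.hcomp_assoc)
      subgoal by simp
      apply (rule nat_iso_axioms.intro)
      subgoal for a
        using S.D.invertible_hcomp3[of "pf_comp T g' g1" "pf_comp S h h'" a]
        by (auto simp: cs pdefs hom_pf_def mor_obj S.pf_comp_invertible T.pf_comp_invertible)
      done
  next
    case (7 \<beta> \<alpha> x)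
    obtain s t where [simp]: "\<alpha> = (s,t)" by (cases \<alpha>)
    obtain s' t' where [simp]: "\<beta> = (s',t')" by (cases \<beta>)
    have [simp]: "s \<in> Cl X" "t \<in> Cl A" "s' \<in> Cl X" "t' \<in> Cl A" "src X (vdom X s) = tgt X (vdom X s')"
      "src A (vdom A t') = tgt A (vdom A t)"  using 7 by (auto simp: pdefs)
    have [simp]: "x \<in> Ar C" "src C x = pf_ob S (tgt X (vdom X s))" "tgt C x = pf_ob T (src A (vdom A t))"
      using 7 by (auto simp: pdefs hom_pf_def mor_obj)
    have e1: "idc C (pf_ar T (vcod A t) \<cdot>\<^bsub>C\<^esub> x \<cdot>\<^bsub>C\<^esub> pf_ar S (vcod X s))
       = idc C (pf_ar T (vcod A t)) \<star>\<^bsub>C\<^esub> idc C x \<star>\<^bsub>C\<^esub> idc C (pf_ar S (vcod X s))"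
      by (simp add: S.D.hcomp_idc cs)
    have e2: "(pf_cl T t' \<star>\<^bsub>C\<^esub> idc C (pf_ar T (vcod A t) \<cdot>\<^bsub>C\<^esub> x \<cdot>\<^bsub>C\<^esub> pf_ar S (vcod X s)) \<star>\<^bsub>C\<^esub> pf_cl S s') \<bullet>\<^bsub>C\<^esub>
       (idc C (pf_ar T (vdom A t')) \<star>\<^bsub>C\<^esub> (pf_cl T t \<star>\<^bsub>C\<^esub> idc C x \<star>\<^bsub>C\<^esub> pf_cl S s) \<star>\<^bsub>C\<^esub> idc C (pf_ar S (vdom X s')))
      = pf_cl T t' \<star>\<^bsub>C\<^esub> (pf_cl T t \<star>\<^bsub>C\<^esub> idc C x \<star>\<^bsub>C\<^esub> pf_cl S s) \<star>\<^bsub>C\<^esub> pf_cl S s'"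
      by (subst S.D.hcomp3_interchange, simp_all add: cs S.D.idc_vcomp' S.D.vcomp_idc')
    also have "\<dots> = (pf_cl T t' \<star>\<^bsub>C\<^esub> pf_cl T t) \<star>\<^bsub>C\<^esub> idc C x \<star>\<^bsub>C\<^esub> (pf_cl S s \<star>\<^bsub>C\<^esub> pf_cl S s')"
      by (simp add: cs S.D.hcomp_assoc)
    finally have e3: "(pf_cl T t' \<star>\<^bsub>C\<^esub> idc C (pf_ar T (vcod A t) \<cdot>\<^bsub>C\<^esub> x \<cdot>\<^bsub>C\<^esub> pf_ar S (vcod X s)) \<star>\<^bsub>C\<^esub> pf_cl S s') \<bullet>\<^bsub>C\<^esub>
       (idc C (pf_ar T (vdom A t')) \<star>\<^bsub>C\<^esub> (pf_cl T t \<star>\<^bsub>C\<^esub> idc C x \<star>\<^bsub>C\<^esub> pf_cl S s) \<star>\<^bsub>C\<^esub> idc C (pf_ar S (vdom X s')))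
      = (pf_cl T t' \<star>\<^bsub>C\<^esub> pf_cl T t) \<star>\<^bsub>C\<^esub> idc C x \<star>\<^bsub>C\<^esub> (pf_cl S s \<star>\<^bsub>C\<^esub> pf_cl S s')" .
    show ?case
      apply (simp add: pdefs hom_pf_def)
      apply (simp add: Mor_def e3)
      apply (subst S.D.hcomp3_interchange, simp_all add: cs)
      apply (subst S.D.hcomp3_interchange, simp_all add: cs)
      by (simp add: T.pf_comp_natural S.pf_comp_natural)
  next
    case (8 k)
    obtain p q where [simp]: "k = (p,q)" by (cases k)
    have [simp]: "p \<in> Ob X" "q \<in> Ob A" using 8 by (auto simp: pdefs)
    have [simp]: "f \<in> Ar C \<Longrightarrow> src C f = a \<Longrightarrow> f \<cdot>\<^bsub>C\<^esub> one C a = f" for f a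
      using S.D.comp1_one by auto
    have [simp]: "f \<in> Ar C \<Longrightarrow> tgt C f = a \<Longrightarrow> one C a \<cdot>\<^bsub>C\<^esub> f = f" for f a
      using S.D.one_comp1 by auto
    have [simp]: "f \<in> Cl C \<Longrightarrow> src C (vdom C f) = a \<Longrightarrow> f \<star>\<^bsub>C\<^esub> idc C (one C a) = f" for f a
      using S.D.hcomp_one by auto
    have [simp]: "f \<in> Cl C \<Longrightarrow> tgt C (vdom C f) = a \<Longrightarrow> idc C (one C a) \<star>\<^bsub>C\<^esub> f = f" for f a
      using S.D.one_hcomp by auto
    show ?case
      apply (rule nat_iso.intro)
       apply (simp add: pdefs hom_pf_def)
       apply (rule S.D.nat_trans_hcomp3[of "pf_unit T q" "pf_unit S p"])
      subgoal by (auto simp: cs)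
      subgoal by (auto simp: cs)
      subgoal by (auto simp: cs)
      subgoal by (auto simp: cs)
      subgoal by (auto simp: cs)
      subgoal by (auto simp: cs)
      subgoal by (rule S.D.is_functor_ident[OF S.D.category_Mor])
      subgoal using ar[of "one X p" "one A q"] by (auto simp: cs hom_pf_def)
      subgoal by (auto simp: cs functor_id_def)
      subgoal by (auto simp: cs functor_id_def)
      subgoal by (auto simp: cs)
      subgoal by (auto simp: cs)
      subgoal by simp
      apply (rule nat_iso_axioms.intro)
      subgoal for a
        using S.D.invertible_hcomp3[of "pf_unit T q" "pf_unit S p" a]
        by (auto simp: cs pdefs hom_pf_def mor_obj S.pf_unit_invertible T.pf_unit_invertible)
      done
  next
    case (9 f x)
    obtain h g where [simp]: "f = (h,g)" by (cases f)
    have [simp]: "h \<in> Ar X" "g \<in> Ar A" using 9 by (auto simp: pdefs)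
    have [simp]: "x \<in> Ar C" "src C x = pf_ob S (tgt X h)" "tgt C x = pf_ob T (src A g)"
      using 9 by (auto simp: pdefs hom_pf_def mor_obj)
    have e: "idc C (pf_ar T g) \<star>\<^bsub>C\<^esub> (pf_unit T (src A g) \<star>\<^bsub>C\<^esub> idc C x \<star>\<^bsub>C\<^esub> pf_unit S (tgt X h)) \<star>\<^bsub>C\<^esub> idc C (pf_ar S h)
      = (idc C (pf_ar T g) \<star>\<^bsub>C\<^esub> pf_unit T (src A g)) \<star>\<^bsub>C\<^esub> idc C x \<star>\<^bsub>C\<^esub> (pf_unit S (tgt X h) \<star>\<^bsub>C\<^esub> idc C (pf_ar S h))"
      by (simp add: cs S.D.hcomp_assoc)
    show ?case
      apply (simp add: pdefs hom_pf_def)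
      apply (simp add: Mor_def e)
      apply (subst S.D.hcomp3_interchange, simp_all add: cs)
      by (simp add: S.pf_unit_left T.pf_unit_right S.D.idc_idem S.D.hcomp_idc cs)
  next
    case (10 f x)
    obtain h g where [simp]: "f = (h,g)" by (cases f)
    have [simp]: "h \<in> Ar X" "g \<in> Ar A" using 10 by (auto simp: pdefs)
    have [simp]: "x \<in> Ar C" "src C x = pf_ob S (tgt X h)" "tgt C x = pf_ob T (src A g)"
      using 10 by (auto simp: pdefs hom_pf_def mor_obj)
    have e: "pf_unit T (tgt A g) \<star>\<^bsub>C\<^esub> idc C (pf_ar T g \<cdot>\<^bsub>C\<^esub> x \<cdot>\<^bsub>C\<^esub> pf_ar S h) \<star>\<^bsub>C\<^esub> pf_unit S (src X h)
      = (pf_unit T (tgt A g) \<star>\<^bsub>C\<^esub> idc C (pf_ar T g)) \<star>\<^bsub>C\<^esub> idc C x \<star>\<^bsub>C\<^esub> (idc C (pf_ar S h) \<star>\<^bsub>C\<^esub> pf_unit S (src X h))"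
      by (simp add: cs S.D.hcomp_assoc S.D.hcomp_idc[symmetric])
    show ?case
      apply (simp add: pdefs hom_pf_def)
      apply (simp add: Mor_def e)
      apply (subst S.D.hcomp3_interchange, simp_all add: cs)
      by (simp add: S.pf_unit_right T.pf_unit_left S.D.idc_idem S.D.hcomp_idc cs)
  next
    case (11 f3 f2 f1 x)
    obtain h3 g3 where [simp]: "f3 = (h3,g3)" by (cases f3)
    obtain h2 g2 where [simp]: "f2 = (h2,g2)" by (cases f2)
    obtain h1 g1 where [simp]: "f1 = (h1,g1)" by (cases f1)
    have [simp]: "h1 \<in> Ar X" "g1 \<in> Ar A" "h2 \<in> Ar X" "g2 \<in> Ar A" "h3 \<in> Ar X" "g3 \<in> Ar A"
      "src A g3 = tgt A g2" "src A g2 = tgt A g1" "src X h2 = tgt X h3" "src X h1 = tgt X h2" using 11 by (auto simp: pdefs)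
    have [simp]: "x \<in> Ar C" "src C x = pf_ob S (tgt X h1)" "tgt C x = pf_ob T (src A g1)"
      using 11 by (auto simp: pdefs hom_pf_def mor_obj)
    have e1: "idc C (pf_ar T g3) \<star>\<^bsub>C\<^esub> (pf_comp T g2 g1 \<star>\<^bsub>C\<^esub> idc C x \<star>\<^bsub>C\<^esub> pf_comp S h1 h2) \<star>\<^bsub>C\<^esub> idc C (pf_ar S h3)
      = (idc C (pf_ar T g3) \<star>\<^bsub>C\<^esub> pf_comp T g2 g1) \<star>\<^bsub>C\<^esub> idc C x \<star>\<^bsub>C\<^esub> (pf_comp S h1 h2 \<star>\<^bsub>C\<^esub> idc C (pf_ar S h3))"
      by (simp add: cs S.D.hcomp_assoc)
    have e2: "pf_comp T g3 g2 \<star>\<^bsub>C\<^esub> idc C (pf_ar T g1 \<cdot>\<^bsub>C\<^esub> x \<cdot>\<^bsub>C\<^esub> pf_ar S h1) \<star>\<^bsub>C\<^esub> pf_comp S h2 h3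
      = (pf_comp T g3 g2 \<star>\<^bsub>C\<^esub> idc C (pf_ar T g1)) \<star>\<^bsub>C\<^esub> idc C x \<star>\<^bsub>C\<^esub> (idc C (pf_ar S h1) \<star>\<^bsub>C\<^esub> pf_comp S h2 h3)"
      by (simp add: cs S.D.hcomp_assoc S.D.hcomp_idc[symmetric])
    show ?case
      apply (simp add: pdefs hom_pf_def)
      apply (simp add: Mor_def e1 e2)
      apply (subst S.D.hcomp3_interchange, simp_all add: cs S.C.comp1_assoc T.C.comp1_assoc S.D.comp1_assoc)
      apply (subst S.D.hcomp3_interchange, simp_all add: cs S.C.comp1_assoc T.C.comp1_assoc S.D.comp1_assoc)
      by (simp add: S.pf_assoc T.pf_assoc)
  qed
qed

end

theory Submission
  imports Defs
begin

text \<open>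
  Given biuniversal arrows \<open>\<eta>\<^sub>x : x \<rightarrow> G (R x)\<close>, consider squares: an arrow \<open>h : x \<rightarrow> y\<close> of \<open>X\<close>, an arrow
  \<open>f : R x \<rightarrow> R y\<close> of \<open>A\<close> and an invertible cell \<open>p : G f \<cdot> \<eta>\<^sub>x \<Rightarrow> \<eta>\<^sub>y \<cdot> h\<close>.  The objects of \<open>X\<close>, squares,
  and pairs of cells of \<open>A\<close> and \<open>X\<close> compatible with \<open>p\<close> form a strict 2-category.  Its projection to \<open>X\<close>
  is surjective on arrows and bijective on cells between given squares, because the functors
  \<open>f \<mapsto> G f \<cdot> \<eta>\<^sub>x\<close> are essentially surjective and fully faithful.  Choosing a square over every arrow
  and projecting to \<open>A\<close> gives the left biadjoint \<open>F\<close>; each coherence law of \<open>F\<close> holds because both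
  sides are cells between the same squares over the same cell of \<open>X\<close>.  Acting on the chosen squares
  with \<open>f\<close> and \<open>g\<close> produces the cells \<open>G (g \<cdot> f \<cdot> F h) \<cdot> \<eta>\<^sub>x \<Rightarrow> G g \<cdot> G f \<cdot> \<eta>\<^sub>y \<cdot> h\<close> whose inverses make
  \<open>f \<mapsto> G f \<cdot> \<eta>\<^sub>x\<close> pseudo natural.

  Conversely, for a biadjunction \<open>\<phi>\<close> put \<open>\<eta>\<^sub>x = \<phi> (1\<^bsub>F x\<^esub>)\<close>.  Pseudo naturality of \<open>\<phi>\<close> at \<open>(1\<^sub>x, f)\<close> and the
  unit cell of \<open>F\<close> give a natural isomorphism \<open>G f \<cdot> \<eta>\<^sub>x \<cong> \<phi> f\<close>, so \<open>f \<mapsto> G f \<cdot> \<eta>\<^sub>x\<close> is an equivalence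
  because \<open>\<phi>\<close> is.
\<close>

section \<open>Equivalences of categories\<close>

lemma (in category) left_cancel:
  assumes "invertible C s" "f \<in> Arr C" "g \<in> Arr C"
    "Cod C f = Dom C s" "Cod C g = Dom C s" "s \<odot> f = s \<odot> g"
  shows "f = g"
proof -
  obtain r where r: "s \<in> Arr C" "r \<in> Arr C" "Dom C r = Cod C s" "Cod C r = Dom C s"
    "r \<odot> s = Ide C (Dom C s)"
    using assms(1) by (auto simp: invertible_def)
  have "r \<odot> (s \<odot> f) = f" "r \<odot> (s \<odot> g) = g"
    using Cmp_assoc[of r s f] Cmp_assoc[of r s g] r assms(2-5) Ide_Cmp[of f] Ide_Cmp[of g] by simp_all
  then show ?thesis using assms(6) by metis
qed

lemma (in category) right_cancel:
  assumes "invertible C s" "f \<in> Arr C" "g \<in> Arr C"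
    "Dom C f = Cod C s" "Dom C g = Cod C s" "f \<odot> s = g \<odot> s"
  shows "f = g"
proof -
  obtain r where r: "s \<in> Arr C" "r \<in> Arr C" "Dom C r = Cod C s" "Cod C r = Dom C s"
    "s \<odot> r = Ide C (Cod C s)"
    using assms(1) by (auto simp: invertible_def)
  have "(f \<odot> s) \<odot> r = f" "(g \<odot> s) \<odot> r = g"
    using Cmp_assoc[of f s r] Cmp_assoc[of g s r] r assms(2-5) Cmp_Ide[of f] Cmp_Ide[of g] by simp_all
  then show ?thesis using assms(6) by metis
qed

lemma (in category) invertible_Cmp:
  assumes "invertible C g" "invertible C f" "Dom C g = Cod C f"
  shows "invertible C (g \<odot> f)"
proof -
  obtain g' where g: "g \<in> Arr C" "g' \<in> Arr C" "Dom C g' = Cod C g" "Cod C g' = Dom C g"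
    "g' \<odot> g = Ide C (Dom C g)" "g \<odot> g' = Ide C (Cod C g)"
    using assms(1) by (auto simp: invertible_def)
  obtain f' where f: "f \<in> Arr C" "f' \<in> Arr C" "Dom C f' = Cod C f" "Cod C f' = Dom C f"
    "f' \<odot> f = Ide C (Dom C f)" "f \<odot> f' = Ide C (Cod C f)"
    using assms(2) by (auto simp: invertible_def)
  have 1: "(f' \<odot> g') \<odot> (g \<odot> f) = f' \<odot> ((g' \<odot> g) \<odot> f)"
    using f(1-4) g(1-4) assms(3) by (simp add: Cmp_assoc Cmp_Arr Dom_Cmp Cod_Cmp)
  have 2: "(g \<odot> f) \<odot> (f' \<odot> g') = g \<odot> ((f \<odot> f') \<odot> g')"
    using f(1-4) g(1-4) assms(3) by (simp add: Cmp_assoc Cmp_Arr Dom_Cmp Cod_Cmp)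
  have "(f' \<odot> g') \<odot> (g \<odot> f) = Ide C (Dom C f)" "(g \<odot> f) \<odot> (f' \<odot> g') = Ide C (Cod C g)"
    unfolding 1 2 using f g assms(3) Ide_Cmp[of f] Ide_Cmp[of g'] by simp_all
  then show ?thesis
    unfolding invertible_def using f g assms(3)
    by (auto intro!: bexI[of _ "f' \<odot> g'"] simp: Cmp_Arr Dom_Cmp Cod_Cmp)
qed

lemma (in is_functor) invertible_on_arr:
  assumes "invertible C f"
  shows "invertible D (on_arr F f)"
proof -
  obtain f' where f: "f \<in> Arr C" "f' \<in> Arr C" "Dom C f' = Cod C f" "Cod C f' = Dom C f"
    "f' \<odot>\<^bsub>C\<^esub> f = Ide C (Dom C f)" "f \<odot>\<^bsub>C\<^esub> f' = Ide C (Cod C f)"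
    using assms by (auto simp: invertible_def)
  then show ?thesis
    unfolding invertible_def
    by (auto intro!: bexI[of _ "on_arr F f'"]
        simp: on_arr_Arr Dom_on_arr Cod_on_arr on_arr_Cmp[symmetric] on_arr_Ide C.Dom_Obj C.Cod_Obj)
qed

text \<open>Naturality of \<open>s\<close> rewrites \<open>s (Cod C f)\<close> after
  \<open>f\<close> as a composite in which \<open>f\<close> occurs only through its image under
  \<open>F\<close>; the invertible component then cancels.\<close>

lemma equivalence_faithful:
  assumes "is_functor C D F" "is_functor D C G" "nat_iso C C functor_id (functor_comp G F) s"
    "f \<in> Arr C" "g \<in> Arr C" "Dom C f = Dom C g" "Cod C f = Cod C g" "on_arr F f = on_arr F g"
  shows "f = g"
proof -
  interpret s: nat_iso C C functor_id "functor_comp G F" s by fact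
  have "s (Cod C f) \<odot>\<^bsub>C\<^esub> f = s (Cod C f) \<odot>\<^bsub>C\<^esub> g"
    using s.naturality[of f] s.naturality[of g] assms(4-8) by (simp add: functor_id_def functor_comp_def)
  then show ?thesis
    by (rule s.S.C.left_cancel[rotated -1])
      (use assms(4-7) in \<open>auto simp: functor_id_def s.component_invertible s.Dom_component s.S.C.Cod_Obj\<close>)
qed

text \<open>The same argument with the counit \<open>t\<close> and cancellation on the other side.
  It lets fullness of \<open>F\<close> be checked after applying \<open>G\<close>.\<close>

lemma equivalence_inverse_faithful:
  assumes "is_functor C D F" "is_functor D C G" "nat_iso D D (functor_comp F G) functor_id t"
    "f \<in> Arr D" "g \<in> Arr D" "Dom D f = Dom D g" "Cod D f = Cod D g" "on_arr G f = on_arr G g"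
  shows "f = g"
proof -
  interpret t: nat_iso D D "functor_comp F G" functor_id t by fact
  have "f \<odot>\<^bsub>D\<^esub> t (Dom D f) = g \<odot>\<^bsub>D\<^esub> t (Dom D f)"
    using t.naturality[of f] t.naturality[of g] assms(4-8) by (simp add: functor_id_def functor_comp_def)
  then show ?thesis
    by (rule t.S.C.right_cancel[rotated -1])
      (use assms(4-7) in \<open>auto simp: functor_id_def t.component_invertible t.Cod_component t.S.C.Dom_Obj\<close>)
qed

text \<open>Naturality of \<open>s\<close> forces the preimage: \<open>s a\<close>, then
  \<open>on_arr G k\<close>, then the inverse of \<open>s b\<close>. Cancelling \<open>s a\<close>
  gives \<open>on_arr G (on_arr F f) = on_arr G k\<close>, and faithfulness of \<open>G\<close>
  finishes.\<close>

lemma equivalence_full: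
  assumes "is_functor C D F" "is_functor D C G" "nat_iso C C functor_id (functor_comp G F) s"
    and t: "nat_iso D D (functor_comp F G) functor_id t"
    and "a \<in> Obj C" "b \<in> Obj C" "k \<in> Arr D" "Dom D k = on_obj F a" "Cod D k = on_obj F b"
  shows "\<exists>f \<in> Arr C. Dom C f = a \<and> Cod C f = b \<and> on_arr F f = k"
proof -
  interpret s: nat_iso C C functor_id "functor_comp G F" s by fact
  interpret F: is_functor C D F by fact
  interpret G: is_functor D C G by fact
  note [simp] = s.component_Arr s.Dom_component s.Cod_component functor_id_def functor_comp_def
    G.on_arr_Arr G.Dom_on_arr G.Cod_on_arr F.on_arr_Arr F.Dom_on_arr F.Cod_on_arr
    s.S.C.Cmp_Arr s.S.C.Dom_Cmp s.S.C.Cod_Cmp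
  obtain r where r: "r \<in> Arr C" "Dom C r = Cod C (s b)" "Cod C r = b" "s b \<odot>\<^bsub>C\<^esub> r = Ide C (Cod C (s b))"
    using s.component_invertible[of b] assms(6) by (auto simp: invertible_def)
  define f where "f = r \<odot>\<^bsub>C\<^esub> (on_arr G k \<odot>\<^bsub>C\<^esub> s a)"
  have f: "f \<in> Arr C" "Dom C f = a" "Cod C f = b"
    using r assms(5-) by (auto simp: f_def)
  have "s b \<odot>\<^bsub>C\<^esub> f = (s b \<odot>\<^bsub>C\<^esub> r) \<odot>\<^bsub>C\<^esub> (on_arr G k \<odot>\<^bsub>C\<^esub> s a)"
    unfolding f_def by (rule s.S.C.Cmp_assoc[symmetric]) (use r assms(5-) in simp_all)
  also have "\<dots> = on_arr G k \<odot>\<^bsub>C\<^esub> s a"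
    using r assms(5-) s.S.C.Ide_Cmp[of "on_arr G k \<odot>\<^bsub>C\<^esub> s a"]
    by simp
  finally have "on_arr G (on_arr F f) \<odot>\<^bsub>C\<^esub> s a = on_arr G k \<odot>\<^bsub>C\<^esub> s a"
    using s.naturality[OF f(1)] f by simp
  then have "on_arr G (on_arr F f) = on_arr G k"
    using s.S.C.right_cancel[of "s a"] s.component_invertible[of a] f assms(5-) by simp
  then have "on_arr F f = k"
    using equivalence_inverse_faithful[OF assms(1,2) t] f assms(5-) by simp
  then show ?thesis using f by blast
qed

text \<open>Unique existence is the form needed later: 2-cells are selected by \<open>THE\<close>
  and compared through their images.\<close>

lemma equivalence_of_categories_full_faithful:
  assumes "equivalence_of_categories C D F" "a \<in> Obj C" "b \<in> Obj C"
    "k \<in> Arr D" "Dom D k = on_obj F a" "Cod D k = on_obj F b"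
  shows "\<exists>!f. f \<in> Arr C \<and> Dom C f = a \<and> Cod C f = b \<and> on_arr F f = k"
proof -
  obtain G s t where "is_functor C D F" "is_functor D C G"
    "nat_iso C C functor_id (functor_comp G F) s" "nat_iso D D (functor_comp F G) functor_id t"
    using assms(1) unfolding equivalence_of_categories_def by blast
  note E = this
  obtain f where f: "f \<in> Arr C \<and> Dom C f = a \<and> Cod C f = b \<and> on_arr F f = k"
    using equivalence_full[OF E assms(2-)] by blast
  then show ?thesis
    by (rule ex1I) (use f in \<open>auto intro!: equivalence_faithful[OF E(1-3)]\<close>)
qed

text \<open>The preimage is the value of the quasi-inverse at \<open>b\<close>, and \<open>p\<close>
  is the component of the counit there.\<close>

lemma equivalence_of_categories_ess_surj:
  assumes "equivalence_of_categories C D F" "b \<in> Obj D"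
  shows "\<exists>a \<in> Obj C. \<exists>p. invertible D p \<and> Dom D p = on_obj F a \<and> Cod D p = b"
proof -
  obtain G s t where "is_functor D C G" "nat_iso D D (functor_comp F G) functor_id t"
    using assms(1) unfolding equivalence_of_categories_def by blast
  then interpret G: is_functor D C G + t: nat_iso D D "functor_comp F G" functor_id t by auto
  show ?thesis
    using t.component_invertible[OF assms(2)] t.Dom_component[OF assms(2)] t.Cod_component[OF assms(2)]
      G.on_obj_Obj[OF assms(2)]
    by (auto simp: functor_comp_def functor_id_def)
qed

section \<open>Vertical composites, inverses and whiskerings of natural isomorphisms\<close>

lemma nat_iso_vcomp:
  assumes "nat_iso C D S T p" "nat_iso C D T U q"
  shows "nat_iso C D S U (\<lambda>a. q a \<odot>\<^bsub>D\<^esub> p a)"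
proof -
  interpret p: nat_iso C D S T p by fact
  interpret q: nat_iso C D T U q by fact
  note [simp] = p.component_Arr p.Dom_component p.Cod_component q.component_Arr q.Dom_component q.Cod_component
    p.S.on_arr_Arr p.S.Dom_on_arr p.S.Cod_on_arr p.T.on_arr_Arr p.T.Dom_on_arr p.T.Cod_on_arr
    q.T.on_arr_Arr q.T.Dom_on_arr q.T.Cod_on_arr p.S.C.Dom_Obj p.S.C.Cod_Obj
    p.S.D.Cmp_Arr p.S.D.Dom_Cmp p.S.D.Cod_Cmp
  show ?thesis
  proof (unfold_locales, goal_cases)
    case (4 f)
    have "(q (Cod C f) \<odot>\<^bsub>D\<^esub> p (Cod C f)) \<odot>\<^bsub>D\<^esub> on_arr S f = (q (Cod C f) \<odot>\<^bsub>D\<^esub> on_arr T f) \<odot>\<^bsub>D\<^esub> p (Dom C f)"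
      using 4 by (simp add: p.S.D.Cmp_assoc p.naturality)
    also have "\<dots> = on_arr U f \<odot>\<^bsub>D\<^esub> (q (Dom C f) \<odot>\<^bsub>D\<^esub> p (Dom C f))"
      using 4 by (simp add: p.S.D.Cmp_assoc q.naturality)
    finally show ?case .
  next
    case (5 a)
    then show ?case by (auto intro!: p.S.D.invertible_Cmp p.component_invertible q.component_invertible)
  qed simp_all
qed

text \<open>Inverting every component suffices: naturality of the inverses follows by cancelling
  \<open>p\<close> on the right.\<close>

lemma nat_iso_inverse:
  assumes "nat_iso C D S T p"
  shows "\<exists>q. nat_iso C D T S q"
proof -
  interpret p: nat_iso C D S T p by fact
  define q where "q a = (SOME r. r \<in> Arr D \<and> Dom D r = Cod D (p a) \<and> Cod D r = Dom D (p a) \<and>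
     r \<odot>\<^bsub>D\<^esub> p a = Ide D (Dom D (p a)) \<and> p a \<odot>\<^bsub>D\<^esub> r = Ide D (Cod D (p a)))" for a
  have q: "q a \<in> Arr D \<and> Dom D (q a) = Cod D (p a) \<and> Cod D (q a) = Dom D (p a) \<and>
     q a \<odot>\<^bsub>D\<^esub> p a = Ide D (Dom D (p a)) \<and> p a \<odot>\<^bsub>D\<^esub> q a = Ide D (Cod D (p a))" if "a \<in> Obj C" for a
    unfolding q_def by (rule someI_ex) (use p.component_invertible[OF that] in \<open>auto simp: invertible_def\<close>)
  note [simp] = p.component_Arr p.Dom_component p.Cod_component q
    p.S.on_arr_Arr p.S.Dom_on_arr p.S.Cod_on_arr p.T.on_arr_Arr p.T.Dom_on_arr p.T.Cod_on_arr
    p.S.C.Dom_Obj p.S.C.Cod_Obj p.S.D.Cmp_Arr p.S.D.Dom_Cmp p.S.D.Cod_Cmp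
  have "nat_iso C D T S q"
  proof (unfold_locales, goal_cases)
    case (4 f)
    have "(q (Cod C f) \<odot>\<^bsub>D\<^esub> on_arr T f) \<odot>\<^bsub>D\<^esub> p (Dom C f) = q (Cod C f) \<odot>\<^bsub>D\<^esub> (p (Cod C f) \<odot>\<^bsub>D\<^esub> on_arr S f)"
      using 4 by (simp add: p.S.D.Cmp_assoc p.naturality)
    also have "\<dots> = (q (Cod C f) \<odot>\<^bsub>D\<^esub> p (Cod C f)) \<odot>\<^bsub>D\<^esub> on_arr S f"
      using 4 by (intro p.S.D.Cmp_assoc[symmetric]) simp_all
    also have "\<dots> = on_arr S f" using 4 p.S.D.Ide_Cmp[of "on_arr S f"] by simp
    also have "\<dots> = (on_arr S f \<odot>\<^bsub>D\<^esub> q (Dom C f)) \<odot>\<^bsub>D\<^esub> p (Dom C f)"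
      using 4 p.S.D.Cmp_Ide[of "on_arr S f"] by (simp add: p.S.D.Cmp_assoc)
    finally show ?case
      using 4 p.S.D.right_cancel[OF p.component_invertible[of "Dom C f"]] by simp
  next
    case (5 a)
    then show ?case unfolding invertible_def using q[OF 5] by (auto intro!: bexI[of _ "p a"])
  qed simp_all
  then show ?thesis by (rule exI[of _ q])
qed

lemma nat_iso_functor_comp_left:
  assumes "nat_iso C D S T p" "is_functor D E F"
  shows "nat_iso C E (functor_comp F S) (functor_comp F T) (\<lambda>a. on_arr F (p a))"
proof -
  interpret p: nat_iso C D S T p by fact
  interpret F: is_functor D E F by fact
  have "on_arr F (p (Cod C f)) \<odot>\<^bsub>E\<^esub> on_arr F (on_arr S f) = on_arr F (on_arr T f) \<odot>\<^bsub>E\<^esub> on_arr F (p (Dom C f))"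
    if "f \<in> Arr C" for f
    using p.naturality[OF that] that
    by (simp add: F.on_arr_Cmp[symmetric] p.component_Arr p.Dom_component p.Cod_component p.S.C.Dom_Obj p.S.C.Cod_Obj
        p.S.on_arr_Arr p.S.Cod_on_arr p.T.on_arr_Arr p.T.Dom_on_arr)
  then show ?thesis
    by unfold_locales
      (auto simp: functor_comp_def p.component_Arr p.Dom_component p.Cod_component
        p.component_invertible F.invertible_on_arr F.on_obj_Obj F.on_arr_Arr F.Dom_on_arr F.Cod_on_arr F.on_arr_Ide
        F.on_arr_Cmp p.S.on_obj_Obj p.S.on_arr_Arr p.S.Dom_on_arr p.S.Cod_on_arr p.S.on_arr_Ide p.S.on_arr_Cmp
        p.T.on_obj_Obj p.T.on_arr_Arr p.T.Dom_on_arr p.T.Cod_on_arr p.T.on_arr_Ide p.T.on_arr_Cmp p.S.C.Dom_Obj p.S.C.Cod_Obj)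
qed

lemma nat_iso_functor_comp_right:
  assumes "nat_iso D E S T p" "is_functor C D F"
  shows "nat_iso C E (functor_comp S F) (functor_comp T F) (\<lambda>a. p (on_obj F a))"
proof -
  interpret p: nat_iso D E S T p by fact
  interpret F: is_functor C D F by fact
  have "p (on_obj F (Cod C f)) \<odot>\<^bsub>E\<^esub> on_arr S (on_arr F f) = on_arr T (on_arr F f) \<odot>\<^bsub>E\<^esub> p (on_obj F (Dom C f))"
    if "f \<in> Arr C" for f
    using p.naturality[of "on_arr F f"] that by (simp add: F.on_arr_Arr F.Dom_on_arr F.Cod_on_arr)
  then show ?thesis
    by unfold_locales
      (auto simp: functor_comp_def p.component_Arr p.Dom_component p.Cod_component
        p.component_invertible F.on_obj_Obj F.on_arr_Arr F.Dom_on_arr F.Cod_on_arr F.on_arr_Ide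
        F.on_arr_Cmp p.S.on_obj_Obj p.S.on_arr_Arr p.S.Dom_on_arr p.S.Cod_on_arr p.S.on_arr_Ide p.S.on_arr_Cmp
        p.T.on_obj_Obj p.T.on_arr_Arr p.T.Dom_on_arr p.T.Cod_on_arr p.T.on_arr_Ide p.T.on_arr_Cmp)
qed

text \<open>The quasi-inverse is kept. The new unit continues \<open>s\<close> with the inverse of
  \<open>p\<close> whiskered by \<open>G\<close>, and the new counit precedes \<open>t\<close> by
  \<open>p\<close> whiskered with \<open>G\<close>.\<close>

lemma equivalence_of_categories_nat_iso:
  assumes "equivalence_of_categories C D F" "nat_iso C D F' F p"
  shows "equivalence_of_categories C D F'"
proof -
  obtain G s t where E: "is_functor D C G" "nat_iso C C functor_id (functor_comp G F) s"
    "nat_iso D D (functor_comp F G) functor_id t"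
    using assms(1) unfolding equivalence_of_categories_def by blast
  interpret p: nat_iso C D F' F p by fact
  obtain q where q: "nat_iso C D F F' q" using nat_iso_inverse[OF assms(2)] ..
  show ?thesis
    unfolding equivalence_of_categories_def
    using E(1) nat_iso_vcomp[OF E(2) nat_iso_functor_comp_left[OF q E(1)]]
      nat_iso_vcomp[OF nat_iso_functor_comp_right[OF assms(2) E(1)] E(3)] p.S.is_functor_axioms
    by blast
qed


section \<open>Whiskering and invertible 2-cells\<close>

text \<open>Choice makes the vertical inverse an operation; its value is meaningful for invertible
  \<open>\<alpha>\<close>, where it is unique by \<open>vinv_eqI\<close>.\<close>

definition vinv :: "('o, 'm, 'c) two_cat_data \<Rightarrow> 'c \<Rightarrow> 'c" where
  "vinv C \<alpha> = (SOME \<beta>. \<beta> \<in> Cl C \<and> vdom C \<beta> = vcod C \<alpha> \<and> vcod C \<beta> = vdom C \<alpha> \<and>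
     \<beta> \<bullet>\<^bsub>C\<^esub> \<alpha> = idc C (vdom C \<alpha>) \<and> \<alpha> \<bullet>\<^bsub>C\<^esub> \<beta> = idc C (vcod C \<alpha>))"

abbreviation iso2 :: "('o, 'm, 'c) two_cat_data \<Rightarrow> 'c \<Rightarrow> bool" where
  "iso2 C \<equiv> invertible (vertical_cat C)"

text \<open>Whiskerings are constants of their own, so that rewrite rules can address them
  separately from general horizontal composites.\<close>

definition lwhisker :: "('o, 'm, 'c) two_cat_data \<Rightarrow> 'm \<Rightarrow> 'c \<Rightarrow> 'c"  (infixr "\<rhd>\<index>" 76) where
  "f \<rhd>\<^bsub>C\<^esub> \<alpha> = idc C f \<star>\<^bsub>C\<^esub> \<alpha>"

definition rwhisker :: "('o, 'm, 'c) two_cat_data \<Rightarrow> 'c \<Rightarrow> 'm \<Rightarrow> 'c"  (infixl "\<lhd>\<index>" 77) where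
  "\<alpha> \<lhd>\<^bsub>C\<^esub> f = \<alpha> \<star>\<^bsub>C\<^esub> idc C f"

context two_category begin

lemma iso2_iff: "iso2 C \<alpha> \<longleftrightarrow> \<alpha> \<in> Cl C \<and> (\<exists>\<beta> \<in> Cl C. vdom C \<beta> = vcod C \<alpha> \<and> vcod C \<beta> = vdom C \<alpha> \<and>
     \<beta> \<bullet> \<alpha> = idc C (vdom C \<alpha>) \<and> \<alpha> \<bullet> \<beta> = idc C (vcod C \<alpha>))"
  by (simp add: invertible_def vertical_cat_def)

lemma iso2_Cl: "iso2 C \<alpha> \<Longrightarrow> \<alpha> \<in> Cl C"
  by (simp add: iso2_iff)

lemma
  assumes "iso2 C \<alpha>"
  shows vinv_Cl: "vinv C \<alpha> \<in> Cl C"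
    and vdom_vinv: "vdom C (vinv C \<alpha>) = vcod C \<alpha>"
    and vcod_vinv: "vcod C (vinv C \<alpha>) = vdom C \<alpha>"
    and vinv_vcomp: "vinv C \<alpha> \<bullet> \<alpha> = idc C (vdom C \<alpha>)"
    and vcomp_vinv: "\<alpha> \<bullet> vinv C \<alpha> = idc C (vcod C \<alpha>)"
proof -
  have "\<exists>\<beta>. \<beta> \<in> Cl C \<and> vdom C \<beta> = vcod C \<alpha> \<and> vcod C \<beta> = vdom C \<alpha> \<and>
     \<beta> \<bullet> \<alpha> = idc C (vdom C \<alpha>) \<and> \<alpha> \<bullet> \<beta> = idc C (vcod C \<alpha>)"
    using assms by (auto simp: iso2_iff)
  from someI_ex[OF this] show "vinv C \<alpha> \<in> Cl C" "vdom C (vinv C \<alpha>) = vcod C \<alpha>"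
    "vcod C (vinv C \<alpha>) = vdom C \<alpha>" "vinv C \<alpha> \<bullet> \<alpha> = idc C (vdom C \<alpha>)"
    "\<alpha> \<bullet> vinv C \<alpha> = idc C (vcod C \<alpha>)"
    unfolding vinv_def by blast+
qed

lemma iso2I:
  assumes "\<alpha> \<in> Cl C" "\<beta> \<in> Cl C" "vdom C \<beta> = vcod C \<alpha>" "vcod C \<beta> = vdom C \<alpha>"
     "\<beta> \<bullet> \<alpha> = idc C (vdom C \<alpha>)" "\<alpha> \<bullet> \<beta> = idc C (vcod C \<alpha>)"
  shows "iso2 C \<alpha>"
  using assms by (auto simp: iso2_iff)

lemma iso2_vinv: "iso2 C \<alpha> \<Longrightarrow> iso2 C (vinv C \<alpha>)"
  by (rule iso2I[of _ \<alpha>]) (simp_all add: iso2_Cl vinv_Cl vdom_vinv vcod_vinv vinv_vcomp vcomp_vinv)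

lemma iso2_idc: "f \<in> Ar C \<Longrightarrow> iso2 C (idc C f)"
  by (rule iso2I[of _ "idc C f"]) (simp_all add: cell_simps idc_idem)

lemma iso2_vcomp: "\<lbrakk>iso2 C \<beta>; iso2 C \<alpha>; vdom C \<beta> = vcod C \<alpha>\<rbrakk> \<Longrightarrow> iso2 C (\<beta> \<bullet> \<alpha>)"
  using category.invertible_Cmp[OF vertical_category, of \<beta> \<alpha>] by (simp add: vertical_cat_def)

lemma iso2_hcomp:
  assumes "iso2 C \<beta>" "iso2 C \<alpha>" "src C (vdom C \<beta>) = tgt C (vdom C \<alpha>)"
  shows "iso2 C (\<beta> \<star> \<alpha>)"
proof -
  note i = iso2_Cl[OF assms(1)] vinv_Cl[OF assms(1)] vdom_vinv[OF assms(1)] vcod_vinv[OF assms(1)]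
    vinv_vcomp[OF assms(1)] vcomp_vinv[OF assms(1)]
    iso2_Cl[OF assms(2)] vinv_Cl[OF assms(2)] vdom_vinv[OF assms(2)] vcod_vinv[OF assms(2)]
    vinv_vcomp[OF assms(2)] vcomp_vinv[OF assms(2)]
  show ?thesis
    by (rule iso2I[of _ "vinv C \<beta> \<star> vinv C \<alpha>"])
      (simp_all add: i cell_simps assms interchange[symmetric] hcomp_idc)
qed

section \<open>Calculus of whiskering\<close>

lemma lwhisker_Cl: "\<lbrakk>f \<in> Ar C; \<alpha> \<in> Cl C; src C f = tgt C (vdom C \<alpha>)\<rbrakk> \<Longrightarrow> f \<rhd> \<alpha> \<in> Cl C"
  and vdom_lwhisker: "\<lbrakk>f \<in> Ar C; \<alpha> \<in> Cl C; src C f = tgt C (vdom C \<alpha>)\<rbrakk> \<Longrightarrow> vdom C (f \<rhd> \<alpha>) = f \<cdot> vdom C \<alpha>"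
  and vcod_lwhisker: "\<lbrakk>f \<in> Ar C; \<alpha> \<in> Cl C; src C f = tgt C (vdom C \<alpha>)\<rbrakk> \<Longrightarrow> vcod C (f \<rhd> \<alpha>) = f \<cdot> vcod C \<alpha>"
  and rwhisker_Cl: "\<lbrakk>f \<in> Ar C; \<alpha> \<in> Cl C; src C (vdom C \<alpha>) = tgt C f\<rbrakk> \<Longrightarrow> \<alpha> \<lhd> f \<in> Cl C"
  and vdom_rwhisker: "\<lbrakk>f \<in> Ar C; \<alpha> \<in> Cl C; src C (vdom C \<alpha>) = tgt C f\<rbrakk> \<Longrightarrow> vdom C (\<alpha> \<lhd> f) = vdom C \<alpha> \<cdot> f"
  and vcod_rwhisker: "\<lbrakk>f \<in> Ar C; \<alpha> \<in> Cl C; src C (vdom C \<alpha>) = tgt C f\<rbrakk> \<Longrightarrow> vcod C (\<alpha> \<lhd> f) = vcod C \<alpha> \<cdot> f"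
  by (simp_all add: lwhisker_def rwhisker_def cell_simps)

lemma iso2_lwhisker: "\<lbrakk>f \<in> Ar C; iso2 C \<alpha>; src C f = tgt C (vdom C \<alpha>)\<rbrakk> \<Longrightarrow> iso2 C (f \<rhd> \<alpha>)"
  and iso2_rwhisker: "\<lbrakk>f \<in> Ar C; iso2 C \<alpha>; src C (vdom C \<alpha>) = tgt C f\<rbrakk> \<Longrightarrow> iso2 C (\<alpha> \<lhd> f)"
  by (simp_all add: lwhisker_def rwhisker_def iso2_hcomp iso2_idc cell_simps)

lemmas cell_typing = cell_simps lwhisker_Cl vdom_lwhisker vcod_lwhisker rwhisker_Cl vdom_rwhisker vcod_rwhisker

lemma lwhisker_lwhisker:
  "\<lbrakk>f \<in> Ar C; g \<in> Ar C; \<alpha> \<in> Cl C; src C f = tgt C g; src C g = tgt C (vdom C \<alpha>)\<rbrakk> \<Longrightarrow> f \<rhd> g \<rhd> \<alpha> = (f \<cdot> g) \<rhd> \<alpha>"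
  and rwhisker_rwhisker:
  "\<lbrakk>f \<in> Ar C; g \<in> Ar C; \<alpha> \<in> Cl C; src C f = tgt C g; src C (vdom C \<alpha>) = tgt C f\<rbrakk> \<Longrightarrow> \<alpha> \<lhd> f \<lhd> g = \<alpha> \<lhd> (f \<cdot> g)"
  and rwhisker_lwhisker:
  "\<lbrakk>f \<in> Ar C; g \<in> Ar C; \<alpha> \<in> Cl C; src C f = tgt C (vdom C \<alpha>); src C (vdom C \<alpha>) = tgt C g\<rbrakk>
    \<Longrightarrow> (f \<rhd> \<alpha>) \<lhd> g = f \<rhd> (\<alpha> \<lhd> g)"
  and lwhisker_idc: "\<lbrakk>f \<in> Ar C; g \<in> Ar C; src C f = tgt C g\<rbrakk> \<Longrightarrow> f \<rhd> idc C g = idc C (f \<cdot> g)"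
  and rwhisker_idc: "\<lbrakk>f \<in> Ar C; g \<in> Ar C; src C f = tgt C g\<rbrakk> \<Longrightarrow> idc C f \<lhd> g = idc C (f \<cdot> g)"
  and lwhisker_one: "\<lbrakk>\<alpha> \<in> Cl C; tgt C (vdom C \<alpha>) = a\<rbrakk> \<Longrightarrow> one C a \<rhd> \<alpha> = \<alpha>"
  and rwhisker_one: "\<lbrakk>\<alpha> \<in> Cl C; src C (vdom C \<alpha>) = a\<rbrakk> \<Longrightarrow> \<alpha> \<lhd> one C a = \<alpha>"
  and lwhisker_vcomp: "\<lbrakk>f \<in> Ar C; \<alpha> \<in> Cl C; \<beta> \<in> Cl C; src C f = tgt C (vdom C \<alpha>); vdom C \<beta> = vcod C \<alpha>\<rbrakk>
    \<Longrightarrow> f \<rhd> (\<beta> \<bullet> \<alpha>) = (f \<rhd> \<beta>) \<bullet> (f \<rhd> \<alpha>)"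
  and rwhisker_vcomp: "\<lbrakk>f \<in> Ar C; \<alpha> \<in> Cl C; \<beta> \<in> Cl C; src C (vdom C \<alpha>) = tgt C f; vdom C \<beta> = vcod C \<alpha>\<rbrakk>
    \<Longrightarrow> (\<beta> \<bullet> \<alpha>) \<lhd> f = (\<beta> \<lhd> f) \<bullet> (\<alpha> \<lhd> f)"
  and hcomp_rwhisker: "\<lbrakk>\<beta> \<in> Cl C; \<alpha> \<in> Cl C; f \<in> Ar C; src C (vdom C \<beta>) = tgt C (vdom C \<alpha>); src C (vdom C \<alpha>) = tgt C f\<rbrakk>
    \<Longrightarrow> (\<beta> \<star> \<alpha>) \<lhd> f = \<beta> \<star> (\<alpha> \<lhd> f)"
  and lwhisker_hcomp: "\<lbrakk>\<beta> \<in> Cl C; \<alpha> \<in> Cl C; f \<in> Ar C; src C (vdom C \<beta>) = tgt C (vdom C \<alpha>); src C f = tgt C (vdom C \<beta>)\<rbrakk>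
    \<Longrightarrow> (f \<rhd> \<beta>) \<star> \<alpha> = f \<rhd> (\<beta> \<star> \<alpha>)"
  and hcomp_lwhisker: "\<lbrakk>\<beta> \<in> Cl C; \<alpha> \<in> Cl C; f \<in> Ar C; src C (vdom C \<beta>) = tgt C f; src C f = tgt C (vdom C \<alpha>)\<rbrakk>
    \<Longrightarrow> \<beta> \<star> (f \<rhd> \<alpha>) = (\<beta> \<lhd> f) \<star> \<alpha>"
  by (auto simp add: lwhisker_def rwhisker_def cell_simps hcomp_assoc hcomp_idc[symmetric] interchange[symmetric]
     idc_idem hcomp_one one_hcomp)

text \<open>Interchange after padding with identity cells. Equating the two factorizations slides
  one 2-cell past another.\<close>

lemma hcomp_eq_whisker:
  assumes "\<beta> \<in> Cl C" "\<alpha> \<in> Cl C" "src C (vdom C \<beta>) = tgt C (vdom C \<alpha>)"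
  shows "\<beta> \<star> \<alpha> = (\<beta> \<lhd> vcod C \<alpha>) \<bullet> (vdom C \<beta> \<rhd> \<alpha>)"
    and "\<beta> \<star> \<alpha> = (vcod C \<beta> \<rhd> \<alpha>) \<bullet> (\<beta> \<lhd> vdom C \<alpha>)"
  using assms by (simp_all add: lwhisker_def rwhisker_def interchange[symmetric] cell_simps vcomp_idc idc_vcomp)

text \<open>Interchange with an identity factor absorbs a whiskering into one side of a horizontal
  composite. The next three lemmas do the same for the other order and the other side.\<close>

lemma hcomp_vcomp_lwhisker:
  assumes "\<beta> \<in> Cl C" "\<alpha> \<in> Cl C" "\<gamma> \<in> Cl C" "vdom C \<alpha> = vcod C \<gamma>"
    "src C (vdom C \<beta>) = tgt C (vdom C \<alpha>)" "vdom C \<beta> = f"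
  shows "(\<beta> \<star> \<alpha>) \<bullet> (f \<rhd> \<gamma>) = \<beta> \<star> (\<alpha> \<bullet> \<gamma>)"
  using assms by (auto simp: lwhisker_def interchange[symmetric] cell_simps vcomp_idc)

lemma lwhisker_vcomp_hcomp:
  assumes "\<beta> \<in> Cl C" "\<alpha> \<in> Cl C" "\<gamma> \<in> Cl C" "vdom C \<gamma> = vcod C \<alpha>"
    "src C (vdom C \<beta>) = tgt C (vdom C \<alpha>)" "vcod C \<beta> = f"
  shows "(f \<rhd> \<gamma>) \<bullet> (\<beta> \<star> \<alpha>) = \<beta> \<star> (\<gamma> \<bullet> \<alpha>)"
  using assms by (auto simp: lwhisker_def interchange[symmetric] cell_simps idc_vcomp)

lemma hcomp_vcomp_rwhisker:
  assumes "\<beta> \<in> Cl C" "\<alpha> \<in> Cl C" "\<gamma> \<in> Cl C" "vdom C \<beta> = vcod C \<gamma>"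
    "src C (vdom C \<beta>) = tgt C (vdom C \<alpha>)" "vdom C \<alpha> = f"
  shows "(\<beta> \<star> \<alpha>) \<bullet> (\<gamma> \<lhd> f) = (\<beta> \<bullet> \<gamma>) \<star> \<alpha>"
proof -
  have "src C (vdom C \<gamma>) = tgt C f" using assms src_vcod by metis
  then show ?thesis
  using assms by (auto simp: rwhisker_def interchange[symmetric] cell_simps vcomp_idc)
qed

lemma rwhisker_vcomp_hcomp:
  assumes "\<beta> \<in> Cl C" "\<alpha> \<in> Cl C" "\<gamma> \<in> Cl C" "vdom C \<gamma> = vcod C \<beta>"
    "src C (vdom C \<beta>) = tgt C (vdom C \<alpha>)" "vcod C \<alpha> = f"
  shows "(\<gamma> \<lhd> f) \<bullet> (\<beta> \<star> \<alpha>) = (\<gamma> \<bullet> \<beta>) \<star> \<alpha>"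
  using assms by (auto simp: rwhisker_def interchange[symmetric] cell_simps idc_vcomp)

lemma iso2_right_cancel:
  assumes "iso2 C p" "\<alpha> \<in> Cl C" "\<beta> \<in> Cl C" "vdom C \<alpha> = vcod C p" "vdom C \<beta> = vcod C p" "\<alpha> \<bullet> p = \<beta> \<bullet> p"
  shows "\<alpha> = \<beta>"
  using category.right_cancel[OF vertical_category, of p \<alpha> \<beta>] assms by (simp add: vertical_cat_def)

lemma vinv_vcomp_assoc:
  assumes "iso2 C p" "\<alpha> \<in> Cl C" "vcod C \<alpha> = vdom C p"
  shows "vinv C p \<bullet> p \<bullet> \<alpha> = \<alpha>"
  using vcomp_assoc[of "vinv C p" p \<alpha>] assms idc_vcomp[of \<alpha>]
  by (simp add: iso2_Cl vinv_Cl vdom_vinv vinv_vcomp)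

lemma vcomp_vinv_assoc:
  assumes "iso2 C p" "\<alpha> \<in> Cl C" "vcod C \<alpha> = vcod C p"
  shows "p \<bullet> vinv C p \<bullet> \<alpha> = \<alpha>"
  using vcomp_assoc[of p "vinv C p" \<alpha>] assms idc_vcomp[of \<alpha>]
  by (simp add: iso2_Cl vinv_Cl vdom_vinv vcod_vinv vcomp_vinv)

text \<open>Inverts two opposite legs of a commuting square. It passes from equations between cells
  in one direction to equations between their inverses.\<close>

lemma vinv_conjugate:
  assumes "iso2 C p" "iso2 C q" "\<alpha> \<in> Cl C" "\<beta> \<in> Cl C"
    "vdom C \<alpha> = vdom C p" "vcod C \<alpha> = vdom C q" "vdom C \<beta> = vcod C p" "vcod C \<beta> = vcod C q"
    "q \<bullet> \<alpha> = \<beta> \<bullet> p"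
  shows "vinv C q \<bullet> \<beta> = \<alpha> \<bullet> vinv C p"
proof -
  note i = iso2_Cl[OF assms(1)] vinv_Cl[OF assms(1)] vdom_vinv[OF assms(1)] vcod_vinv[OF assms(1)]
    vinv_vcomp[OF assms(1)] vcomp_vinv[OF assms(1)]
    iso2_Cl[OF assms(2)] vinv_Cl[OF assms(2)] vdom_vinv[OF assms(2)] vcod_vinv[OF assms(2)]
    vinv_vcomp[OF assms(2)] vcomp_vinv[OF assms(2)]
  have "(vinv C q \<bullet> \<beta>) \<bullet> p = vinv C q \<bullet> q \<bullet> \<alpha>"
    unfolding assms(9) using assms(3-8) i(1-4,7-10) by (intro vcomp_assoc) simp_all
  also have "\<dots> = \<alpha> \<bullet> idc C (vdom C p)"
    using assms(2,3,5,6) vcomp_idc[of \<alpha>] by (simp add: vinv_vcomp_assoc)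
  also have "\<dots> = (\<alpha> \<bullet> vinv C p) \<bullet> p"
    unfolding i(5)[symmetric] using assms(3,5) i(1-4) by (intro vcomp_assoc[symmetric]) simp_all
  finally show ?thesis
    by (rule iso2_right_cancel[OF assms(1), rotated -1]) (use assms(3-8) i in \<open>simp_all add: cell_simps\<close>)
qed

lemma vinv_eqI:
  assumes "iso2 C p" "\<alpha> \<in> Cl C" "vdom C \<alpha> = vcod C p" "vcod C \<alpha> = vdom C p" "\<alpha> \<bullet> p = idc C (vdom C p)"
  shows "\<alpha> = vinv C p"
  by (rule iso2_right_cancel[OF assms(1)]) (use assms in \<open>simp_all add: vinv_Cl vdom_vinv vinv_vcomp\<close>)

lemma vinv_vcomp_distrib:
  assumes "iso2 C p" "iso2 C q" "vdom C q = vcod C p"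
  shows "vinv C (q \<bullet> p) = vinv C p \<bullet> vinv C q"
proof -
  have "(vinv C p \<bullet> vinv C q) \<bullet> (q \<bullet> p) = vinv C p \<bullet> (vinv C q \<bullet> q \<bullet> p)"
    using assms by (subst vcomp_assoc) (simp_all add: iso2_Cl vinv_Cl vdom_vinv vcod_vinv cell_simps)
  also have "\<dots> = idc C (vdom C p)"
    using assms by (simp add: vinv_vcomp_assoc iso2_Cl vinv_vcomp)
  finally show ?thesis
    using assms by (intro vinv_eqI[symmetric]) (simp_all add: iso2_vcomp iso2_Cl vinv_Cl vdom_vinv vcod_vinv cell_simps)
qed

lemma vinv_lwhisker:
  assumes "f \<in> Ar C" "iso2 C p" "src C f = tgt C (vdom C p)"
  shows "vinv C (f \<rhd> p) = f \<rhd> vinv C p"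
proof -
  have [simp]: "tgt C (vcod C p) = tgt C (vdom C p)" using assms by (simp add: tgt_vcod iso2_Cl)
  show ?thesis
    using assms by (intro vinv_eqI[symmetric]) (simp_all add: iso2_lwhisker iso2_Cl vinv_Cl vdom_vinv vcod_vinv
      cell_typing lwhisker_vcomp[symmetric] vinv_vcomp lwhisker_idc)
qed

lemma vinv_rwhisker:
  assumes "f \<in> Ar C" "iso2 C p" "src C (vdom C p) = tgt C f"
  shows "vinv C (p \<lhd> f) = vinv C p \<lhd> f"
proof -
  have [simp]: "src C (vcod C p) = src C (vdom C p)" using assms by (simp add: src_vcod iso2_Cl)
  show ?thesis
    using assms by (intro vinv_eqI[symmetric]) (simp_all add: iso2_rwhisker iso2_Cl vinv_Cl vdom_vinv vcod_vinv
      cell_typing rwhisker_vcomp[symmetric] vinv_vcomp rwhisker_idc)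
qed

end

section \<open>The inverted coherence cells of a pseudo functor\<close>

definition pf_decomp :: "('p, 'n, 'd) two_cat_data \<Rightarrow> ('o, 'm, 'c, 'p, 'n, 'd) pseudo_functor_data \<Rightarrow> 'm \<Rightarrow> 'm \<Rightarrow> 'd" where
  "pf_decomp D F g f = vinv D (pf_comp F g f)"

definition pf_counit :: "('p, 'n, 'd) two_cat_data \<Rightarrow> ('o, 'm, 'c, 'p, 'n, 'd) pseudo_functor_data \<Rightarrow> 'o \<Rightarrow> 'd" where
  "pf_counit D F a = vinv D (pf_unit F a)"

context pseudo_functor begin

lemma
  assumes "g \<in> Ar C" "f \<in> Ar C" "src C g = tgt C f"
  shows iso2_pf_decomp: "iso2 D (pf_decomp D F g f)"
    and pf_decomp_Cl: "pf_decomp D F g f \<in> Cl D"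
    and vdom_pf_decomp: "vdom D (pf_decomp D F g f) = pf_ar F (g \<cdot>\<^bsub>C\<^esub> f)"
    and vcod_pf_decomp: "vcod D (pf_decomp D F g f) = pf_ar F g \<cdot>\<^bsub>D\<^esub> pf_ar F f"
    and pf_comp_Cl: "pf_comp F g f \<in> Cl D"
    and pf_decomp_pf_comp: "pf_decomp D F g f \<bullet>\<^bsub>D\<^esub> pf_comp F g f = idc D (pf_ar F g \<cdot>\<^bsub>D\<^esub> pf_ar F f)"
    and pf_comp_pf_decomp: "pf_comp F g f \<bullet>\<^bsub>D\<^esub> pf_decomp D F g f = idc D (pf_ar F (g \<cdot>\<^bsub>C\<^esub> f))"
  using assms pf_comp_invertible[OF assms]
  by (simp_all add: pf_decomp_def D.iso2_vinv D.iso2_Cl D.vinv_Cl D.vdom_vinv D.vcod_vinv vdom_pf_comp vcod_pf_comp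
    D.vinv_vcomp D.vcomp_vinv)

lemma
  assumes "a \<in> Ob C"
  shows iso2_pf_counit: "iso2 D (pf_counit D F a)"
    and pf_counit_Cl: "pf_counit D F a \<in> Cl D"
    and vdom_pf_counit: "vdom D (pf_counit D F a) = pf_ar F (one C a)"
    and vcod_pf_counit: "vcod D (pf_counit D F a) = one D (pf_ob F a)"
    and pf_unit_Cl: "pf_unit F a \<in> Cl D"
  using assms pf_unit_invertible[OF assms]
  by (simp_all add: pf_counit_def D.iso2_vinv D.iso2_Cl D.vinv_Cl D.vdom_vinv D.vcod_vinv vdom_pf_unit vcod_pf_unit
    D.vinv_vcomp D.vcomp_vinv)

lemmas pf_typing = pf_ob pf_ar src_pf_ar tgt_pf_ar pf_cl vdom_pf_cl vcod_pf_cl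
  pf_comp_Cl vdom_pf_comp vcod_pf_comp pf_unit_Cl vdom_pf_unit vcod_pf_unit
  pf_decomp_Cl vdom_pf_decomp vcod_pf_decomp pf_counit_Cl vdom_pf_counit vcod_pf_counit

lemma pf_decomp_natural:
  assumes "\<beta> \<in> Cl C" "\<alpha> \<in> Cl C" "src C (vdom C \<beta>) = tgt C (vdom C \<alpha>)"
  shows "(pf_cl F \<beta> \<star>\<^bsub>D\<^esub> pf_cl F \<alpha>) \<bullet>\<^bsub>D\<^esub> pf_decomp D F (vdom C \<beta>) (vdom C \<alpha>)
    = pf_decomp D F (vcod C \<beta>) (vcod C \<alpha>) \<bullet>\<^bsub>D\<^esub> pf_cl F (\<beta> \<star>\<^bsub>C\<^esub> \<alpha>)"
  unfolding pf_decomp_def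
  by (rule D.vinv_conjugate[symmetric])
    (use assms in \<open>simp_all add: pf_comp_invertible pf_typing C.cell_typing D.cell_typing pf_comp_natural\<close>)

text \<open>The two sides are the inverses of the sides of \<open>pf_assoc\<close>;
  \<open>vinv\<close> reverses vertical composites and commutes with whiskering.\<close>

lemma pf_decomp_assoc:
  assumes "h \<in> Ar C" "g \<in> Ar C" "f \<in> Ar C" "src C h = tgt C g" "src C g = tgt C f"
  shows "(pf_ar F h \<rhd>\<^bsub>D\<^esub> pf_decomp D F g f) \<bullet>\<^bsub>D\<^esub> pf_decomp D F h (g \<cdot>\<^bsub>C\<^esub> f)
    = (pf_decomp D F h g \<lhd>\<^bsub>D\<^esub> pf_ar F f) \<bullet>\<^bsub>D\<^esub> pf_decomp D F (h \<cdot>\<^bsub>C\<^esub> g) f"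
proof -
  note s = assms pf_comp_invertible pf_typing C.cell_typing D.cell_typing D.iso2_lwhisker D.iso2_rwhisker
  have "vinv D (pf_comp F h (g \<cdot>\<^bsub>C\<^esub> f) \<bullet>\<^bsub>D\<^esub> (pf_ar F h \<rhd>\<^bsub>D\<^esub> pf_comp F g f))
    = vinv D (pf_comp F (h \<cdot>\<^bsub>C\<^esub> g) f \<bullet>\<^bsub>D\<^esub> (pf_comp F h g \<lhd>\<^bsub>D\<^esub> pf_ar F f))"
    using pf_assoc[OF assms] by (simp add: lwhisker_def rwhisker_def)
  then show ?thesis
    by (simp add: s D.vinv_vcomp_distrib D.vinv_lwhisker D.vinv_rwhisker pf_decomp_def)
qed

text \<open>This is \<open>pf_unit_right\<close> inverted, an identity cell being its own inverse;
  \<open>pf_decomp_one_left\<close> treats the other side.\<close>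

lemma pf_decomp_one_right:
  assumes "f \<in> Ar C" "src C f = a"
  shows "(pf_ar F f \<rhd>\<^bsub>D\<^esub> pf_counit D F a) \<bullet>\<^bsub>D\<^esub> pf_decomp D F f (one C a) = idc D (pf_ar F f)"
proof -
  note s = assms pf_comp_invertible pf_unit_invertible pf_typing C.cell_typing D.cell_typing D.iso2_lwhisker D.iso2_rwhisker
  have a: "a \<in> Ob C" "f \<cdot>\<^bsub>C\<^esub> one C a = f" "pf_ar F f \<cdot>\<^bsub>D\<^esub> one D (pf_ob F a) = pf_ar F f"
    using assms C.comp1_one[of f] D.comp1_one[of "pf_ar F f"] by (auto simp: C.cell_simps pf_ar src_pf_ar)
  have "vinv D (pf_comp F f (one C a) \<bullet>\<^bsub>D\<^esub> (pf_ar F f \<rhd>\<^bsub>D\<^esub> pf_unit F a)) = vinv D (idc D (pf_ar F f))"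
    using pf_unit_right[OF assms(1)] assms by (simp add: lwhisker_def)
  also have "\<dots> = idc D (pf_ar F f)"
    by (rule D.vinv_eqI[symmetric]) (use assms in \<open>simp_all add: D.iso2_idc pf_ar D.cell_simps D.idc_idem\<close>)
  finally show ?thesis
    using a by (simp add: s D.vinv_vcomp_distrib D.vinv_lwhisker D.vinv_rwhisker pf_decomp_def pf_counit_def)
qed

lemma pf_decomp_one_left:
  assumes "f \<in> Ar C" "tgt C f = a"
  shows "(pf_counit D F a \<lhd>\<^bsub>D\<^esub> pf_ar F f) \<bullet>\<^bsub>D\<^esub> pf_decomp D F (one C a) f = idc D (pf_ar F f)"
proof -
  note s = assms pf_comp_invertible pf_unit_invertible pf_typing C.cell_typing D.cell_typing D.iso2_lwhisker D.iso2_rwhisker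
  have a: "a \<in> Ob C" "one C a \<cdot>\<^bsub>C\<^esub> f = f" "one D (pf_ob F a) \<cdot>\<^bsub>D\<^esub> pf_ar F f = pf_ar F f"
    using assms C.one_comp1[of f] D.one_comp1[of "pf_ar F f"] by (auto simp: C.cell_simps pf_ar tgt_pf_ar)
  have "vinv D (pf_comp F (one C a) f \<bullet>\<^bsub>D\<^esub> (pf_unit F a \<lhd>\<^bsub>D\<^esub> pf_ar F f)) = vinv D (idc D (pf_ar F f))"
    using pf_unit_left[OF assms(1)] assms by (simp add: rwhisker_def)
  also have "\<dots> = idc D (pf_ar F f)"
    by (rule D.vinv_eqI[symmetric]) (use assms in \<open>simp_all add: D.iso2_idc pf_ar D.cell_simps D.idc_idem\<close>)
  finally show ?thesis
    using a by (simp add: s D.vinv_vcomp_distrib D.vinv_lwhisker D.vinv_rwhisker pf_decomp_def pf_counit_def)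
qed

end


section \<open>The 2-category of squares over biuniversal arrows\<close>

text \<open>The right-hand side of the theorem after a choice: \<open>R\<close> and
  \<open>\<eta>\<close> are functions, so that squares meeting at an object of \<open>X\<close>
  share the edge there.\<close>

locale biuniversal_family = G: pseudo_functor A X G
  for A :: "('ao, 'am, 'ac) two_cat_data" and X :: "('xo, 'xm, 'xc) two_cat_data" (structure)
    and G :: "('ao, 'am, 'ac, 'xo, 'xm, 'xc) pseudo_functor_data" +
  fixes R :: "'xo \<Rightarrow> 'ao" and \<eta> :: "'xo \<Rightarrow> 'xm"
  assumes biuniversal: "x \<in> Ob X \<Longrightarrow> biuniversal_arrow A X G x (R x) (\<eta> x)"
begin

abbreviation "d \<equiv> pf_decomp X G"

section \<open>Typing, filling and factorization for the biuniversal arrows\<close>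

lemma R_Ob: "x \<in> Ob X \<Longrightarrow> R x \<in> Ob A"
  and \<eta>_Ar: "x \<in> Ob X \<Longrightarrow> \<eta> x \<in> Ar X"
  and src_\<eta>: "x \<in> Ob X \<Longrightarrow> src X (\<eta> x) = x"
  and tgt_\<eta>: "x \<in> Ob X \<Longrightarrow> tgt X (\<eta> x) = pf_ob G (R x)"
  using biuniversal unfolding biuniversal_arrow_def Mor_def by auto

lemmas typing = R_Ob \<eta>_Ar src_\<eta> tgt_\<eta> G.pf_typing G.C.cell_typing G.D.cell_typing

text \<open>Full faithfulness of \<open>f \<mapsto> G f \<cdot> \<eta> x\<close>, with the hom
  categories unfolded into 2-cells with prescribed boundary.\<close>

lemma fill_ex1:
  assumes "x \<in> Ob X" "f \<in> Ar A" "src A f = R x" "f' \<in> Ar A" "src A f' = R x" "tgt A f' = tgt A f"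
    "\<tau> \<in> Cl X" "vdom X \<tau> = pf_ar G f \<cdot> \<eta> x" "vcod X \<tau> = pf_ar G f' \<cdot> \<eta> x"
  shows "\<exists>!\<gamma>. \<gamma> \<in> Cl A \<and> vdom A \<gamma> = f \<and> vcod A \<gamma> = f' \<and> pf_cl G \<gamma> \<lhd> \<eta> x = \<tau>"
proof -
  have "equivalence_of_categories (Mor A (R x) (tgt A f)) (Mor X x (pf_ob G (tgt A f)))
        \<lparr>on_obj = \<lambda>f'. pf_ar G f' \<cdot> \<eta> x, on_arr = \<lambda>\<gamma>. pf_cl G \<gamma> \<star> idc X (\<eta> x)\<rparr>"
    using biuniversal[OF assms(1)] assms(2) by (auto simp: biuniversal_arrow_def typing)
  from equivalence_of_categories_full_faithful[OF this, of f f' \<tau>]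
  have "\<exists>!\<gamma>. \<gamma> \<in> Arr (Mor A (R x) (tgt A f)) \<and> vdom A \<gamma> = f \<and> vcod A \<gamma> = f' \<and> pf_cl G \<gamma> \<lhd> \<eta> x = \<tau>"
    using assms by (auto simp: Mor_def typing rwhisker_def)
  \<comment> \<open>Once the domain is \<open>f\<close>, the endpoint conditions of
    \<open>Mor\<close> hold automatically, so uniqueness extends to all 2-cells of \<open>A\<close>
    with this boundary.\<close>
  moreover have "\<gamma> \<in> Arr (Mor A (R x) (tgt A f)) \<and> vdom A \<gamma> = f \<longleftrightarrow> \<gamma> \<in> Cl A \<and> vdom A \<gamma> = f" for \<gamma>
    using assms by (auto simp: Mor_def)
  ultimately show ?thesis by (metis (no_types, lifting))
qed

text \<open>Essential surjectivity of the same functor; the comparison cell is invertible in a hom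
  category and hence in \<open>X\<close>.\<close>

lemma factorization_ex:
  assumes "x \<in> Ob X" "a \<in> Ob A" "u \<in> Ar X" "src X u = x" "tgt X u = pf_ob G a"
  shows "\<exists>f p. f \<in> Ar A \<and> src A f = R x \<and> tgt A f = a \<and> iso2 X p \<and>
    vdom X p = pf_ar G f \<cdot> \<eta> x \<and> vcod X p = u"
proof -
  have "equivalence_of_categories (Mor A (R x) a) (Mor X x (pf_ob G a))
        \<lparr>on_obj = \<lambda>f'. pf_ar G f' \<cdot> \<eta> x, on_arr = \<lambda>\<gamma>. pf_cl G \<gamma> \<star> idc X (\<eta> x)\<rparr>"
    using biuniversal[OF assms(1)] assms(2) by (auto simp: biuniversal_arrow_def)
  from equivalence_of_categories_ess_surj[OF this, of u]
  obtain f p where "f \<in> Obj (Mor A (R x) a)" "invertible (Mor X x (pf_ob G a)) p"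
    "vdom X p = pf_ar G f \<cdot> \<eta> x" "vcod X p = u"
    using assms by (auto simp: Mor_def)
  moreover have "iso2 X p" using calculation(2) by (auto simp: invertible_def Mor_def vertical_cat_def)
  ultimately show ?thesis by (auto simp: Mor_def)
qed

section \<open>Squares and their composition\<close>

definition square :: "'xo \<Rightarrow> 'xo \<Rightarrow> 'am \<Rightarrow> 'xm \<Rightarrow> 'xc \<Rightarrow> bool" where
  "square x y f h p \<longleftrightarrow> x \<in> Ob X \<and> y \<in> Ob X \<and> f \<in> Ar A \<and> src A f = R x \<and> tgt A f = R y \<and>
     h \<in> Ar X \<and> src X h = x \<and> tgt X h = y \<and>
     iso2 X p \<and> vdom X p = pf_ar G f \<cdot> \<eta> x \<and> vcod X p = \<eta> y \<cdot> h"

lemma squareD: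
  assumes "square x y f h p"
  shows "x \<in> Ob X" "y \<in> Ob X" "f \<in> Ar A" "src A f = R x" "tgt A f = R y"
     "h \<in> Ar X" "src X h = x" "tgt X h = y"
     "iso2 X p" "vdom X p = pf_ar G f \<cdot> \<eta> x" "vcod X p = \<eta> y \<cdot> h" "p \<in> Cl X"
  using assms by (simp_all add: square_def G.D.iso2_Cl)

text \<open>
  \<open>act x g f p : G (g \<cdot> f) \<cdot> \<eta>\<^sub>x \<Rightarrow> G g \<cdot> \<eta>\<^sub>y \<cdot> h\<close> for a square \<open>p : G f \<cdot> \<eta>\<^sub>x \<Rightarrow> \<eta>\<^sub>y \<cdot> h\<close> and any \<open>g : R y \<rightarrow> a\<close>;
  composition of squares is the case \<open>a = R z\<close> followed by a whiskered square.
\<close>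

definition act :: "'xo \<Rightarrow> 'am \<Rightarrow> 'am \<Rightarrow> 'xc \<Rightarrow> 'xc" where
  "act x g f p = (pf_ar G g \<rhd> p) \<bullet> (d g f \<lhd> \<eta> x)"

lemma
  assumes "square x y f h p" "g \<in> Ar A" "src A g = R y"
  shows act_Cl: "act x g f p \<in> Cl X"
    and vdom_act: "vdom X (act x g f p) = pf_ar G (g \<cdot>\<^bsub>A\<^esub> f) \<cdot> \<eta> x"
    and vcod_act: "vcod X (act x g f p) = pf_ar G g \<cdot> \<eta> y \<cdot> h"
    and iso2_act: "iso2 X (act x g f p)"
  using squareD[OF assms(1)] assms(2,3)
  by (auto simp: act_def typing G.D.comp1_assoc intro!: G.D.iso2_vcomp G.D.iso2_lwhisker G.D.iso2_rwhisker G.iso2_pf_decomp)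

definition sqcomp :: "'xo \<Rightarrow> 'am \<Rightarrow> 'am \<Rightarrow> 'xm \<Rightarrow> 'xc \<Rightarrow> 'xc \<Rightarrow> 'xc" where
  "sqcomp x g f h q p = (q \<lhd> h) \<bullet> act x g f p"

lemma square_sqcomp:
  assumes "square x y f h p" "square y z g k q"
  shows "square x z (g \<cdot>\<^bsub>A\<^esub> f) (k \<cdot> h) (sqcomp x g f h q p)"
  using squareD[OF assms(1)] squareD[OF assms(2)] act_Cl[OF assms(1)] vdom_act[OF assms(1)] vcod_act[OF assms(1)] iso2_act[OF assms(1)]
  unfolding square_def sqcomp_def
  by (auto simp: typing G.D.comp1_assoc intro!: G.D.iso2_vcomp G.D.iso2_rwhisker)

text \<open>The inverse unit cell of \<open>G\<close> appears because the filler of a square starts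
  on the \<open>G\<close> side, here at \<open>G 1 \<cdot> \<eta> x\<close>.\<close>

definition unit_square :: "'xo \<Rightarrow> 'xc" where
  "unit_square x = pf_counit X G (R x) \<lhd> \<eta> x"

lemma square_unit:
  assumes "x \<in> Ob X"
  shows "square x x (one A (R x)) (one X x) (unit_square x)"
  using assms G.D.one_comp1[of "\<eta> x"] G.D.comp1_one[of "\<eta> x"]
  unfolding square_def unit_square_def
  by (auto simp: typing intro!: G.D.iso2_rwhisker G.iso2_pf_counit)

text \<open>The squares are arguments because a pair of 2-cells does not determine the fillers
  \<open>p\<close> and \<open>p'\<close>.\<close>

definition square_cell :: "'xo \<Rightarrow> 'xo \<Rightarrow> 'am \<Rightarrow> 'xm \<Rightarrow> 'xc \<Rightarrow> 'am \<Rightarrow> 'xm \<Rightarrow> 'xc \<Rightarrow> 'ac \<Rightarrow> 'xc \<Rightarrow> bool" where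
  "square_cell x y f h p f' h' p' \<gamma> \<sigma> \<longleftrightarrow> square x y f h p \<and> square x y f' h' p' \<and>
     \<gamma> \<in> Cl A \<and> vdom A \<gamma> = f \<and> vcod A \<gamma> = f' \<and> \<sigma> \<in> Cl X \<and> vdom X \<sigma> = h \<and> vcod X \<sigma> = h' \<and>
     p' \<bullet> (pf_cl G \<gamma> \<lhd> \<eta> x) = (\<eta> y \<rhd> \<sigma>) \<bullet> p"

lemma square_cellD:
  assumes "square_cell x y f h p f' h' p' \<gamma> \<sigma>"
  shows "square x y f h p" "square x y f' h' p'"
    "\<gamma> \<in> Cl A" "vdom A \<gamma> = f" "vcod A \<gamma> = f'" "\<sigma> \<in> Cl X" "vdom X \<sigma> = h" "vcod X \<sigma> = h'"
    "p' \<bullet> (pf_cl G \<gamma> \<lhd> \<eta> x) = (\<eta> y \<rhd> \<sigma>) \<bullet> p"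
  using assms by (simp_all add: square_cell_def)

text \<open>Naturality of the decomposition cells moves \<open>\<beta>\<close> and
  \<open>\<gamma>\<close> past \<open>d\<close>; interchange brings \<open>\<gamma>\<close> next to
  \<open>p'\<close>, where the compatibility equation replaces it by
  \<open>\<sigma>\<close>.\<close>

lemma act_natural:
  assumes "square_cell x y f h p f' h' p' \<gamma> \<sigma>" "\<beta> \<in> Cl A" "src A (vdom A \<beta>) = R y"
  shows "act x (vcod A \<beta>) f' p' \<bullet> (pf_cl G (\<beta> \<star>\<^bsub>A\<^esub> \<gamma>) \<lhd> \<eta> x)
    = (pf_cl G \<beta> \<star> (\<eta> y \<rhd> \<sigma>)) \<bullet> act x (vdom A \<beta>) f p"
proof -
  note D = square_cellD(3-8)[OF assms(1)] squareD[OF square_cellD(1)[OF assms(1)]] squareD[OF square_cellD(2)[OF assms(1)]]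
    assms(2,3)
  let ?e = "\<eta> x" and ?b = "vdom A \<beta>" and ?b' = "vcod A \<beta>"
  have n: "(pf_cl G \<beta> \<star> pf_cl G \<gamma>) \<bullet> d ?b f = d ?b' f' \<bullet> pf_cl G (\<beta> \<star>\<^bsub>A\<^esub> \<gamma>)"
    using G.pf_decomp_natural[of \<beta> \<gamma>] D by simp
  have "act x ?b' f' p' \<bullet> (pf_cl G (\<beta> \<star>\<^bsub>A\<^esub> \<gamma>) \<lhd> ?e)
      = (pf_ar G ?b' \<rhd> p') \<bullet> (d ?b' f' \<bullet> pf_cl G (\<beta> \<star>\<^bsub>A\<^esub> \<gamma>)) \<lhd> ?e"
    using D by (simp add: act_def typing G.D.vcomp_assoc G.D.comp1_assoc G.D.rwhisker_vcomp)
  also have "\<dots> = ((pf_ar G ?b' \<rhd> p') \<bullet> (pf_cl G \<beta> \<star> (pf_cl G \<gamma> \<lhd> ?e))) \<bullet> (d ?b f \<lhd> ?e)"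
    unfolding n[symmetric]
    using D by (simp add: typing G.D.vcomp_assoc G.D.comp1_assoc G.D.rwhisker_vcomp G.D.hcomp_rwhisker)
  also have "(pf_ar G ?b' \<rhd> p') \<bullet> (pf_cl G \<beta> \<star> (pf_cl G \<gamma> \<lhd> ?e)) = pf_cl G \<beta> \<star> (p' \<bullet> (pf_cl G \<gamma> \<lhd> ?e))"
    using D by (intro G.D.lwhisker_vcomp_hcomp) (simp_all add: typing)
  also have "\<dots> = (pf_cl G \<beta> \<star> (\<eta> y \<rhd> \<sigma>)) \<bullet> (pf_ar G ?b \<rhd> p)"
    unfolding square_cellD(9)[OF assms(1)]
    using D by (intro G.D.hcomp_vcomp_lwhisker[symmetric]) (simp_all add: typing)
  finally show ?thesis
    using D by (simp add: act_def typing G.D.vcomp_assoc G.D.comp1_assoc)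
qed

text \<open>The two ways of decomposing a triple composite agree by \<open>pf_decomp_assoc\<close>,
  and the decomposition of \<open>k \<cdot> g\<close> slides past \<open>p\<close>.\<close>

lemma act_act:
  assumes "square x y f h p" "g \<in> Ar A" "src A g = R y" "k \<in> Ar A" "src A k = tgt A g"
  shows "(d k g \<lhd> (\<eta> y \<cdot> h)) \<bullet> act x (k \<cdot>\<^bsub>A\<^esub> g) f p
    = (pf_ar G k \<rhd> act x g f p) \<bullet> (d k (g \<cdot>\<^bsub>A\<^esub> f) \<lhd> \<eta> x)"
proof -
  note D = squareD[OF assms(1)] assms(2-)
  have n: "(pf_ar G k \<rhd> d g f) \<bullet> d k (g \<cdot>\<^bsub>A\<^esub> f) = (d k g \<lhd> pf_ar G f) \<bullet> d (k \<cdot>\<^bsub>A\<^esub> g) f"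
    using D by (intro G.pf_decomp_assoc) simp_all
  \<comment> \<open>Both sides equal \<open>d k g \<star> p\<close>, factored in its two
    orders.\<close>
  have e: "(d k g \<lhd> (\<eta> y \<cdot> h)) \<bullet> (pf_ar G (k \<cdot>\<^bsub>A\<^esub> g) \<rhd> p)
    = ((pf_ar G k \<cdot> pf_ar G g) \<rhd> p) \<bullet> (d k g \<lhd> (pf_ar G f \<cdot> \<eta> x))"
    using D G.D.hcomp_eq_whisker[of "d k g" p] by (simp add: typing)
  have "(d k g \<lhd> (\<eta> y \<cdot> h)) \<bullet> act x (k \<cdot>\<^bsub>A\<^esub> g) f p
    = ((d k g \<lhd> (\<eta> y \<cdot> h)) \<bullet> (pf_ar G (k \<cdot>\<^bsub>A\<^esub> g) \<rhd> p)) \<bullet> (d (k \<cdot>\<^bsub>A\<^esub> g) f \<lhd> \<eta> x)"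
    using D by (simp add: act_def typing G.D.vcomp_assoc G.D.comp1_assoc)
  also have "\<dots> = ((pf_ar G k \<cdot> pf_ar G g) \<rhd> p) \<bullet> ((d k g \<lhd> pf_ar G f) \<bullet> d (k \<cdot>\<^bsub>A\<^esub> g) f) \<lhd> \<eta> x"
    unfolding e
    using D by (simp add: typing G.D.vcomp_assoc G.D.comp1_assoc G.C.comp1_assoc G.D.rwhisker_vcomp G.D.rwhisker_rwhisker)
  also have "\<dots> = (pf_ar G k \<rhd> act x g f p) \<bullet> (d k (g \<cdot>\<^bsub>A\<^esub> f) \<lhd> \<eta> x)"
    unfolding n[symmetric]
    using D by (simp add: act_def typing G.D.vcomp_assoc G.D.comp1_assoc G.C.comp1_assoc G.D.rwhisker_vcomp G.D.rwhisker_rwhisker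
      G.D.lwhisker_vcomp G.D.lwhisker_lwhisker G.D.rwhisker_lwhisker)
  finally show ?thesis .
qed

text \<open>The action law: a composite square acts as its two constituents in succession. Once the
  whiskered \<open>q\<close> is split off, the remaining term is an instance of
  \<open>act_act\<close>.\<close>

lemma act_sqcomp:
  assumes "square x y f h p" "square y z g k q" "e \<in> Ar A" "src A e = R z"
  shows "act x e (g \<cdot>\<^bsub>A\<^esub> f) (sqcomp x g f h q p) = (act y e g q \<lhd> h) \<bullet> act x (e \<cdot>\<^bsub>A\<^esub> g) f p"
proof -
  note D = squareD[OF assms(1)] squareD[OF assms(2)] assms(3-)
    act_Cl[OF assms(1)] vdom_act[OF assms(1)] vcod_act[OF assms(1)]
  have "act x e (g \<cdot>\<^bsub>A\<^esub> f) (sqcomp x g f h q p)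
    = (pf_ar G e \<rhd> q \<lhd> h) \<bullet> (pf_ar G e \<rhd> act x g f p) \<bullet> (d e (g \<cdot>\<^bsub>A\<^esub> f) \<lhd> \<eta> x)"
    using D unfolding sqcomp_def act_def[of x e]
    by (simp add: typing G.D.vcomp_assoc G.D.comp1_assoc G.D.lwhisker_vcomp)
  also have "\<dots> = (pf_ar G e \<rhd> q \<lhd> h) \<bullet> (d e g \<lhd> (\<eta> y \<cdot> h)) \<bullet> act x (e \<cdot>\<^bsub>A\<^esub> g) f p"
    using act_act[OF assms(1), of g e] D by simp
  also have "\<dots> = (act y e g q \<lhd> h) \<bullet> act x (e \<cdot>\<^bsub>A\<^esub> g) f p"
    using D unfolding act_def[of y]
    by (simp add: typing G.D.vcomp_assoc G.D.comp1_assoc G.D.rwhisker_vcomp G.D.rwhisker_rwhisker G.D.rwhisker_lwhisker)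
  finally show ?thesis .
qed

text \<open>Unfolding the outermost composition reduces associativity to the action law
  \<open>act_sqcomp\<close>. It is an equation, so squares compose strictly.\<close>

lemma sqcomp_assoc:
  assumes "square w x f h p" "square x y g k q" "square y z e l r"
  shows "sqcomp w (e \<cdot>\<^bsub>A\<^esub> g) f h (sqcomp x e g k r q) p = sqcomp w e (g \<cdot>\<^bsub>A\<^esub> f) (k \<cdot> h) r (sqcomp w g f h q p)"
proof -
  note D = squareD[OF assms(1)] squareD[OF assms(2)] squareD[OF assms(3)]
    act_Cl[OF assms(1)] vdom_act[OF assms(1)] vcod_act[OF assms(1)]
    act_Cl[OF assms(2)] vdom_act[OF assms(2)] vcod_act[OF assms(2)]
  show ?thesis
    unfolding sqcomp_def[of _ _ _ _ r]
    using D act_sqcomp[OF assms(1,2), of e]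
    by (simp add: sqcomp_def[of _ _ _ _ "_ \<bullet> _"] typing G.D.vcomp_assoc G.D.comp1_assoc G.D.rwhisker_vcomp G.D.rwhisker_rwhisker)
qed

text \<open>The right unit law of \<open>G\<close>, whiskered with \<open>\<eta> x\<close>: the
  counit in \<open>unit_square\<close> cancels the decomposition of
  \<open>g \<cdot> 1\<close>.\<close>

lemma act_unit:
  assumes "x \<in> Ob X" "g \<in> Ar A" "src A g = R x"
  shows "act x g (one A (R x)) (unit_square x) = idc X (pf_ar G g \<cdot> \<eta> x)"
proof -
  have "act x g (one A (R x)) (unit_square x) = ((pf_ar G g \<rhd> pf_counit X G (R x)) \<bullet> d g (one A (R x))) \<lhd> \<eta> x"
    using assms G.D.one_comp1[of "\<eta> x"] unfolding act_def unit_square_def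
    by (simp add: typing G.D.comp1_assoc G.D.rwhisker_vcomp G.D.rwhisker_lwhisker)
  then show ?thesis
    using assms G.pf_decomp_one_right[of g "R x"] by (simp add: typing G.D.rwhisker_idc)
qed

text \<open>The counit slides past \<open>p\<close> by interchange and then cancels the
  decomposition of \<open>1 \<cdot> f\<close> by \<open>pf_decomp_one_left\<close>.\<close>

lemma counit_act:
  assumes "square x y f h p"
  shows "(pf_counit X G (R y) \<lhd> (\<eta> y \<cdot> h)) \<bullet> act x (one A (R y)) f p = p"
proof -
  note D = squareD[OF assms(1)]
  have o: "one X (pf_ob G (R y)) \<cdot> \<eta> y \<cdot> h = \<eta> y \<cdot> h" "one A (R y) \<cdot>\<^bsub>A\<^esub> f = f"
    "one X (pf_ob G (R y)) \<cdot> pf_ar G f \<cdot> \<eta> x = pf_ar G f \<cdot> \<eta> x"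
    using D G.D.one_comp1[of "\<eta> y \<cdot> h"] G.C.one_comp1[of f] G.D.one_comp1[of "pf_ar G f \<cdot> \<eta> x"] by (simp_all add: typing)
  let ?c = "pf_counit X G (R y)"
  have e: "(?c \<lhd> (\<eta> y \<cdot> h)) \<bullet> (pf_ar G (one A (R y)) \<rhd> p) = p \<bullet> (?c \<lhd> (pf_ar G f \<cdot> \<eta> x))"
    using D G.D.hcomp_eq_whisker[of ?c p] by (simp add: typing G.D.lwhisker_one)
  have "(?c \<lhd> (\<eta> y \<cdot> h)) \<bullet> act x (one A (R y)) f p
    = ((?c \<lhd> (\<eta> y \<cdot> h)) \<bullet> (pf_ar G (one A (R y)) \<rhd> p)) \<bullet> (d (one A (R y)) f \<lhd> \<eta> x)"
    using D o by (simp add: act_def typing G.D.vcomp_assoc G.D.comp1_assoc)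
  also have "\<dots> = p \<bullet> ((?c \<lhd> pf_ar G f) \<bullet> d (one A (R y)) f) \<lhd> \<eta> x"
    unfolding e
    using D o by (simp add: typing G.D.vcomp_assoc G.D.comp1_assoc G.D.rwhisker_vcomp G.D.rwhisker_rwhisker)
  also have "\<dots> = p"
    using D G.pf_decomp_one_left[of f "R y"] G.D.vcomp_idc[of p] by (simp add: typing G.D.rwhisker_idc)
  finally show ?thesis .
qed

lemma sqcomp_unit_right:
  assumes "square x y f h p"
  shows "sqcomp x f (one A (R x)) (one X x) p (unit_square x) = p"
  using squareD[OF assms] act_unit[of x f] G.D.vcomp_idc[of p]
  by (simp add: sqcomp_def typing G.D.rwhisker_one)

lemma sqcomp_unit_left:
  assumes "square x y f h p"
  shows "sqcomp x (one A (R y)) f h (unit_square y) p = p"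
  using squareD[OF assms] counit_act[OF assms]
  by (simp add: sqcomp_def unit_square_def typing G.D.rwhisker_rwhisker)

section \<open>Cells between squares and their lifting\<close>

lemma square_cell_idc:
  assumes "square x y f h p"
  shows "square_cell x y f h p f h p (idc A f) (idc X h)"
  using squareD[OF assms] assms G.D.vcomp_idc[of p] G.D.idc_vcomp[of p]
  by (simp add: square_cell_def typing G.pf_cl_idc G.D.lwhisker_idc G.D.rwhisker_idc)

lemma square_cell_vcomp:
  assumes "square_cell x y f' h' p' f'' h'' p'' \<gamma>' \<sigma>'" "square_cell x y f h p f' h' p' \<gamma> \<sigma>"
  shows "square_cell x y f h p f'' h'' p'' (\<gamma>' \<bullet>\<^bsub>A\<^esub> \<gamma>) (\<sigma>' \<bullet> \<sigma>)"
proof -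
  note D = square_cellD(3-8)[OF assms(1)] square_cellD(3-8)[OF assms(2)] squareD[OF square_cellD(1)[OF assms(1)]]
    squareD[OF square_cellD(2)[OF assms(1)]] squareD[OF square_cellD(1)[OF assms(2)]]
  have "p'' \<bullet> (pf_cl G (\<gamma>' \<bullet>\<^bsub>A\<^esub> \<gamma>) \<lhd> \<eta> x) = (p'' \<bullet> (pf_cl G \<gamma>' \<lhd> \<eta> x)) \<bullet> (pf_cl G \<gamma> \<lhd> \<eta> x)"
    using D by (simp add: typing G.pf_cl_vcomp G.D.rwhisker_vcomp G.D.vcomp_assoc)
  also have "\<dots> = (\<eta> y \<rhd> \<sigma>') \<bullet> (p' \<bullet> (pf_cl G \<gamma> \<lhd> \<eta> x))"
    unfolding square_cellD(9)[OF assms(1)] using D by (simp add: typing G.D.vcomp_assoc)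
  also have "\<dots> = (\<eta> y \<rhd> (\<sigma>' \<bullet> \<sigma>)) \<bullet> p"
    unfolding square_cellD(9)[OF assms(2)] using D by (simp add: typing G.D.vcomp_assoc G.D.lwhisker_vcomp)
  finally show ?thesis
    using D square_cellD(2)[OF assms(1)] square_cellD(1)[OF assms(2)] by (simp add: square_cell_def typing)
qed

text \<open>\<open>act_natural\<close> exchanges \<open>\<gamma>\<close> for \<open>\<sigma>\<close>
  through the inner square; absorbing whiskerings then puts \<open>\<delta>\<close> next to
  \<open>q'\<close>, where the other compatibility equation exchanges it for
  \<open>\<tau>\<close>.\<close>

lemma square_cell_hcomp:
  assumes "square_cell y z g k q g' k' q' \<delta> \<tau>" "square_cell x y f h p f' h' p' \<gamma> \<sigma>"
  shows "square_cell x z (g \<cdot>\<^bsub>A\<^esub> f) (k \<cdot> h) (sqcomp x g f h q p)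
    (g' \<cdot>\<^bsub>A\<^esub> f') (k' \<cdot> h') (sqcomp x g' f' h' q' p') (\<delta> \<star>\<^bsub>A\<^esub> \<gamma>) (\<tau> \<star> \<sigma>)"
proof -
  note S = square_cellD(1,2)[OF assms(1)] square_cellD(1,2)[OF assms(2)]
  note D = square_cellD(3-8)[OF assms(1)] square_cellD(3-8)[OF assms(2)]
    squareD[OF S(1)] squareD[OF S(2)] squareD[OF S(3)] squareD[OF S(4)]
  note D = D act_Cl[OF S(3)] vdom_act[OF S(3)] vcod_act[OF S(3)] act_Cl[OF S(4)] vdom_act[OF S(4)] vcod_act[OF S(4)]
  have "sqcomp x g' f' h' q' p' \<bullet> (pf_cl G (\<delta> \<star>\<^bsub>A\<^esub> \<gamma>) \<lhd> \<eta> x)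
    = (q' \<lhd> h') \<bullet> (act x g' f' p' \<bullet> (pf_cl G (\<delta> \<star>\<^bsub>A\<^esub> \<gamma>) \<lhd> \<eta> x))"
    using D by (simp add: sqcomp_def typing G.D.vcomp_assoc G.D.comp1_assoc)
  also have "\<dots> = (q' \<lhd> h') \<bullet> (((pf_cl G \<delta> \<lhd> \<eta> y) \<star> \<sigma>) \<bullet> act x g f p)"
    using act_natural[OF assms(2), of \<delta>] D by (simp add: typing G.D.hcomp_lwhisker)
  also have "\<dots> = ((q' \<lhd> h') \<bullet> ((pf_cl G \<delta> \<lhd> \<eta> y) \<star> \<sigma>)) \<bullet> act x g f p"
    using D by (intro G.D.vcomp_assoc[symmetric]) (simp_all add: typing G.D.comp1_assoc)
  also have "(q' \<lhd> h') \<bullet> ((pf_cl G \<delta> \<lhd> \<eta> y) \<star> \<sigma>) = (q' \<bullet> (pf_cl G \<delta> \<lhd> \<eta> y)) \<star> \<sigma>"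
    using D by (intro G.D.rwhisker_vcomp_hcomp) (simp_all add: typing)
  also have "\<dots> = ((\<eta> z \<rhd> \<tau>) \<star> \<sigma>) \<bullet> (q \<lhd> h)"
    unfolding square_cellD(9)[OF assms(1)]
    using D by (intro G.D.hcomp_vcomp_rwhisker[symmetric]) (simp_all add: typing)
  also have "(((\<eta> z \<rhd> \<tau>) \<star> \<sigma>) \<bullet> (q \<lhd> h)) \<bullet> act x g f p = (\<eta> z \<rhd> (\<tau> \<star> \<sigma>)) \<bullet> sqcomp x g f h q p"
    using D by (simp add: sqcomp_def typing G.D.vcomp_assoc G.D.comp1_assoc G.D.lwhisker_hcomp)
  finally show ?thesis
    using D square_sqcomp[OF S(3) S(1)] square_sqcomp[OF S(4) S(2)] by (simp add: square_cell_def typing)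
qed

text \<open>Since \<open>p'\<close> is invertible, compatibility can be solved for
  \<open>pf_cl G \<gamma> \<lhd> \<eta> x\<close>; biuniversality gives exactly one
  \<open>\<gamma>\<close> with that whiskering. This is the local full faithfulness of the
  projection to \<open>X\<close>.\<close>

lemma square_cell_ex1:
  assumes "square x y f h p" "square x y f' h' p'" "\<sigma> \<in> Cl X" "vdom X \<sigma> = h" "vcod X \<sigma> = h'"
  shows "\<exists>!\<gamma>. square_cell x y f h p f' h' p' \<gamma> \<sigma>"
proof -
  note D = squareD[OF assms(1)] squareD[OF assms(2)] assms(3-)
  let ?\<tau> = "vinv X p' \<bullet> (\<eta> y \<rhd> \<sigma>) \<bullet> p"
  note V = G.D.vinv_Cl[OF D(21)] G.D.vdom_vinv[OF D(21)] G.D.vcod_vinv[OF D(21)]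
  have "square_cell x y f h p f' h' p' \<gamma> \<sigma> \<longleftrightarrow> \<gamma> \<in> Cl A \<and> vdom A \<gamma> = f \<and> vcod A \<gamma> = f' \<and> pf_cl G \<gamma> \<lhd> \<eta> x = ?\<tau>" for \<gamma>
  proof -
    have "p' \<bullet> (pf_cl G \<gamma> \<lhd> \<eta> x) = (\<eta> y \<rhd> \<sigma>) \<bullet> p \<longleftrightarrow> pf_cl G \<gamma> \<lhd> \<eta> x = ?\<tau>"
      if g: "\<gamma> \<in> Cl A" "vdom A \<gamma> = f" "vcod A \<gamma> = f'"
    proof
      assume "p' \<bullet> (pf_cl G \<gamma> \<lhd> \<eta> x) = (\<eta> y \<rhd> \<sigma>) \<bullet> p"
      moreover have "vinv X p' \<bullet> (p' \<bullet> (pf_cl G \<gamma> \<lhd> \<eta> x)) = pf_cl G \<gamma> \<lhd> \<eta> x"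
        using g D by (intro G.D.vinv_vcomp_assoc) (simp_all add: typing)
      ultimately show "pf_cl G \<gamma> \<lhd> \<eta> x = ?\<tau>" by simp
    next
      assume "pf_cl G \<gamma> \<lhd> \<eta> x = ?\<tau>"
      moreover have "p' \<bullet> ?\<tau> = (\<eta> y \<rhd> \<sigma>) \<bullet> p"
        using D by (intro G.D.vcomp_vinv_assoc) (simp_all add: typing)
      ultimately show "p' \<bullet> (pf_cl G \<gamma> \<lhd> \<eta> x) = (\<eta> y \<rhd> \<sigma>) \<bullet> p" by simp
    qed
    then show ?thesis using assms by (auto simp: square_cell_def)
  qed
  moreover have "\<exists>!\<gamma>. \<gamma> \<in> Cl A \<and> vdom A \<gamma> = f \<and> vcod A \<gamma> = f' \<and> pf_cl G \<gamma> \<lhd> \<eta> x = ?\<tau>"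
    using D V by (intro fill_ex1) (simp_all add: typing)
  ultimately show ?thesis by simp
qed

text \<open>The device behind the coherence laws of the left biadjoint: between fixed squares,
  equality in \<open>A\<close> is tested on the cell of \<open>X\<close> below.\<close>

lemma square_cell_unique:
  assumes "square_cell x y f h p f' h' p' \<gamma> \<sigma>" "square_cell x y f h p f' h' p' \<gamma>' \<sigma>"
  shows "\<gamma> = \<gamma>'"
  using square_cell_ex1[OF square_cellD(1,2,6-8)[OF assms(1)]] assms by blast

definition lift :: "'xo \<Rightarrow> 'xo \<Rightarrow> 'am \<Rightarrow> 'xm \<Rightarrow> 'xc \<Rightarrow> 'am \<Rightarrow> 'xm \<Rightarrow> 'xc \<Rightarrow> 'xc \<Rightarrow> 'ac" where
  "lift x y f h p f' h' p' \<sigma> = (THE \<gamma>. square_cell x y f h p f' h' p' \<gamma> \<sigma>)"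

lemma square_cell_lift:
  assumes "square x y f h p" "square x y f' h' p'" "\<sigma> \<in> Cl X" "vdom X \<sigma> = h" "vcod X \<sigma> = h'"
  shows "square_cell x y f h p f' h' p' (lift x y f h p f' h' p' \<sigma>) \<sigma>"
  unfolding lift_def by (rule theI'[OF square_cell_ex1[OF assms]])

text \<open>The identity of \<open>h\<close> also lifts in the reverse direction. Both composites of
  the two lifts lie over an identity, so they are identities by uniqueness.\<close>

lemma square_cell_iso2:
  assumes "square_cell x y f h p f' h p' \<gamma> (idc X h)"
  shows "iso2 A \<gamma>"
proof -
  note S = square_cellD(1,2)[OF assms] and D = square_cellD(3-8)[OF assms]
  have h: "h \<in> Ar X" using squareD[OF S(1)] by simp
  have c: "square_cell x y f' h p' f h p (lift x y f' h p' f h p (idc X h)) (idc X h)" (is "square_cell _ _ _ _ _ _ _ _ ?\<delta> _")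
    by (rule square_cell_lift) (use S h in \<open>simp_all add: typing\<close>)
  have "?\<delta> \<bullet>\<^bsub>A\<^esub> \<gamma> = idc A f"
    by (rule square_cell_unique[OF square_cell_vcomp[OF c assms, unfolded G.D.idc_idem[OF h]] square_cell_idc[OF S(1)]])
  moreover have "\<gamma> \<bullet>\<^bsub>A\<^esub> ?\<delta> = idc A f'"
    by (rule square_cell_unique[OF square_cell_vcomp[OF assms c, unfolded G.D.idc_idem[OF h]] square_cell_idc[OF S(2)]])
  ultimately show ?thesis
    by (intro G.C.iso2I[of _ ?\<delta>]) (use D square_cellD(3-8)[OF c] in simp_all)
qed

section \<open>The chosen squares and the left biadjoint\<close>

definition Far :: "'xm \<Rightarrow> 'am" where
  "Far h = fst (SOME fp. square (src X h) (tgt X h) (fst fp) h (snd fp))"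

definition Fsq :: "'xm \<Rightarrow> 'xc" where
  "Fsq h = snd (SOME fp. square (src X h) (tgt X h) (fst fp) h (snd fp))"

text \<open>\<open>Far\<close> and \<open>Fsq\<close> are projections of the same choice, so they
  belong to one square. Such a square comes from factoring \<open>\<eta> (tgt X h) \<cdot> h\<close>
  through \<open>\<eta> (src X h)\<close>.\<close>

lemma square_F:
  assumes "h \<in> Ar X"
  shows "square (src X h) (tgt X h) (Far h) h (Fsq h)"
proof -
  obtain f p where "f \<in> Ar A" "src A f = R (src X h)" "tgt A f = R (tgt X h)" "iso2 X p"
    "vdom X p = pf_ar G f \<cdot> \<eta> (src X h)" "vcod X p = \<eta> (tgt X h) \<cdot> h"
    using factorization_ex[of "src X h" "R (tgt X h)" "\<eta> (tgt X h) \<cdot> h"] assms by (auto simp: typing)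
  then have "square (src X h) (tgt X h) f h p" using assms by (simp add: square_def typing)
  then have "\<exists>fp. square (src X h) (tgt X h) (fst fp) h (snd fp)" by auto
  then show ?thesis unfolding Far_def Fsq_def by (rule someI_ex)
qed

text \<open>All 2-cells are lifts: of the given cell in \<open>pf_cl\<close>, and of identities in
  the constraints, which compare a composite or unit square with the chosen square over the same
  arrow.\<close>

definition left_adj :: "('xo, 'xm, 'xc, 'ao, 'am, 'ac) pseudo_functor_data" where
  "left_adj = \<lparr>pf_ob = R, pf_ar = Far,
     pf_cl = \<lambda>\<sigma>. lift (src X (vdom X \<sigma>)) (tgt X (vdom X \<sigma>)) (Far (vdom X \<sigma>)) (vdom X \<sigma>) (Fsq (vdom X \<sigma>))
       (Far (vcod X \<sigma>)) (vcod X \<sigma>) (Fsq (vcod X \<sigma>)) \<sigma>,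
     pf_comp = \<lambda>g f. lift (src X f) (tgt X g)
       (Far g \<cdot>\<^bsub>A\<^esub> Far f) (g \<cdot> f) (sqcomp (src X f) (Far g) (Far f) f (Fsq g) (Fsq f))
       (Far (g \<cdot> f)) (g \<cdot> f) (Fsq (g \<cdot> f)) (idc X (g \<cdot> f)),
     pf_unit = \<lambda>x. lift x x (one A (R x)) (one X x) (unit_square x)
       (Far (one X x)) (one X x) (Fsq (one X x)) (idc X (one X x))\<rparr>"

text \<open>This lemma, \<open>square_cell_F_comp\<close> and \<open>square_cell_F_unit\<close> are
  the properties through which the 2-cells of \<open>left_adj\<close> are used.\<close>

lemma square_cell_F:
  assumes "\<sigma> \<in> Cl X" "src X (vdom X \<sigma>) = x" "tgt X (vdom X \<sigma>) = y"
  shows "square_cell x y (Far (vdom X \<sigma>)) (vdom X \<sigma>) (Fsq (vdom X \<sigma>))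
       (Far (vcod X \<sigma>)) (vcod X \<sigma>) (Fsq (vcod X \<sigma>)) (pf_cl left_adj \<sigma>) \<sigma>"
  unfolding left_adj_def using assms square_F[of "vdom X \<sigma>"] square_F[of "vcod X \<sigma>"]
  by (auto simp: typing intro!: square_cell_lift)

lemma square_F_eq:
  assumes "h \<in> Ar X" "src X h = x" "tgt X h = y"
  shows "square x y (Far h) h (Fsq h)"
  using square_F[OF assms(1)] assms(2,3) by simp

lemma square_cell_F_comp:
  assumes "g \<in> Ar X" "f \<in> Ar X" "src X g = tgt X f" "src X f = x" "tgt X g = z"
  shows "square_cell x z (Far g \<cdot>\<^bsub>A\<^esub> Far f) (g \<cdot> f) (sqcomp x (Far g) (Far f) f (Fsq g) (Fsq f))
       (Far (g \<cdot> f)) (g \<cdot> f) (Fsq (g \<cdot> f)) (pf_comp left_adj g f) (idc X (g \<cdot> f))"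
  unfolding left_adj_def using assms
  by (auto simp: typing intro!: square_cell_lift square_sqcomp[of _ "tgt X f"] square_F_eq)

lemma square_cell_F_unit:
  assumes "x \<in> Ob X"
  shows "square_cell x x (one A (R x)) (one X x) (unit_square x)
       (Far (one X x)) (one X x) (Fsq (one X x)) (pf_unit left_adj x) (idc X (one X x))"
  unfolding left_adj_def using assms
  by (auto simp: typing intro!: square_cell_lift square_unit square_F_eq)

text \<open>Typing and invertibility are read off the lifts; the equations follow by uniqueness once
  both sides are assembled with \<open>square_cell_vcomp\<close> and
  \<open>square_cell_hcomp\<close>.\<close>

lemma pseudo_functor_left_adj: "pseudo_functor X A left_adj"
proof -
  have [simp]: "pf_ob left_adj = R" "pf_ar left_adj = Far" by (simp_all add: left_adj_def)
  note F = square_F[THEN squareD(3)] square_F[THEN squareD(4)] square_F[THEN squareD(5)]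
  note c = square_cell_F[OF _ refl refl] and cc = square_cell_F_comp[OF _ _ _ refl refl] and cu = square_cell_F_unit
  show ?thesis
  proof (rule pseudo_functor.intro[OF G.D.two_category_axioms G.C.two_category_axioms], unfold_locales, goal_cases)
    case (8 f)
    have "square_cell (src X f) (tgt X f) (Far f) f (Fsq f) (Far f) f (Fsq f) (pf_cl left_adj (idc X f)) (idc X f)"
      using c[of "idc X f"] 8 by (simp add: typing)
    from square_cell_unique[OF this square_cell_idc[OF square_F[OF 8]]] show ?case by simp
  next
    case (9 \<beta> \<alpha>)
    have "square_cell (src X (vdom X \<alpha>)) (tgt X (vdom X \<alpha>)) (Far (vcod X \<alpha>)) (vcod X \<alpha>) (Fsq (vcod X \<alpha>))
      (Far (vcod X \<beta>)) (vcod X \<beta>) (Fsq (vcod X \<beta>)) (pf_cl left_adj \<beta>) \<beta>"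
      using c[OF 9(1)] 9 by (simp add: typing)
    from square_cell_vcomp[OF this c[OF 9(2)]] show ?case
      using square_cell_unique c[of "\<beta> \<bullet> \<alpha>"] 9 by (simp add: typing)
  next
    \<comment> \<open>Naturality of the composition cells: both sides lie over
      \<open>\<beta> \<star> \<alpha>\<close>, padded by an identity after or before it.\<close>
    case (13 \<beta> \<alpha>)
    have *: "square_cell (src X (vdom X \<alpha>)) (tgt X (vdom X \<beta>))
      (Far (vdom X \<beta>) \<cdot>\<^bsub>A\<^esub> Far (vdom X \<alpha>)) (vdom X \<beta> \<cdot> vdom X \<alpha>)
      (sqcomp (src X (vdom X \<alpha>)) (Far (vdom X \<beta>)) (Far (vdom X \<alpha>)) (vdom X \<alpha>) (Fsq (vdom X \<beta>)) (Fsq (vdom X \<alpha>)))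
      (Far (vcod X \<beta> \<cdot> vcod X \<alpha>)) (vcod X \<beta> \<cdot> vcod X \<alpha>) (Fsq (vcod X \<beta> \<cdot> vcod X \<alpha>))
      (pf_comp left_adj (vcod X \<beta>) (vcod X \<alpha>) \<bullet>\<^bsub>A\<^esub> (pf_cl left_adj \<beta> \<star>\<^bsub>A\<^esub> pf_cl left_adj \<alpha>))
      (idc X (vcod X \<beta> \<cdot> vcod X \<alpha>) \<bullet> (\<beta> \<star> \<alpha>))"
      by (rule square_cell_vcomp[OF square_cell_F_comp square_cell_hcomp[OF square_cell_F square_cell_F]])
        (use 13 in \<open>simp_all add: typing\<close>)
    have "square_cell (src X (vdom X \<alpha>)) (tgt X (vdom X \<beta>))
      (Far (vdom X \<beta>) \<cdot>\<^bsub>A\<^esub> Far (vdom X \<alpha>)) (vdom X \<beta> \<cdot> vdom X \<alpha>)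
      (sqcomp (src X (vdom X \<alpha>)) (Far (vdom X \<beta>)) (Far (vdom X \<alpha>)) (vdom X \<alpha>) (Fsq (vdom X \<beta>)) (Fsq (vdom X \<alpha>)))
      (Far (vcod X (\<beta> \<star> \<alpha>))) (vcod X (\<beta> \<star> \<alpha>)) (Fsq (vcod X (\<beta> \<star> \<alpha>)))
      (pf_cl left_adj (\<beta> \<star> \<alpha>) \<bullet>\<^bsub>A\<^esub> pf_comp left_adj (vdom X \<beta>) (vdom X \<alpha>))
      ((\<beta> \<star> \<alpha>) \<bullet> idc X (vdom X \<beta> \<cdot> vdom X \<alpha>))"
      apply (rule square_cell_vcomp[OF _ square_cell_F_comp])
      using c[of "\<beta> \<star> \<alpha>"] 13 by (simp_all add: typing)
    moreover have "idc X (vcod X \<beta> \<cdot> vcod X \<alpha>) \<bullet> (\<beta> \<star> \<alpha>) = (\<beta> \<star> \<alpha>) \<bullet> idc X (vdom X \<beta> \<cdot> vdom X \<alpha>)"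
      using 13 G.D.vcomp_idc[of "\<beta> \<star> \<alpha>"] G.D.idc_vcomp[of "\<beta> \<star> \<alpha>"] by (simp add: typing)
    ultimately show ?case using * 13 by (auto simp: typing dest: square_cell_unique)
  next
    \<comment> \<open>Right unit law: \<open>sqcomp_unit_right\<close> turns the source square into
      the chosen square over \<open>f\<close>, whose identity cell is the other side.\<close>
    case (17 f)
    have o: "f \<cdot> one X (src X f) = f" using G.D.comp1_one 17 by simp
    have "square_cell (src X f) (tgt X f) (Far f \<cdot>\<^bsub>A\<^esub> one A (R (src X f))) (f \<cdot> one X (src X f))
      (sqcomp (src X f) (Far f) (one A (R (src X f))) (one X (src X f)) (Fsq f) (unit_square (src X f)))
      (Far (f \<cdot> one X (src X f))) (f \<cdot> one X (src X f)) (Fsq (f \<cdot> one X (src X f)))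
      (pf_comp left_adj f (one X (src X f)) \<bullet>\<^bsub>A\<^esub> (idc A (Far f) \<star>\<^bsub>A\<^esub> pf_unit left_adj (src X f)))
      (idc X (f \<cdot> one X (src X f)) \<bullet> (idc X f \<star> idc X (one X (src X f))))"
      by (rule square_cell_vcomp[OF square_cell_F_comp square_cell_hcomp[OF square_cell_idc[OF square_F] square_cell_F_unit]])
        (use 17 in \<open>simp_all add: typing\<close>)
    moreover have "Far f \<cdot>\<^bsub>A\<^esub> one A (R (src X f)) = Far f" using G.C.comp1_one[of "Far f"] 17 F by simp
    moreover have "idc X f \<star> idc X (one X (src X f)) = idc X f" using 17 o by (simp add: G.D.hcomp_idc typing)
    ultimately show ?case
      using square_cell_idc[OF square_F[OF 17]] sqcomp_unit_right[OF square_F[OF 17]] o G.D.idc_idem[OF 17]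
      by (auto dest: square_cell_unique)
  next
    case (18 f)
    have o: "one X (tgt X f) \<cdot> f = f" using G.D.one_comp1 18 by simp
    have "square_cell (src X f) (tgt X f) (one A (R (tgt X f)) \<cdot>\<^bsub>A\<^esub> Far f) (one X (tgt X f) \<cdot> f)
      (sqcomp (src X f) (one A (R (tgt X f))) (Far f) f (unit_square (tgt X f)) (Fsq f))
      (Far (one X (tgt X f) \<cdot> f)) (one X (tgt X f) \<cdot> f) (Fsq (one X (tgt X f) \<cdot> f))
      (pf_comp left_adj (one X (tgt X f)) f \<bullet>\<^bsub>A\<^esub> (pf_unit left_adj (tgt X f) \<star>\<^bsub>A\<^esub> idc A (Far f)))
      (idc X (one X (tgt X f) \<cdot> f) \<bullet> (idc X (one X (tgt X f)) \<star> idc X f))"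
      by (rule square_cell_vcomp[OF square_cell_F_comp square_cell_hcomp[OF square_cell_F_unit square_cell_idc[OF square_F]]])
        (use 18 in \<open>simp_all add: typing\<close>)
    moreover have "one A (R (tgt X f)) \<cdot>\<^bsub>A\<^esub> Far f = Far f" using G.C.one_comp1[of "Far f"] 18 F by simp
    moreover have "idc X (one X (tgt X f)) \<star> idc X f = idc X f" using 18 o by (simp add: G.D.hcomp_idc typing)
    ultimately show ?case
      using square_cell_idc[OF square_F[OF 18]] sqcomp_unit_left[OF square_F[OF 18]] o G.D.idc_idem[OF 18]
      by (auto dest: square_cell_unique)
  next
    case (19 h g f)
    note S = square_F_eq[OF 19(3) refl 19(5)[symmetric]] square_F_eq[OF 19(2) refl 19(4)[symmetric]] square_F[OF 19(1)]
    have 1: "square_cell (src X f) (tgt X h) (Far h \<cdot>\<^bsub>A\<^esub> (Far g \<cdot>\<^bsub>A\<^esub> Far f)) (h \<cdot> (g \<cdot> f))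
      (sqcomp (src X f) (Far h) (Far g \<cdot>\<^bsub>A\<^esub> Far f) (g \<cdot> f) (Fsq h) (sqcomp (src X f) (Far g) (Far f) f (Fsq g) (Fsq f)))
      (Far (h \<cdot> (g \<cdot> f))) (h \<cdot> (g \<cdot> f)) (Fsq (h \<cdot> (g \<cdot> f)))
      (pf_comp left_adj h (g \<cdot> f) \<bullet>\<^bsub>A\<^esub> (idc A (Far h) \<star>\<^bsub>A\<^esub> pf_comp left_adj g f))
      (idc X (h \<cdot> (g \<cdot> f)) \<bullet> (idc X h \<star> idc X (g \<cdot> f)))"
      by (rule square_cell_vcomp[OF square_cell_F_comp square_cell_hcomp[OF square_cell_idc[OF square_F_eq] square_cell_F_comp]])
        (use 19 in \<open>simp_all add: typing\<close>)
    have 2: "square_cell (src X f) (tgt X h) ((Far h \<cdot>\<^bsub>A\<^esub> Far g) \<cdot>\<^bsub>A\<^esub> Far f) ((h \<cdot> g) \<cdot> f)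
      (sqcomp (src X f) (Far h \<cdot>\<^bsub>A\<^esub> Far g) (Far f) f (sqcomp (tgt X f) (Far h) (Far g) g (Fsq h) (Fsq g)) (Fsq f))
      (Far ((h \<cdot> g) \<cdot> f)) ((h \<cdot> g) \<cdot> f) (Fsq ((h \<cdot> g) \<cdot> f))
      (pf_comp left_adj (h \<cdot> g) f \<bullet>\<^bsub>A\<^esub> (pf_comp left_adj h g \<star>\<^bsub>A\<^esub> idc A (Far f)))
      (idc X ((h \<cdot> g) \<cdot> f) \<bullet> (idc X (h \<cdot> g) \<star> idc X f))"
      by (rule square_cell_vcomp[OF square_cell_F_comp square_cell_hcomp[OF square_cell_F_comp square_cell_idc[OF square_F_eq]]])
        (use 19 in \<open>simp_all add: typing\<close>)
    have e: "idc X (h \<cdot> g) \<star> idc X f = idc X h \<star> idc X (g \<cdot> f)"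
      using 19 by (simp add: G.D.hcomp_idc typing G.D.comp1_assoc)
    \<comment> \<open>Strict associativity of squares gives both composite cells the same source
      square, so uniqueness applies.\<close>
    have s: "sqcomp (src X f) (Far h \<cdot>\<^bsub>A\<^esub> Far g) (Far f) f (sqcomp (tgt X f) (Far h) (Far g) g (Fsq h) (Fsq g)) (Fsq f)
      = sqcomp (src X f) (Far h) (Far g \<cdot>\<^bsub>A\<^esub> Far f) (g \<cdot> f) (Fsq h) (sqcomp (src X f) (Far g) (Far f) f (Fsq g) (Fsq f))"
      by (rule sqcomp_assoc) (use 19 in \<open>auto intro: square_F_eq\<close>)
    have a: "(Far h \<cdot>\<^bsub>A\<^esub> Far g) \<cdot>\<^bsub>A\<^esub> Far f = Far h \<cdot>\<^bsub>A\<^esub> (Far g \<cdot>\<^bsub>A\<^esub> Far f)" "(h \<cdot> g) \<cdot> f = h \<cdot> (g \<cdot> f)"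
      using 19 F by (simp_all add: typing G.C.comp1_assoc G.D.comp1_assoc)
    show ?case using square_cell_unique[OF 1 2[unfolded e s a]] a by simp
  next
    \<comment> \<open>Constraint cells lie over identities, so they are invertible.\<close>
    case (10 g f) then show ?case using square_cell_iso2[OF cc] by simp
  next
    case (14 x) then show ?case using square_cell_iso2[OF cu] by simp
  qed (use square_cellD(3-5)[OF c] square_cellD(3-5)[OF cc] square_cellD(3-5)[OF cu] in \<open>simp_all add: F R_Ob\<close>)
qed

end


section \<open>Pseudo naturality\<close>

context biuniversal_family begin

text \<open>
  \<open>theta x g f f' p : G (g \<cdot> f \<cdot> f') \<cdot> \<eta>\<^sub>x \<Rightarrow> G g \<cdot> G f \<cdot> \<eta>\<^sub>y \<cdot> h\<close> is the inverse of the coherence cell at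
  \<open>(h, g)\<close>; working with it keeps all cells \<open>G (g \<cdot> f) \<Rightarrow> G g \<cdot> G f\<close> in one direction.
\<close>

definition theta :: "'xo \<Rightarrow> 'am \<Rightarrow> 'am \<Rightarrow> 'am \<Rightarrow> 'xc \<Rightarrow> 'xc" where
  "theta x g f f' p = (pf_ar G g \<rhd> act x f f' p) \<bullet> (d g (f \<cdot>\<^bsub>A\<^esub> f') \<lhd> \<eta> x)"

lemma
  assumes "square x y f' h p" "f \<in> Ar A" "src A f = R y" "g \<in> Ar A" "src A g = tgt A f"
  shows theta_Cl: "theta x g f f' p \<in> Cl X"
    and vdom_theta: "vdom X (theta x g f f' p) = pf_ar G (g \<cdot>\<^bsub>A\<^esub> f \<cdot>\<^bsub>A\<^esub> f') \<cdot> \<eta> x"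
    and vcod_theta: "vcod X (theta x g f f' p) = pf_ar G g \<cdot> pf_ar G f \<cdot> \<eta> y \<cdot> h"
    and iso2_theta: "iso2 X (theta x g f f' p)"
  using squareD[OF assms(1)] assms(2-) act_Cl[OF assms(1-3)] vdom_act[OF assms(1-3)] vcod_act[OF assms(1-3)] iso2_act[OF assms(1-3)]
  by (auto simp: theta_def typing G.D.comp1_assoc G.C.comp1_assoc
      intro!: G.D.iso2_vcomp G.D.iso2_lwhisker G.D.iso2_rwhisker G.iso2_pf_decomp)

text \<open>Naturality of \<open>d\<close> handles \<open>\<tau>\<close>, and
  \<open>act_natural\<close> handles \<open>\<beta>\<close>, \<open>\<gamma>\<close> and
  \<open>\<sigma>\<close> inside the remaining factor.\<close>

lemma theta_natural:
  assumes "square_cell x y f h p f' h' p' \<gamma> \<sigma>" "\<beta> \<in> Cl A" "src A (vdom A \<beta>) = R y"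
    "\<tau> \<in> Cl A" "src A (vdom A \<tau>) = tgt A (vdom A \<beta>)"
  shows "theta x (vcod A \<tau>) (vcod A \<beta>) f' p' \<bullet> (pf_cl G (\<tau> \<star>\<^bsub>A\<^esub> \<beta> \<star>\<^bsub>A\<^esub> \<gamma>) \<lhd> \<eta> x)
    = (pf_cl G \<tau> \<star> pf_cl G \<beta> \<star> (\<eta> y \<rhd> \<sigma>)) \<bullet> theta x (vdom A \<tau>) (vdom A \<beta>) f p"
proof -
  note S = square_cellD(1,2)[OF assms(1)]
  note D = square_cellD(3-8)[OF assms(1)] squareD[OF S(1)] squareD[OF S(2)] assms(2-)
  have t: "vdom A \<beta> \<in> Ar A" "src A (vdom A \<beta>) = R y" "vcod A \<beta> \<in> Ar A" "src A (vcod A \<beta>) = R y"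
    using assms(2-) by (simp_all add: typing)
  note D = D act_Cl[OF S(1) t(1,2)] vdom_act[OF S(1) t(1,2)] vcod_act[OF S(1) t(1,2)]
    act_Cl[OF S(2) t(3,4)] vdom_act[OF S(2) t(3,4)] vcod_act[OF S(2) t(3,4)]
  let ?e = "\<eta> x" and ?g = "vdom A \<tau>" and ?g' = "vcod A \<tau>" and ?b = "vdom A \<beta>" and ?b' = "vcod A \<beta>"
  have n: "(pf_cl G \<tau> \<star> pf_cl G (\<beta> \<star>\<^bsub>A\<^esub> \<gamma>)) \<bullet> d ?g (?b \<cdot>\<^bsub>A\<^esub> f) = d ?g' (?b' \<cdot>\<^bsub>A\<^esub> f') \<bullet> pf_cl G (\<tau> \<star>\<^bsub>A\<^esub> \<beta> \<star>\<^bsub>A\<^esub> \<gamma>)"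
    using G.pf_decomp_natural[of \<tau> "\<beta> \<star>\<^bsub>A\<^esub> \<gamma>"] D by (simp add: typing)
  have "theta x ?g' ?b' f' p' \<bullet> (pf_cl G (\<tau> \<star>\<^bsub>A\<^esub> \<beta> \<star>\<^bsub>A\<^esub> \<gamma>) \<lhd> ?e)
      = (pf_ar G ?g' \<rhd> act x ?b' f' p') \<bullet> (d ?g' (?b' \<cdot>\<^bsub>A\<^esub> f') \<bullet> pf_cl G (\<tau> \<star>\<^bsub>A\<^esub> \<beta> \<star>\<^bsub>A\<^esub> \<gamma>)) \<lhd> ?e"
    using D by (simp add: theta_def typing G.D.vcomp_assoc G.D.comp1_assoc G.D.rwhisker_vcomp)
  also have "\<dots> = ((pf_ar G ?g' \<rhd> act x ?b' f' p') \<bullet> (pf_cl G \<tau> \<star> (pf_cl G (\<beta> \<star>\<^bsub>A\<^esub> \<gamma>) \<lhd> ?e))) \<bullet> (d ?g (?b \<cdot>\<^bsub>A\<^esub> f) \<lhd> ?e)"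
    unfolding n[symmetric]
    using D by (simp add: typing G.D.vcomp_assoc G.D.comp1_assoc G.D.rwhisker_vcomp G.D.hcomp_rwhisker)
  also have "(pf_ar G ?g' \<rhd> act x ?b' f' p') \<bullet> (pf_cl G \<tau> \<star> (pf_cl G (\<beta> \<star>\<^bsub>A\<^esub> \<gamma>) \<lhd> ?e))
      = pf_cl G \<tau> \<star> (act x ?b' f' p' \<bullet> (pf_cl G (\<beta> \<star>\<^bsub>A\<^esub> \<gamma>) \<lhd> ?e))"
    using D by (intro G.D.lwhisker_vcomp_hcomp) (simp_all add: typing)
  also have "\<dots> = (pf_cl G \<tau> \<star> (pf_cl G \<beta> \<star> (\<eta> y \<rhd> \<sigma>))) \<bullet> (pf_ar G ?g \<rhd> act x ?b f p)"
    unfolding act_natural[OF assms(1-3)]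
    using D by (intro G.D.hcomp_vcomp_lwhisker[symmetric]) (simp_all add: typing G.D.comp1_assoc)
  finally show ?thesis
    using D by (simp add: theta_def typing G.D.vcomp_assoc G.D.comp1_assoc)
qed

text \<open>The composition law of the coherence cells before inversion: splitting in two stages
  agrees with splitting along the composite square, up to the decomposition of
  \<open>g' \<cdot> g\<close>.\<close>

lemma theta_sqcomp:
  assumes "square w x b h' q" "square x y a h p" "f \<in> Ar A" "src A f = R y" "g \<in> Ar A" "src A g = tgt A f"
    "g' \<in> Ar A" "src A g' = tgt A g"
  shows "(d g' g \<lhd> (pf_ar G f \<cdot> \<eta> y \<cdot> h \<cdot> h')) \<bullet> theta w (g' \<cdot>\<^bsub>A\<^esub> g) f (a \<cdot>\<^bsub>A\<^esub> b) (sqcomp w a b h' p q)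
    = (pf_ar G g' \<rhd> theta x g f a p \<lhd> h') \<bullet> theta w g' (g \<cdot>\<^bsub>A\<^esub> f \<cdot>\<^bsub>A\<^esub> a) b q"
proof -
  note D = squareD[OF assms(1)] squareD[OF assms(2)] assms(3-) act_Cl[OF assms(1)] vdom_act[OF assms(1)] vcod_act[OF assms(1)]
    act_Cl[OF assms(2)] vdom_act[OF assms(2)] vcod_act[OF assms(2)]
  note s = typing G.D.vcomp_assoc G.D.comp1_assoc G.C.comp1_assoc G.D.rwhisker_vcomp G.D.rwhisker_rwhisker
      G.D.lwhisker_vcomp G.D.lwhisker_lwhisker G.D.rwhisker_lwhisker
  let ?u = "act x (g' \<cdot>\<^bsub>A\<^esub> g \<cdot>\<^bsub>A\<^esub> f) a p" and ?v = "act w (g' \<cdot>\<^bsub>A\<^esub> g \<cdot>\<^bsub>A\<^esub> f \<cdot>\<^bsub>A\<^esub> a) b q" and ?e = "\<eta> y \<cdot> h \<cdot> h'"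
  have n: "(pf_ar G g' \<rhd> d g f) \<bullet> d g' (g \<cdot>\<^bsub>A\<^esub> f) = (d g' g \<lhd> pf_ar G f) \<bullet> d (g' \<cdot>\<^bsub>A\<^esub> g) f"
    using D by (intro G.pf_decomp_assoc) simp_all
  \<comment> \<open>Equations \<open>t1\<close> to \<open>t4\<close> move decomposition cells across
    the squares by \<open>act_act\<close>, with \<open>act_sqcomp\<close> splitting the composite
    square. The decompositions of \<open>g'\<close>, \<open>g\<close> and \<open>f\<close> become
    adjacent, and \<open>n\<close> reassociates them.\<close>
  have t1: "theta w (g' \<cdot>\<^bsub>A\<^esub> g) f (a \<cdot>\<^bsub>A\<^esub> b) (sqcomp w a b h' p q) = (d (g' \<cdot>\<^bsub>A\<^esub> g) f \<lhd> ?e) \<bullet> (?u \<lhd> h') \<bullet> ?v"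
    unfolding theta_def
    using act_act[OF square_sqcomp[OF assms(1,2)], of f "g' \<cdot>\<^bsub>A\<^esub> g"] act_sqcomp[OF assms(1,2), of "g' \<cdot>\<^bsub>A\<^esub> g \<cdot>\<^bsub>A\<^esub> f"] D
    by (simp add: typing G.C.comp1_assoc)
  have t2: "theta x g f a p = (d g f \<lhd> (\<eta> y \<cdot> h)) \<bullet> act x (g \<cdot>\<^bsub>A\<^esub> f) a p"
    unfolding theta_def using act_act[OF assms(2), of f g] D by simp
  have t3: "theta w g' (g \<cdot>\<^bsub>A\<^esub> f \<cdot>\<^bsub>A\<^esub> a) b q = (d g' (g \<cdot>\<^bsub>A\<^esub> f \<cdot>\<^bsub>A\<^esub> a) \<lhd> (\<eta> x \<cdot> h')) \<bullet> ?v"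
    unfolding theta_def using act_act[OF assms(1), of "g \<cdot>\<^bsub>A\<^esub> f \<cdot>\<^bsub>A\<^esub> a" g'] D by (simp add: typing G.C.comp1_assoc)
  have t4: "(d g' (g \<cdot>\<^bsub>A\<^esub> f) \<lhd> (\<eta> y \<cdot> h)) \<bullet> ?u
    = (pf_ar G g' \<rhd> act x (g \<cdot>\<^bsub>A\<^esub> f) a p) \<bullet> (d g' (g \<cdot>\<^bsub>A\<^esub> f \<cdot>\<^bsub>A\<^esub> a) \<lhd> \<eta> x)"
    using act_act[OF assms(2), of "g \<cdot>\<^bsub>A\<^esub> f" g'] D by (simp add: typing G.C.comp1_assoc)
  have "(d g' g \<lhd> (pf_ar G f \<cdot> ?e)) \<bullet> (d (g' \<cdot>\<^bsub>A\<^esub> g) f \<lhd> ?e) \<bullet> (?u \<lhd> h') \<bullet> ?v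
    = (((d g' g \<lhd> pf_ar G f) \<bullet> d (g' \<cdot>\<^bsub>A\<^esub> g) f) \<lhd> ?e) \<bullet> (?u \<lhd> h') \<bullet> ?v"
    using D by (simp add: s)
  also have "\<dots> = (pf_ar G g' \<rhd> d g f \<lhd> ?e) \<bullet> (((d g' (g \<cdot>\<^bsub>A\<^esub> f) \<lhd> (\<eta> y \<cdot> h)) \<bullet> ?u) \<lhd> h') \<bullet> ?v"
    unfolding n[symmetric] using D by (simp add: s)
  also have "\<dots> = (pf_ar G g' \<rhd> theta x g f a p \<lhd> h') \<bullet> theta w g' (g \<cdot>\<^bsub>A\<^esub> f \<cdot>\<^bsub>A\<^esub> a) b q"
    unfolding t4 t2 t3 using D by (simp add: s)
  finally show ?thesis unfolding t1 .
qed

text \<open>The unit square acts as an identity, so the decomposition of \<open>1 \<cdot> f\<close>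
  remains; by the left unit law of \<open>G\<close> it is the whiskered unit cell.\<close>

lemma theta_unit:
  assumes "x \<in> Ob X" "f \<in> Ar A" "src A f = R x" "tgt A f = a"
  shows "theta x (one A a) f (one A (R x)) (unit_square x) = pf_unit G a \<lhd> (pf_ar G f \<cdot> \<eta> x)"
proof -
  have a: "a \<in> Ob A" and o: "one A a \<cdot>\<^bsub>A\<^esub> f = f" "f \<cdot>\<^bsub>A\<^esub> one A (R x) = f"
    "one X (pf_ob G a) \<cdot> pf_ar G f = pf_ar G f"
    using assms G.C.one_comp1[of f] G.C.comp1_one[of f] G.D.one_comp1[of "pf_ar G f"] by (auto simp: typing)
  have "d (one A a) f = d (one A a) f \<bullet> pf_comp G (one A a) f \<bullet> (pf_unit G a \<lhd> pf_ar G f)"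
    using G.pf_unit_left[of f] G.D.vcomp_idc[of "d (one A a) f"] assms a o by (simp add: rwhisker_def typing)
  also have "\<dots> = (d (one A a) f \<bullet> pf_comp G (one A a) f) \<bullet> (pf_unit G a \<lhd> pf_ar G f)"
    using assms a o by (intro G.D.vcomp_assoc[symmetric]) (simp_all add: typing)
  also have "\<dots> = pf_unit G a \<lhd> pf_ar G f"
    using assms a G.D.idc_vcomp[of "pf_unit G a \<lhd> pf_ar G f"] by (simp add: G.pf_decomp_pf_comp typing)
  finally have "d (one A a) f = pf_unit G a \<lhd> pf_ar G f" .
  then show ?thesis
    using assms a o act_unit[of x f] G.D.idc_vcomp[of "pf_unit G a \<lhd> (pf_ar G f \<cdot> \<eta> x)"]
    by (simp add: theta_def typing G.D.lwhisker_idc G.D.rwhisker_rwhisker)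
qed

section \<open>The equivalences and their pseudo naturality\<close>

definition left_adj_equiv :: "('xo \<times> 'ao, 'xm \<times> 'am, 'am, 'ac, 'xm, 'xc) cat_pseudo_nat_data" where
  "left_adj_equiv = \<lparr>
     cpt_ob = \<lambda>(x, a). \<lparr>on_obj = \<lambda>f. pf_ar G f \<cdot> \<eta> x, on_arr = \<lambda>\<gamma>. pf_cl G \<gamma> \<star> idc X (\<eta> x)\<rparr>,
     cpt_ar = \<lambda>(h, g) f. vinv X (theta (src X h) g f (Far h) (Fsq h))\<rparr>"

text \<open>The functor at \<open>(x, a)\<close> is literally the one in
  \<open>biuniversal_arrow\<close>, so the hypothesis applies directly.\<close>

lemma equivalence_left_adj:
  assumes "x \<in> Ob X" "a \<in> Ob A"
  shows "equivalence_of_categories (Mor A (R x) a) (Mor X x (pf_ob G a)) (cpt_ob left_adj_equiv (x, a))"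
  using biuniversal[OF assms(1)] assms(2) by (auto simp: biuniversal_arrow_def left_adj_equiv_def)

text \<open>Each law is proved first as an equation for \<open>theta\<close> and then transferred to
  the inverse, which is the coherence cell.\<close>

lemma cat_pseudo_nat_trans_left_adj:
  "cat_pseudo_nat_trans (prod2 (op2 X) A) (hom_pf A left_adj (pf_id A)) (hom_pf X (pf_id X) G) left_adj_equiv"
proof -
  interpret L: pseudo_functor X A left_adj by (rule pseudo_functor_left_adj)
  interpret P: cat_pseudo_functor "prod2 (op2 X) A" "hom_pf A left_adj (pf_id A)"
    by (rule cat_pseudo_functor_hom_pf[OF L.pseudo_functor_axioms G.C.pseudo_functor_pf_id])
  interpret Q: cat_pseudo_functor "prod2 (op2 X) A" "hom_pf X (pf_id X) G"
    by (rule cat_pseudo_functor_hom_pf[OF G.D.pseudo_functor_pf_id G.pseudo_functor_axioms])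
  have [simp]: "pf_ob left_adj = R" "pf_ar left_adj = Far" by (simp_all add: left_adj_def)
  have E: "is_functor (Mor A (R x) a) (Mor X x (pf_ob G a)) (cpt_ob left_adj_equiv (x, a))"
    if "x \<in> Ob X" "a \<in> Ob A" for x a
    using equivalence_left_adj[OF that] by (simp add: equivalence_of_categories_def)
  show ?thesis
  proof (rule cat_pseudo_nat_trans.intro[OF P.cat_pseudo_functor_axioms Q.cat_pseudo_functor_axioms],
      rule cat_pseudo_nat_trans_axioms.intro, goal_cases)
    case (1 k)
    obtain x a where k [simp]: "k = (x, a)" by (cases k)
    have "x \<in> Ob X" "a \<in> Ob A" using 1 by (auto simp: prod2_def op2_def)
    then show ?case using E by (simp add: hom_pf_def pf_id_def)
  next
    case (2 k)
    obtain h g where k [simp]: "k = (h, g)" by (cases k)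
    have hg: "h \<in> Ar X" "g \<in> Ar A" using 2 by (auto simp: prod2_def op2_def)
    note S = square_F[OF hg(1)] and D = squareD[OF square_F[OF hg(1)]]
    let ?x = "src X h" and ?y = "tgt X h" and ?a = "src A g" and ?b = "tgt A g"
    have S1: "is_functor (Mor A (R ?y) ?a) (Mor X ?x (pf_ob G ?b))
       (functor_comp (cpf_ar (hom_pf X (pf_id X) G) k) (cpt_ob left_adj_equiv (?y, ?a)))"
      using G.D.is_functor_comp[OF E[of ?y ?a]] Q.cpf_ar[OF 2] hg by (simp add: prod2_def op2_def hom_pf_def pf_id_def typing)
    have S2: "is_functor (Mor A (R ?y) ?a) (Mor X ?x (pf_ob G ?b))
       (functor_comp (cpt_ob left_adj_equiv (?x, ?b)) (cpf_ar (hom_pf A left_adj (pf_id A)) k))"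
      using G.D.is_functor_comp[OF _ E[of ?x ?b]] P.cpf_ar[OF 2] hg by (simp add: prod2_def op2_def hom_pf_def pf_id_def typing)
    have "nat_iso (Mor A (R ?y) ?a) (Mor X ?x (pf_ob G ?b))
       (functor_comp (cpf_ar (hom_pf X (pf_id X) G) k) (cpt_ob left_adj_equiv (?y, ?a)))
       (functor_comp (cpt_ob left_adj_equiv (?x, ?b)) (cpf_ar (hom_pf A left_adj (pf_id A)) k)) (cpt_ar left_adj_equiv k)"
    proof (intro nat_iso.intro nat_trans.intro nat_trans_axioms.intro nat_iso_axioms.intro S1 S2, goal_cases)
      case (4 \<beta>)
      then have b: "\<beta> \<in> Cl A" "src A (vdom A \<beta>) = R ?y" "tgt A (vdom A \<beta>) = ?a" by (auto simp: Mor_def)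
      let ?f = "vdom A \<beta>" and ?f' = "vcod A \<beta>"
      have f: "?f \<in> Ar A" "src A ?f = R ?y" "src A g = tgt A ?f" "?f' \<in> Ar A" "src A ?f' = R ?y" "src A g = tgt A ?f'"
        using b by (simp_all add: typing)
      \<comment> \<open>\<open>theta_natural\<close> with identity cells on \<open>g\<close> and on
        the chosen square leaves naturality in the remaining cell \<open>\<beta>\<close>.\<close>
      have n: "theta ?x g ?f' (Far h) (Fsq h) \<bullet> (pf_cl G (idc A g \<star>\<^bsub>A\<^esub> \<beta> \<star>\<^bsub>A\<^esub> idc A (Far h)) \<star> idc X (\<eta> ?x))
        = (idc X (pf_ar G g) \<star> (pf_cl G \<beta> \<star> idc X (\<eta> ?y)) \<star> idc X h) \<bullet> theta ?x g ?f (Far h) (Fsq h)"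
        using theta_natural[OF square_cell_idc[OF S] b(1,2), of "idc A g"] b hg D
        by (simp add: typing rwhisker_def lwhisker_def G.pf_cl_idc G.D.hcomp_assoc)
      note T = theta_Cl[OF S f(1,2) hg(2) f(3)] vdom_theta[OF S f(1,2) hg(2) f(3)] vcod_theta[OF S f(1,2) hg(2) f(3)] iso2_theta[OF S f(1,2) hg(2) f(3)]
        theta_Cl[OF S f(4,5) hg(2) f(6)] vdom_theta[OF S f(4,5) hg(2) f(6)] vcod_theta[OF S f(4,5) hg(2) f(6)] iso2_theta[OF S f(4,5) hg(2) f(6)]
      have "vinv X (theta ?x g ?f' (Far h) (Fsq h)) \<bullet> (idc X (pf_ar G g) \<star> (pf_cl G \<beta> \<star> idc X (\<eta> ?y)) \<star> idc X h)
        = (pf_cl G (idc A g \<star>\<^bsub>A\<^esub> \<beta> \<star>\<^bsub>A\<^esub> idc A (Far h)) \<star> idc X (\<eta> ?x)) \<bullet> vinv X (theta ?x g ?f (Far h) (Fsq h))"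
        by (rule G.D.vinv_conjugate[OF T(4,8) _ _ _ _ _ _ n])
          (use b hg D T in \<open>simp_all add: typing G.D.comp1_assoc\<close>)
      then show ?case by (simp add: functor_comp_def Mor_def left_adj_equiv_def hom_pf_def pf_id_def)
    next
      case (5 f)
      then have f: "f \<in> Ar A" "src A f = R ?y" "tgt A f = ?a" by (auto simp: Mor_def)
      note T = theta_Cl[OF S f(1,2) hg(2) f(3)[symmetric]] vdom_theta[OF S f(1,2) hg(2) f(3)[symmetric]]
        vcod_theta[OF S f(1,2) hg(2) f(3)[symmetric]] iso2_theta[OF S f(1,2) hg(2) f(3)[symmetric]]
      let ?t = "theta ?x g f (Far h) (Fsq h)"
      note V = T G.D.vinv_Cl[OF T(4)] G.D.vdom_vinv[OF T(4)] G.D.vcod_vinv[OF T(4)] G.D.vinv_vcomp[OF T(4)] G.D.vcomp_vinv[OF T(4)]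
      have "invertible (Mor X ?x (pf_ob G ?b)) (vinv X ?t)"
        unfolding invertible_def
        by (intro conjI bexI[of _ ?t]) (use f hg D V in \<open>simp_all add: Mor_def typing\<close>)
      then show ?case by (simp add: left_adj_equiv_def)
    next
      case (1 f)
      then have f: "f \<in> Ar A" "src A f = R ?y" "tgt A f = ?a" by (auto simp: Mor_def)
      note T = vcod_theta[OF S f(1,2) hg(2) f(3)[symmetric]] iso2_theta[OF S f(1,2) hg(2) f(3)[symmetric]]
      show ?case
        using f hg D G.D.vinv_Cl[OF T(2)] G.D.vdom_vinv[OF T(2)] T(1) by (simp add: left_adj_equiv_def Mor_def typing)
    next
      case (2 f)
      then have f: "f \<in> Ar A" "src A f = R ?y" "tgt A f = ?a" by (auto simp: Mor_def)
      note T = vcod_theta[OF S f(1,2) hg(2) f(3)[symmetric]] iso2_theta[OF S f(1,2) hg(2) f(3)[symmetric]]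
      show ?case
        using f hg D G.D.vdom_vinv[OF T(2)] T(1)
        by (simp add: left_adj_equiv_def Mor_def functor_comp_def hom_pf_def pf_id_def typing G.D.comp1_assoc)
    next
      case (3 f)
      then have f: "f \<in> Ar A" "src A f = R ?y" "tgt A f = ?a" by (auto simp: Mor_def)
      note T = vdom_theta[OF S f(1,2) hg(2) f(3)[symmetric]] iso2_theta[OF S f(1,2) hg(2) f(3)[symmetric]]
      show ?case
        using G.D.vcod_vinv[OF T(2)] T(1)
        by (simp add: left_adj_equiv_def Mor_def functor_comp_def hom_pf_def pf_id_def)
    qed
    then show ?case by (simp add: prod2_def op2_def hom_pf_def pf_id_def)
  next
    case (3 \<mu> f)
    obtain \<sigma> \<tau> where k [simp]: "\<mu> = (\<sigma>, \<tau>)" by (cases \<mu>)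
    have st: "\<sigma> \<in> Cl X" "\<tau> \<in> Cl A" using 3 by (auto simp: prod2_def op2_def)
    let ?x = "src X (vdom X \<sigma>)" and ?y = "tgt X (vdom X \<sigma>)"
    have f: "f \<in> Ar A" "src A f = R ?y" "tgt A f = src A (vdom A \<tau>)"
      using 3 by (auto simp: prod2_def op2_def hom_pf_def pf_id_def Mor_def)
    \<comment> \<open>The lift of \<open>\<sigma>\<close> links the chosen squares over its boundary
      arrows, which brings the action of \<open>left_adj\<close> on 2-cells into
      \<open>theta_natural\<close>.\<close>
    note C = square_cell_F[OF st(1) refl refl]
    note S = square_cellD(1,2)[OF C]
    have g: "vdom A \<tau> \<in> Ar A" "src A (vdom A \<tau>) = tgt A f" "vcod A \<tau> \<in> Ar A" "src A (vcod A \<tau>) = tgt A f"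
      using st f by (simp_all add: typing)
    note T = theta_Cl[OF S(1) f(1,2) g(1,2)] vdom_theta[OF S(1) f(1,2) g(1,2)] vcod_theta[OF S(1) f(1,2) g(1,2)] iso2_theta[OF S(1) f(1,2) g(1,2)]
      theta_Cl[OF S(2) f(1,2) g(3,4)] vdom_theta[OF S(2) f(1,2) g(3,4)] vcod_theta[OF S(2) f(1,2) g(3,4)] iso2_theta[OF S(2) f(1,2) g(3,4)]
    note D = squareD[OF S(1)] squareD[OF S(2)] square_cellD(3-8)[OF C]
    have hh: "idc X (pf_ar G f \<cdot> \<eta> ?y) \<star> \<sigma> = idc X (pf_ar G f) \<star> idc X (\<eta> ?y) \<star> \<sigma>"
      using G.D.hcomp_assoc[of "idc X (pf_ar G f)" "idc X (\<eta> ?y)" \<sigma>] f D by (simp add: typing G.D.hcomp_idc)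
    have n: "theta ?x (vcod A \<tau>) f (Far (vcod X \<sigma>)) (Fsq (vcod X \<sigma>)) \<bullet>
        (pf_cl G (\<tau> \<star>\<^bsub>A\<^esub> idc A f \<star>\<^bsub>A\<^esub> pf_cl left_adj \<sigma>) \<star> idc X (\<eta> ?x))
      = (pf_cl G \<tau> \<star> idc X (pf_ar G f \<cdot> \<eta> ?y) \<star> \<sigma>) \<bullet> theta ?x (vdom A \<tau>) f (Far (vdom X \<sigma>)) (Fsq (vdom X \<sigma>))"
      using theta_natural[OF C, of "idc A f" \<tau>] f st D hh
      by (simp add: typing rwhisker_def lwhisker_def G.pf_cl_idc)
    have "vinv X (theta ?x (vcod A \<tau>) f (Far (vcod X \<sigma>)) (Fsq (vcod X \<sigma>))) \<bullet> (pf_cl G \<tau> \<star> idc X (pf_ar G f \<cdot> \<eta> ?y) \<star> \<sigma>)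
      = (pf_cl G (\<tau> \<star>\<^bsub>A\<^esub> idc A f \<star>\<^bsub>A\<^esub> pf_cl left_adj \<sigma>) \<star> idc X (\<eta> ?x)) \<bullet> vinv X (theta ?x (vdom A \<tau>) f (Far (vdom X \<sigma>)) (Fsq (vdom X \<sigma>)))"
      by (rule G.D.vinv_conjugate[OF T(4,8) _ _ _ _ _ _ n]) (use f st D T in \<open>simp_all add: typing G.D.comp1_assoc\<close>)
    then show ?case using st by (simp add: prod2_def op2_def hom_pf_def pf_id_def left_adj_equiv_def Mor_def typing)
  next
    case (4 k f)
    obtain x a where k [simp]: "k = (x, a)" by (cases k)
    have xa: "x \<in> Ob X" "a \<in> Ob A" using 4 by (auto simp: prod2_def op2_def)
    have f: "f \<in> Ar A" "src A f = R x" "tgt A f = a" using 4 by (auto simp: hom_pf_def pf_id_def Mor_def)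
    \<comment> \<open>The unit cell of \<open>left_adj\<close> runs from the unit square to the
      chosen square over \<open>one X x\<close>; naturality of \<open>theta\<close> along it reduces
      the law to \<open>theta_unit\<close>.\<close>
    note C = square_cell_F_unit[OF xa(1)]
    note S = square_cellD(1,2)[OF C]
    note D = squareD[OF S(1)] squareD[OF S(2)] square_cellD(3-8)[OF C]
    have o: "one A a \<in> Ar A" "src A (one A a) = tgt A f" "one A a \<cdot>\<^bsub>A\<^esub> f = f" "f \<cdot>\<^bsub>A\<^esub> one A (R x) = f"
      "\<eta> x \<cdot> one X x = \<eta> x"
      using xa f G.C.one_comp1[of f] G.C.comp1_one[of f] G.D.comp1_one[of "\<eta> x"] by (simp_all add: typing)
    note T = theta_Cl[OF S(2) f(1,2) o(1,2)] vdom_theta[OF S(2) f(1,2) o(1,2)] vcod_theta[OF S(2) f(1,2) o(1,2)] iso2_theta[OF S(2) f(1,2) o(1,2)]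
    let ?t = "theta x (one A a) f (Far (one X x)) (Fsq (one X x))"
    let ?Z = "pf_cl G (idc A (one A a) \<star>\<^bsub>A\<^esub> idc A f \<star>\<^bsub>A\<^esub> pf_unit left_adj x) \<star> idc X (\<eta> x)"
    have "?t \<bullet> ?Z = theta x (one A a) f (one A (R x)) (unit_square x)"
      using theta_natural[OF C, of "idc A f" "idc A (one A a)"] f xa D o vdom_theta[OF S(1) f(1,2) o(1,2)] vcod_theta[OF S(1) f(1,2) o(1,2)]
        theta_Cl[OF S(1) f(1,2) o(1,2)] G.D.idc_vcomp[of "theta x (one A a) f (one A (R x)) (unit_square x)"]
      by (simp add: typing rwhisker_def lwhisker_def G.pf_cl_idc G.D.hcomp_idc)
    also have "\<dots> = pf_unit G a \<star> idc X (pf_ar G f \<cdot> \<eta> x) \<star> idc X (one X x)"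
      using theta_unit[OF xa(1) f] xa f o by (simp add: rwhisker_def G.D.hcomp_idc typing G.D.comp1_assoc)
    finally have "vinv X ?t \<bullet> (pf_unit G a \<star> idc X (pf_ar G f \<cdot> \<eta> x) \<star> idc X (one X x)) = vinv X ?t \<bullet> ?t \<bullet> ?Z" by simp
    also have "\<dots> = ?Z"
      by (rule G.D.vinv_vcomp_assoc[OF T(4)]) (use f xa D T in \<open>simp_all add: typing\<close>)
    finally show ?case using xa by (simp add: prod2_def op2_def hom_pf_def pf_id_def left_adj_equiv_def Mor_def typing)
  next
    case (5 k' k f)
    obtain h g where k [simp]: "k = (h, g)" by (cases k)
    obtain h' g' where k' [simp]: "k' = (h', g')" by (cases k')
    have hg: "h \<in> Ar X" "g \<in> Ar A" "h' \<in> Ar X" "g' \<in> Ar A" "src A g' = tgt A g" "tgt X h' = src X h"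
      using 5 by (auto simp: prod2_def op2_def)
    let ?w = "src X h'" and ?x = "src X h" and ?y = "tgt X h"
    have f: "f \<in> Ar A" "src A f = R ?y" "src A g = tgt A f" using 5 by (auto simp: prod2_def op2_def hom_pf_def pf_id_def Mor_def)
    note S1 = square_F[OF hg(1)] and S2 = square_F_eq[OF hg(3) refl hg(6)]
    \<comment> \<open>Composing \<open>(h', g')\<close> after \<open>(h, g)\<close> gives
      \<open>h \<cdot> h'\<close> in \<open>X\<close>; the composition cell of
      \<open>left_adj\<close> links the composite of the chosen squares to the chosen square over
      it.\<close>
    note C = square_cell_F_comp[OF hg(1,3) hg(6)[symmetric] refl refl]
    note S3 = square_cellD(1,2)[OF C]
    have gg: "g' \<cdot>\<^bsub>A\<^esub> g \<in> Ar A" "src A (g' \<cdot>\<^bsub>A\<^esub> g) = tgt A f" using f hg by (simp_all add: typing)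
    have gf: "g \<cdot>\<^bsub>A\<^esub> f \<cdot>\<^bsub>A\<^esub> Far h \<in> Ar A" "src A (g \<cdot>\<^bsub>A\<^esub> f \<cdot>\<^bsub>A\<^esub> Far h) = R ?x" "src A g' = tgt A (g \<cdot>\<^bsub>A\<^esub> f \<cdot>\<^bsub>A\<^esub> Far h)"
      using f hg squareD[OF S1] by (simp_all add: typing)
    let ?t12 = "theta ?w (g' \<cdot>\<^bsub>A\<^esub> g) f (Far (h \<cdot> h')) (Fsq (h \<cdot> h'))" and ?t1 = "theta ?x g f (Far h) (Fsq h)"
      and ?t' = "theta ?w g' (g \<cdot>\<^bsub>A\<^esub> f \<cdot>\<^bsub>A\<^esub> Far h) (Far h') (Fsq h')"
      and ?T = "theta ?w (g' \<cdot>\<^bsub>A\<^esub> g) f (Far h \<cdot>\<^bsub>A\<^esub> Far h') (sqcomp ?w (Far h) (Far h') h' (Fsq h) (Fsq h'))"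
    note T12 = theta_Cl[OF S3(2) f(1,2) gg] vdom_theta[OF S3(2) f(1,2) gg] vcod_theta[OF S3(2) f(1,2) gg] iso2_theta[OF S3(2) f(1,2) gg]
    note TT = theta_Cl[OF S3(1) f(1,2) gg] vdom_theta[OF S3(1) f(1,2) gg] vcod_theta[OF S3(1) f(1,2) gg]
    note T1 = theta_Cl[OF S1 f(1,2) hg(2) f(3)] vdom_theta[OF S1 f(1,2) hg(2) f(3)] vcod_theta[OF S1 f(1,2) hg(2) f(3)] iso2_theta[OF S1 f(1,2) hg(2) f(3)]
    note T' = theta_Cl[OF S2 gf(1,2) hg(4) gf(3)] vdom_theta[OF S2 gf(1,2) hg(4) gf(3)] vcod_theta[OF S2 gf(1,2) hg(4) gf(3)] iso2_theta[OF S2 gf(1,2) hg(4) gf(3)]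
    note D = f hg squareD[OF S1] squareD[OF S2] squareD[OF S3(1)] squareD[OF S3(2)] square_cellD(3-8)[OF C]
    let ?Z = "pf_cl G (idc A (g' \<cdot>\<^bsub>A\<^esub> g) \<star>\<^bsub>A\<^esub> idc A f \<star>\<^bsub>A\<^esub> pf_comp left_adj h h') \<lhd> \<eta> ?w"
    let ?e = "pf_ar G f \<cdot> \<eta> ?y \<cdot> h \<cdot> h'"
    \<comment> \<open>\<open>?W\<close> pastes the \<open>theta\<close> cells of the two separate
      steps; its inverse, with the factors reversed, supplies the two coherence cells on the right
      of the law.\<close>
    let ?W = "(pf_ar G g' \<rhd> ?t1 \<lhd> h') \<bullet> ?t'"
    have W: "iso2 X ?W" "?W \<in> Cl X" "vdom X ?W = pf_ar G (g' \<cdot>\<^bsub>A\<^esub> g \<cdot>\<^bsub>A\<^esub> f \<cdot>\<^bsub>A\<^esub> Far h \<cdot>\<^bsub>A\<^esub> Far h') \<cdot> \<eta> ?w"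
      "vcod X ?W = pf_ar G g' \<cdot> pf_ar G g \<cdot> ?e"
      using T1 T' D by (auto simp: typing G.D.comp1_assoc G.C.comp1_assoc intro!: G.D.iso2_vcomp G.D.iso2_lwhisker G.D.iso2_rwhisker)
    have tz: "?t12 \<bullet> ?Z = ?T"
      using theta_natural[OF C, of "idc A f" "idc A (g' \<cdot>\<^bsub>A\<^esub> g)"] D TT G.D.idc_vcomp[of ?T]
      by (simp add: typing rwhisker_def lwhisker_def G.pf_cl_idc G.D.hcomp_idc)
    \<comment> \<open>Composing with \<open>pf_comp G g' g\<close> cancels the decomposition that
      \<open>theta_sqcomp\<close> introduces, leaving \<open>theta\<close> of the composite
      square.\<close>
    have "(pf_comp G g' g \<lhd> ?e) \<bullet> ?W = (pf_comp G g' g \<lhd> ?e) \<bullet> (d g' g \<lhd> ?e) \<bullet> ?T"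
      using theta_sqcomp[OF S2 S1 f(1,2) hg(2) f(3) hg(4,5)] hg by simp
    also have "\<dots> = ((pf_comp G g' g \<bullet> d g' g) \<lhd> ?e) \<bullet> ?T"
      using D TT by (simp add: typing G.D.vcomp_assoc G.D.rwhisker_vcomp G.D.comp1_assoc)
    also have "\<dots> = ?T"
      using D TT G.D.idc_vcomp[of ?T] by (simp add: G.pf_comp_pf_decomp typing G.D.rwhisker_idc)
    finally have n: "?t12 \<bullet> ?Z = (pf_comp G g' g \<lhd> ?e) \<bullet> ?W" using tz by simp
    have "vinv X ?t12 \<bullet> (pf_comp G g' g \<lhd> ?e) = ?Z \<bullet> vinv X ?W"
      by (rule G.D.vinv_conjugate[OF W(1) T12(4) _ _ _ _ _ _ n])
        (use D T12 W in \<open>simp_all add: typing G.D.comp1_assoc G.C.comp1_assoc\<close>)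
    also have "vinv X ?W = vinv X ?t' \<bullet> (pf_ar G g' \<rhd> vinv X ?t1 \<lhd> h')"
      using T1 T' D by (simp add: G.D.vinv_vcomp_distrib G.D.vinv_lwhisker G.D.vinv_rwhisker G.D.iso2_lwhisker G.D.iso2_rwhisker
          typing G.D.comp1_assoc)
    finally show ?case
      using D by (simp add: prod2_def op2_def hom_pf_def pf_id_def left_adj_equiv_def Mor_def typing
          rwhisker_def lwhisker_def G.D.hcomp_idc G.D.comp1_assoc)
  qed
qed

lemma left_biadjoint_left_adj: "left_biadjoint X A left_adj G"
  unfolding left_biadjoint_def biadjunction_def
  using pseudo_functor_left_adj G.pseudo_functor_axioms cat_pseudo_nat_trans_left_adj equivalence_left_adj
  by (intro exI[of _ left_adj_equiv]) (simp add: left_adj_def)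

end


section \<open>Biuniversal arrows from a biadjunction\<close>

lemma biadjunction_biuniversal_arrow:
  assumes "biadjunction X A F G \<phi>" "x \<in> Ob X"
  shows "biuniversal_arrow A X G x (pf_ob F x) (on_obj (cpt_ob \<phi> (x, pf_ob F x)) (one A (pf_ob F x)))"
proof -
  let ?R = "pf_ob F x"
  define u where "u = on_obj (cpt_ob \<phi> (x, ?R)) (one A ?R)"
  have "pseudo_functor X A F" "pseudo_functor A X G"
    "cat_pseudo_nat_trans (prod2 (op2 X) A) (hom_pf A F (pf_id A)) (hom_pf X (pf_id X) G) \<phi>"
    and E: "\<And>x a. \<lbrakk>x \<in> Ob X; a \<in> Ob A\<rbrakk> \<Longrightarrow> equivalence_of_categories
        (Mor A (pf_ob F x) a) (Mor X x (pf_ob G a)) (cpt_ob \<phi> (x, a))"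
    using assms(1) by (auto simp: biadjunction_def)
  then interpret F: pseudo_functor X A F + G: pseudo_functor A X G +
    N: cat_pseudo_nat_trans "prod2 (op2 X) A" "hom_pf A F (pf_id A)" "hom_pf X (pf_id X) G" \<phi> by auto
  note typing = F.pf_typing G.pf_typing F.D.cell_typing F.C.cell_typing
  have R: "?R \<in> Ob A" using assms(2) by (rule F.pf_ob)
  have E': "is_functor (Mor A (pf_ob F x) a) (Mor X x (pf_ob G a)) (cpt_ob \<phi> (x, a))" if "a \<in> Ob A" for a
    using E[OF assms(2) that] by (simp add: equivalence_of_categories_def)
  have "u \<in> Obj (Mor X x (pf_ob G ?R))"
    unfolding u_def using is_functor.on_obj_Obj[OF E'[OF R], of "one A ?R"] R by (simp add: Mor_def typing)
  then have u: "u \<in> Ar X" "src X u = x" "tgt X u = pf_ob G ?R" by (simp_all add: Mor_def)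
  have u1: "u \<cdot>\<^bsub>X\<^esub> one X x = u" using F.C.comp1_one[OF u(1)] u by simp
  \<comment> \<open>\<open>F\<close> preserves \<open>one X x\<close> up to the unit cell, so
    \<open>pf_ar F (one X x)\<close> remains in the coherence cells and is removed by
    \<open>pf_counit\<close>.\<close>
  have F1: "pf_ar F (one X x) \<in> Ar A" "src A (pf_ar F (one X x)) = ?R" "tgt A (pf_ar F (one X x)) = ?R"
    using assms(2) by (simp_all add: typing)
  have o1: "one A ?R \<cdot>\<^bsub>A\<^esub> pf_ar F (one X x) = pf_ar F (one X x)"
    using F.D.one_comp1[OF F1(1)] F1 by simp
  have equiv: "equivalence_of_categories (Mor A ?R a) (Mor X x (pf_ob G a))
        \<lparr>on_obj = \<lambda>f'. pf_ar G f' \<cdot>\<^bsub>X\<^esub> u, on_arr = \<lambda>\<gamma>. pf_cl G \<gamma> \<star>\<^bsub>X\<^esub> idc X u\<rparr>" (is "equivalence_of_categories ?C ?D ?U")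
    if a: "a \<in> Ob A" for a
  \<comment> \<open>Equivalences are stable under natural isomorphism, so it remains to compare
    \<open>?U\<close> with the equivalence of the biadjunction.\<close>
  proof (rule equivalence_of_categories_nat_iso[OF E[OF assms(2) a]])
    interpret \<phi>: is_functor ?C ?D "cpt_ob \<phi> (x, a)" by (rule E'[OF a])
    have C: "f \<in> Obj ?C \<longleftrightarrow> f \<in> Ar A \<and> src A f = ?R \<and> tgt A f = a"
      "\<gamma> \<in> Arr ?C \<longleftrightarrow> \<gamma> \<in> Cl A \<and> src A (vdom A \<gamma>) = ?R \<and> tgt A (vdom A \<gamma>) = a"
      "Dom ?C = vdom A" "Cod ?C = vcod A" "Cmp ?C = vcomp A" "Ide ?C = idc A" for f \<gamma>
      by (simp_all add: Mor_def)
    have D: "f \<in> Obj ?D \<longleftrightarrow> f \<in> Ar X \<and> src X f = x \<and> tgt X f = pf_ob G a"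
      "\<gamma> \<in> Arr ?D \<longleftrightarrow> \<gamma> \<in> Cl X \<and> src X (vdom X \<gamma>) = x \<and> tgt X (vdom X \<gamma>) = pf_ob G a"
      "Dom ?D = vdom X" "Cod ?D = vcod X" "Cmp ?D = vcomp X" "Ide ?D = idc X" for f \<gamma>
      by (simp_all add: Mor_def)
    \<comment> \<open>\<open>?i\<close> removes \<open>pf_ar F (one X x)\<close> from the right of
      \<open>f\<close>; \<open>?c\<close> is the coherence cell at \<open>(one X x, f)\<close>,
      evaluated at the identity of \<open>?R\<close>.\<close>
    let ?i = "\<lambda>f. f \<rhd>\<^bsub>A\<^esub> pf_counit A F x"
    let ?c = "\<lambda>f. cpt_ar \<phi> (one X x, f) (one A ?R)"
    have f1: "f \<cdot>\<^bsub>A\<^esub> one A ?R = f" if "f \<in> Obj ?C" for f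
      using that F.D.comp1_one[of f] by (simp add: C)
    have i: "?i f \<in> Arr ?C" "vdom A (?i f) = f \<cdot>\<^bsub>A\<^esub> pf_ar F (one X x)" "vcod A (?i f) = f" "invertible ?C (?i f)"
      if "f \<in> Obj ?C" for f
    proof -
      show 1: "?i f \<in> Arr ?C" "vdom A (?i f) = f \<cdot>\<^bsub>A\<^esub> pf_ar F (one X x)" "vcod A (?i f) = f"
        using that assms(2) f1[OF that] by (simp_all add: C typing)
      have "iso2 A (?i f)"
        using that assms(2) F.iso2_pf_counit[of x] by (intro F.D.iso2_lwhisker) (simp_all add: C typing)
      then show "invertible ?C (?i f)"
        using 1 F.D.src_vcod F.D.tgt_vcod unfolding F.D.iso2_iff by (fastforce simp: invertible_def Mor_def)
    qed
    have c: "?c f \<in> Arr ?D" "vdom X (?c f) = pf_ar G f \<cdot>\<^bsub>X\<^esub> u"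
       "vcod X (?c f) = on_obj (cpt_ob \<phi> (x, a)) (f \<cdot>\<^bsub>A\<^esub> pf_ar F (one X x))" "invertible ?D (?c f)"
      if "f \<in> Obj ?C" for f
    proof -
      have "(one X x, f) \<in> Ar (prod2 (op2 X) A)" using that assms(2) by (simp add: prod2_def op2_def C typing)
      from N.cpt_ar[OF this]
      interpret c: nat_iso "Mor A ?R ?R" ?D "functor_comp (cpf_ar (hom_pf X (pf_id X) G) (one X x, f)) (cpt_ob \<phi> (x, ?R))"
        "functor_comp (cpt_ob \<phi> (x, a)) (cpf_ar (hom_pf A F (pf_id A)) (one X x, f))" "cpt_ar \<phi> (one X x, f)"
        using that assms(2) by (simp add: prod2_def op2_def hom_pf_def pf_id_def C typing)
      have o: "one A ?R \<in> Obj (Mor A ?R ?R)" using R by (simp add: Mor_def typing)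
      show "?c f \<in> Arr ?D" "invertible ?D (?c f)" using c.component_Arr[OF o] c.component_invertible[OF o] by auto
      show "vdom X (?c f) = pf_ar G f \<cdot>\<^bsub>X\<^esub> u"
        using c.Dom_component[OF o] u1 by (simp add: D functor_comp_def hom_pf_def pf_id_def u_def[symmetric])
      show "vcod X (?c f) = on_obj (cpt_ob \<phi> (x, a)) (f \<cdot>\<^bsub>A\<^esub> pf_ar F (one X x))"
        using c.Cod_component[OF o] o1 by (simp add: D functor_comp_def hom_pf_def pf_id_def)
    qed
    \<comment> \<open>Pseudo naturality along the 2-cell \<open>(idc X (one X x), \<gamma>)\<close>,
      evaluated at the identity of \<open>?R\<close>, is naturality of \<open>?c\<close>.\<close>
    have nat: "?c (vcod A \<gamma>) \<bullet>\<^bsub>X\<^esub> (pf_cl G \<gamma> \<star>\<^bsub>X\<^esub> idc X u)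
      = on_arr (cpt_ob \<phi> (x, a)) (\<gamma> \<lhd>\<^bsub>A\<^esub> pf_ar F (one X x)) \<bullet>\<^bsub>X\<^esub> ?c (vdom A \<gamma>)" if "\<gamma> \<in> Arr ?C" for \<gamma>
    proof -
      have "(idc X (one X x), \<gamma>) \<in> Cl (prod2 (op2 X) A)" using that assms(2) by (simp add: prod2_def op2_def C typing)
      from N.cpt_cl[OF this, of "one A ?R"]
      show ?thesis
        using that assms(2) R u u1 o1
        by (simp add: prod2_def op2_def hom_pf_def pf_id_def C D typing u_def[symmetric] F.C.hcomp_idc F.pf_cl_idc
          F.D.hcomp_idc rwhisker_def)
          (simp add: Mor_def typing)
    qed
    \<comment> \<open>The comparison goes from \<open>G f \<cdot> u\<close> by \<open>?c\<close> to
      the value of the equivalence at \<open>f \<cdot> F 1\<close>, then by the image of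
      \<open>?i\<close> to its value at \<open>f\<close>.\<close>
    let ?t = "\<lambda>f. on_arr (cpt_ob \<phi> (x, a)) (?i f) \<bullet>\<^bsub>X\<^esub> ?c f"
    have U': "is_functor ?C ?D ?U"
      by (intro is_functor.intro is_functor_axioms.intro \<phi>.C.category_axioms \<phi>.D.category_axioms)
        (use u in \<open>auto simp: C D typing G.pf_cl_idc F.C.hcomp_idc G.pf_cl_vcomp F.C.interchange[symmetric] F.C.idc_idem\<close>)
    show "nat_iso ?C ?D ?U (cpt_ob \<phi> (x, a)) ?t"
    proof (intro nat_iso.intro nat_trans.intro nat_trans_axioms.intro nat_iso_axioms.intro U' \<phi>.is_functor_axioms, goal_cases)
      case (1 f)
      then show ?case using i c \<phi>.D.Cmp_Arr[of "on_arr (cpt_ob \<phi> (x, a)) (?i f)" "?c f"]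
        \<phi>.on_arr_Arr[of "?i f"] \<phi>.Dom_on_arr[of "?i f"] by (simp add: C D)
    next
      case (2 f)
      then show ?case using i c \<phi>.D.Dom_Cmp[of "on_arr (cpt_ob \<phi> (x, a)) (?i f)" "?c f"]
        \<phi>.on_arr_Arr[of "?i f"] \<phi>.Dom_on_arr[of "?i f"] by (simp add: C D)
    next
      case (3 f)
      then show ?case using i c \<phi>.D.Cod_Cmp[of "on_arr (cpt_ob \<phi> (x, a)) (?i f)" "?c f"]
        \<phi>.on_arr_Arr[of "?i f"] \<phi>.Dom_on_arr[of "?i f"] \<phi>.Cod_on_arr[of "?i f"] by (simp add: C D)
    next
      case (5 f)
      have "invertible ?D (on_arr (cpt_ob \<phi> (x, a)) (?i f) \<odot>\<^bsub>?D\<^esub> ?c f)"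
        by (rule \<phi>.D.invertible_Cmp[OF \<phi>.invertible_on_arr[OF i(4)[OF 5]] c(4)[OF 5]])
          (use i[OF 5] c[OF 5] \<phi>.Dom_on_arr[of "?i f"] in \<open>simp add: C D\<close>)
      then show ?case by (simp add: D)
    next
      case (4 \<gamma>)
      let ?f = "vdom A \<gamma>" and ?f' = "vcod A \<gamma>" and ?p = "on_arr (cpt_ob \<phi> (x, a))"
      have f: "?f \<in> Obj ?C" "?f' \<in> Obj ?C" and g: "\<gamma> \<in> Cl A" "src A (vdom A \<gamma>) = ?R" "tgt A (vdom A \<gamma>) = a"
        using 4 by (simp_all add: C typing)
      \<comment> \<open>The two factorizations of
        \<open>\<gamma> \<star> pf_counit A F x\<close>.\<close>
      have e: "?i ?f' \<bullet>\<^bsub>A\<^esub> (\<gamma> \<lhd>\<^bsub>A\<^esub> pf_ar F (one X x)) = \<gamma> \<bullet>\<^bsub>A\<^esub> ?i ?f"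
        using F.D.hcomp_eq_whisker[of \<gamma> "pf_counit A F x"] g assms(2) R by (simp add: typing F.D.rwhisker_one)
      have w: "\<gamma> \<lhd>\<^bsub>A\<^esub> pf_ar F (one X x) \<in> Arr ?C" "vdom A (\<gamma> \<lhd>\<^bsub>A\<^esub> pf_ar F (one X x)) = ?f \<cdot>\<^bsub>A\<^esub> pf_ar F (one X x)"
        "vcod A (\<gamma> \<lhd>\<^bsub>A\<^esub> pf_ar F (one X x)) = ?f' \<cdot>\<^bsub>A\<^esub> pf_ar F (one X x)"
        using g F1 by (simp_all add: C typing)
      have U: "pf_cl G \<gamma> \<star>\<^bsub>X\<^esub> idc X u \<in> Arr ?D" "vcod X (pf_cl G \<gamma> \<star>\<^bsub>X\<^esub> idc X u) = pf_ar G ?f' \<cdot>\<^bsub>X\<^esub> u"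
        using g u by (simp_all add: D typing)
      note p = \<phi>.on_arr_Arr \<phi>.Dom_on_arr[unfolded C(3-6) D(3-6)] \<phi>.Cod_on_arr[unfolded C(3-6) D(3-6)] i(1-3)[OF f(1)] i(1-3)[OF f(2)] c(1-3)[OF f(1)] c(1-3)[OF f(2)] w 4 U
      have "?t ?f' \<bullet>\<^bsub>X\<^esub> (pf_cl G \<gamma> \<star>\<^bsub>X\<^esub> idc X u) = ?p (?i ?f') \<bullet>\<^bsub>X\<^esub> (?c ?f' \<bullet>\<^bsub>X\<^esub> (pf_cl G \<gamma> \<star>\<^bsub>X\<^esub> idc X u))"
        by (rule \<phi>.D.Cmp_assoc[unfolded C(3-6) D(3-6)]) (use p in \<open>simp_all add: C(3-6) D(3-6)\<close>)
      also have "\<dots> = ?p (?i ?f') \<bullet>\<^bsub>X\<^esub> (?p (\<gamma> \<lhd>\<^bsub>A\<^esub> pf_ar F (one X x)) \<bullet>\<^bsub>X\<^esub> ?c ?f)"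
        unfolding nat[OF 4] ..
      also have "\<dots> = (?p (?i ?f') \<bullet>\<^bsub>X\<^esub> ?p (\<gamma> \<lhd>\<^bsub>A\<^esub> pf_ar F (one X x))) \<bullet>\<^bsub>X\<^esub> ?c ?f"
        by (rule \<phi>.D.Cmp_assoc[unfolded C(3-6) D(3-6), symmetric]) (use p in \<open>simp_all add: C(3-6) D(3-6)\<close>)
      also have "?p (?i ?f') \<bullet>\<^bsub>X\<^esub> ?p (\<gamma> \<lhd>\<^bsub>A\<^esub> pf_ar F (one X x)) = ?p (?i ?f' \<bullet>\<^bsub>A\<^esub> (\<gamma> \<lhd>\<^bsub>A\<^esub> pf_ar F (one X x)))"
        by (rule \<phi>.on_arr_Cmp[unfolded C(3-6) D(3-6), symmetric]) (use p in \<open>simp_all add: C(3-6) D(3-6)\<close>)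
      also have "\<dots> = ?p \<gamma> \<bullet>\<^bsub>X\<^esub> ?p (?i ?f)"
        unfolding e by (rule \<phi>.on_arr_Cmp[unfolded C(3-6) D(3-6)]) (use p in \<open>simp_all add: C(3-6) D(3-6)\<close>)
      also have "(?p \<gamma> \<bullet>\<^bsub>X\<^esub> ?p (?i ?f)) \<bullet>\<^bsub>X\<^esub> ?c ?f = ?p \<gamma> \<bullet>\<^bsub>X\<^esub> ?t ?f"
        by (rule \<phi>.D.Cmp_assoc[unfolded C(3-6) D(3-6)]) (use p in \<open>simp_all add: C(3-6) D(3-6)\<close>)
      finally show ?case by (simp add: C(3-6) D(3-6))
    qed
  qed
  show ?thesis
    unfolding biuniversal_arrow_def u_def[symmetric] using assms(2) R u equiv by (simp add: Mor_def)
qed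

theorem theorem9p17:
  fixes X :: "('xo, 'xm, 'xc) two_cat_data"
    and A :: "('ao, 'am, 'ac) two_cat_data"
    and G :: "('ao, 'am, 'ac, 'xo, 'xm, 'xc) pseudo_functor_data"
  assumes "two_category X"
    and "two_category A"
    and "pseudo_functor A X G"
  shows "(\<exists>F. left_biadjoint X A F G) \<longleftrightarrow>
    (\<forall>x \<in> Ob X. \<exists>R \<in> Ob A. \<exists>\<eta>. biuniversal_arrow A X G x R \<eta>)"
proof
  assume "\<exists>F. left_biadjoint X A F G"
  then obtain F \<phi> where B: "biadjunction X A F G \<phi>" by (auto simp: left_biadjoint_def)
  show "\<forall>x \<in> Ob X. \<exists>R \<in> Ob A. \<exists>\<eta>. biuniversal_arrow A X G x R \<eta>"
  proof
    fix x assume "x \<in> Ob X"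
    from biadjunction_biuniversal_arrow[OF B this]
    show "\<exists>R \<in> Ob A. \<exists>\<eta>. biuniversal_arrow A X G x R \<eta>" by (auto simp: biuniversal_arrow_def)
  qed
next
  assume "\<forall>x \<in> Ob X. \<exists>R \<in> Ob A. \<exists>\<eta>. biuniversal_arrow A X G x R \<eta>"
  \<comment> \<open>A simultaneous choice for all objects of \<open>X\<close> supplies the data of
    the locale.\<close>
  then obtain R \<eta> where "\<And>x. x \<in> Ob X \<Longrightarrow> biuniversal_arrow A X G x (R x) (\<eta> x)" by metis
  then interpret biuniversal_family A X G R \<eta>
    using assms(3) by (simp add: biuniversal_family_def biuniversal_family_axioms_def)
  show "\<exists>F. left_biadjoint X A F G" using left_biadjoint_left_adj by blast
qed

end
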